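(* Let $A\in\mathbb{R}^{n\times n}$, $B\in\mathbb{R}^{n\times m}$, $E\in\mathbb{R}^{n\times d}$, let $Q\in\mathbb{R}^{n\times n}$ be symmetric with $Q\ge 0$, let $R\in\mathbb{R}^{m\times m}$ be symmetric with $R>0$, let $0<\alpha<1$, $\lambda>0$, and let $\bar w=\frac1N\sum_{j=1}^N v^j\in\mathbb{R}^d$ be the mean of given samples $v^1,\dots,v^N\in\mathbb{R}^d$. Assume that: (i) $BR^{-1}B^{\top}-\frac{1}{\lambda}EE^{\top}>0$, and $(A,\sqrt{Q})$ is observable; (ii) $\lambda>\underline\lambda$, where $\underline\lambda=\inf\{\lambda\mid \lambda I-\alpha E^{\top}PE>0\}$ and $P$ is a positive semidefinite solution of the Riccati equation stated in the context. Let $q=n+m+d$, let $\{\theta_i\}_{i\ge 0}$ be the sequence of parameter vectors produced by the Q-learning algorithm described in the context with trajectory length $M$, and let $\theta=[h^{\top},G^{\top},s]^{\top}$ be the parameter vector of the Q-function of the deterministic zero-sum game described in the context. If $M>\frac12(q+1)(q+2)$, then $\{\theta_i\}$ converges to $\theta$.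
   Context: **Riccati equation and related notation.** For a symmetric matrix $P$ put $H_{xx}=Q+\alpha A^{\top}PA$, $H_{xu}=\alpha A^{\top}PB$, $H_{xw}=\alpha A^{\top}PE$, $H_{uu}=R+\alpha B^{\top}PB$, $H_{uw}=\alpha B^{\top}PE$, $H_{ww}=\alpha E^{\top}PE-\lambda I$. The Riccati equation is $$P=H_{xx}-\begin{bmatrix}H_{xu}&H_{xw}\end{bmatrix}\begin{bmatrix}H_{uu}&H_{uw}\\ H_{uw}^{\top}&H_{ww}\end{bmatrix}^{-1}\begin{bmatrix}H_{xu}^{\top}\\ H_{xw}^{\top}\end{bmatrix}.$$ With $P$ the solution in assumption (ii), $g\in\mathbb{R}^n$ and $z\in\mathbb{R}$ are defined by $$g=G_x-\begin{bmatrix}H_{xu}&H_{xw}\end{bmatrix}\begin{bmatrix}H_{uu}&H_{uw}\\ H_{uw}^{\top}&H_{ww}\end{bmatrix}^{-1}\begin{bmatrix}G_u\\ G_w\end{bmatrix},$$ $$z=\alpha z-\lambda\|\bar w\|^2-\mathrm{tr}\{H_{ww}^{-1}(\lambda^2\Sigma+\tfrac14G_wG_w^{\top})\}-\tfrac14(G_u^{\top}-G_w^{\top}H_{ww}^{-1}H_{uw}^{\top})(H_{uu}-H_{uw}H_{ww}^{-1}H_{uw}^{\top})^{-1}(G_u-H_{uw}H_{ww}^{-1}G_w),$$ where $G_x=\alpha A^{\top}g$, $G_u=\alpha B^{\top}g$, $G_w=\alpha E^{\top}g+2\lambda\bar w$, and $\Sigma=\frac1N\sum_{j=1}^N(v^j-\bar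 w)(v^j-\bar w)^{\top}$. With $V(x)=x^{\top}Px+g^{\top}x+z$, let $z_0$ be the constant (independent of $x,u$) in the identity $$\frac1N\sum_{j=1}^N\max_{w}\{\alpha V(Ax+Bu+Ew)-\lambda\|w-v^j\|^2\}=\max_{w}\{\alpha V(Ax+Bu+Ew)-\lambda\|w-\bar w\|^2\}+z_0 .$$ **Deterministic game and its Q-function.** The game is $$\min\max\sum_{k\ge0}\alpha^k\left(x_k^{\top}Qx_k+u_k^{\top}Ru_k-\lambda\|w_k-\bar w\|^2\right),\qquad x_{k+1}=Ax_k+Bu_k+Ew_k,$$ with minimizing input $u_k\in\mathbb{R}^m$ (a function of the history $x_0,u_0,\dots,x_k$) and maximizing input $w_k\in\mathbb{R}^d$ (a function of that history and $u_k$). Its value function is given by $V^d(x)=x^{\top}Px+g^{\top}x+z-z_0$. The Q-function is $$Q(x,u,w)=x^{\top}Qx+u^{\top}Ru-\lambda\|w-\bar w\|^2+\alpha V^d(Ax+Bu+Ew)=e^{\top}He+G^{\top}e+s,\qquad e=[x^{\top},u^{\top},w^{\top}]^{\top}\in\mathbb{R}^q,$$ where $H$ is the symmetric $q\times q$ matrix with blocks $H_{xx},H_{xu},H_{xw},H_{uu},H_{uw},H_{ww}$, $G=[G_x^{\top},G_u^{\top},G_w^{\top}]^{\top}$, and $s$ is a constant scalar. **Parametrization.** For $e\in\mathbb{R}^q$ let $\bar e$ be the vector of all monomials $e_ae_b$, $1\le a\le b\le q$, and $\tilde e=[\bar e^{\top},e^{\top},1]^{\top}$. A triple $(H,G,s)$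 ($H$ symmetric $q\times q$, $G\in\mathbb{R}^q$, $s\in\mathbb{R}$) is identified with $\theta=[h^{\top},G^{\top},s]^{\top}$, where $h$ is the vector of entries of $H$ with the redundancy due to symmetry removed, so that $h^{\top}\bar e=e^{\top}He$ for all $e$. Write $Q(x,u,w|\theta)=\theta^{\top}\tilde e=e^{\top}He+G^{\top}e+s$ with $e=[x^{\top},u^{\top},w^{\top}]^{\top}$. **Policies from a parameter.** Given $\theta$ with blocks $H_{xx},\dots,H_{ww}$ of $H$ and $G_x,G_u,G_w$ of $G$, the associated affine policies $u(x)=Kx+r$, $w(x)=Lx+l$ are $$K=(H_{uu}-H_{uw}H_{ww}^{-1}H_{uw}^{\top})^{-1}(H_{uw}H_{ww}^{-1}H_{xw}^{\top}-H_{xu}^{\top}),$$ $$r=-\tfrac12(H_{uu}-H_{uw}H_{ww}^{-1}H_{uw}^{\top})^{-1}(G_u-H_{uw}H_{ww}^{-1}G_w),$$ $$L=(H_{ww}-H_{uw}^{\top}H_{uu}^{-1}H_{uw})^{-1}(H_{uw}^{\top}H_{uu}^{-1}H_{xu}^{\top}-H_{xw}^{\top}),$$ $$l=\tfrac12(H_{ww}-H_{uw}^{\top}H_{uu}^{-1}H_{uw})^{-1}(H_{uw}^{\top}H_{uu}^{-1}G_u-G_w).$$ **Q-learning algorithm.** Initialize $\theta_0=0$, $K_0=0$, $r_0=0$, $L_0=0$, $l_0=0$. For $i=0,1,2,\dots$: 1. Sample a trajectory of length $M$ from a fixed initial state $x_0^i=x_0\in\mathbb{R}^n$: for $k=0,\dots,M-1$,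 $u_k^i=K_ix_k^i+r_i+o_k^1$, $w_k^i=L_ix_k^i+l_i+o_k^2$, $x_{k+1}^i=Ax_k^i+Bu_k^i+Ew_k^i$, with exploration noises $o_k^1\sim\mathcal N(0,I_m)$ and $o_k^2\sim\mathcal N(0,I_d)$. 2. With $\tilde e_k^i$ the vector $\tilde e$ built from $e=[x_k^{i\top},u_k^{i\top},w_k^{i\top}]^{\top}$, and $$d_k^i=x_k^{i\top}Qx_k^i+u_k^{i\top}Ru_k^i-\lambda\|w_k^i-\bar w\|^2+\alpha\,Q\left(x_{k+1}^i,\;K_ix_{k+1}^i+r_i,\;L_ix_{k+1}^i+l_i\,\middle|\,\theta_i\right),$$ let $\theta_{i+1}$ be the minimizer over $\vartheta$ of $\sum_{k=0}^{M-1}|\vartheta^{\top}\tilde e_k^i-d_k^i|^2$, that is, $$\theta_{i+1}=\Big(\sum_{k=0}^{M-1}\tilde e_k^i\tilde e_k^{i\top}\Big)^{-1}\sum_{k=0}^{M-1}\tilde e_k^i\,d_k^i.$$ 3. Let $(K_{i+1},r_{i+1})$ and $(L_{i+1},l_{i+1})$ be the policies associated with $\theta_{i+1}$.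
   Formalization: The printed value function x^T P x + g^T x + z − z_0 has a wrong constant in general (when Σ ≠ 0); here V^d is the actual inf-sup value of the deterministic game, and s is the constant fixed by the resulting Q-function, not by z and z_0. *)

theory Defs
  imports "HOL-Probability.Probability" "HOL-Library.Uprod"
begin

definition psd :: "real^'k^'k \<Rightarrow> bool" where
  "psd X \<longleftrightarrow> transpose X = X \<and> (\<forall>x. 0 \<le> x \<bullet> (X *v x))"

definition pd :: "real^'k^'k \<Rightarrow> bool" where
  "pd X \<longleftrightarrow> transpose X = X \<and> (\<forall>x. x \<noteq> 0 \<longrightarrow> 0 < x \<bullet> (X *v x))"

text \<open>Observability of the pair $(A, C)$: in $x_{k+1} = A x_k$, $y_k = C x_k$ the output sequence
  determines the initial state.\<close>

definition observable :: "real^'n^'n \<Rightarrow> real^'n^'p \<Rightarrow> bool" where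
  "observable A C \<longleftrightarrow>
     (\<forall>x x'. (\<forall>k::nat. C *v (((*v) A ^^ k) x) = C *v (((*v) A ^^ k) x')) \<longrightarrow> x = x')"

definition join :: "real^'a \<Rightarrow> real^'b \<Rightarrow> real^('a + 'b)" where
  "join x y = (\<chi> i. case i of Inl a \<Rightarrow> x $ a | Inr b \<Rightarrow> y $ b)"

definition row_block :: "real^'a^'k \<Rightarrow> real^'b^'k \<Rightarrow> real^('a + 'b)^'k" where
  "row_block X Y = (\<chi> i. join (X $ i) (Y $ i))"

text \<open>The matrix with block rows $[X\; Y]$ and $[Y^\top\; Z]$.\<close>

definition sym_block :: "real^'a^'a \<Rightarrow> real^'b^'a \<Rightarrow> real^'b^'b \<Rightarrow> real^('a + 'b)^('a + 'b)" where
  "sym_block X Y Z =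
     (\<chi> i. case i of Inl a \<Rightarrow> row_block X Y $ a | Inr b \<Rightarrow> row_block (transpose Y) Z $ b)"

definition evec :: "real^'n \<Rightarrow> real^'m \<Rightarrow> real^'d \<Rightarrow> real^('n + 'm + 'd)" where
  "evec x u w = join x (join u w)"

definition H_xx :: "real \<Rightarrow> real^'n^'n \<Rightarrow> real^'n^'n \<Rightarrow> real^'n^'n \<Rightarrow> real^'n^'n" where
  "H_xx \<alpha> A Q P = Q + \<alpha> *\<^sub>R (transpose A ** P ** A)"

definition H_xu :: "real \<Rightarrow> real^'n^'n \<Rightarrow> real^'m^'n \<Rightarrow> real^'n^'n \<Rightarrow> real^'m^'n" where
  "H_xu \<alpha> A B P = \<alpha> *\<^sub>R (transpose A ** P ** B)"

definition H_xw :: "real \<Rightarrow> real^'n^'n \<Rightarrow> real^'d^'n \<Rightarrow> real^'n^'n \<Rightarrow> real^'d^'n" where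
  "H_xw \<alpha> A E P = \<alpha> *\<^sub>R (transpose A ** P ** E)"

definition H_uu :: "real \<Rightarrow> real^'m^'n \<Rightarrow> real^'m^'m \<Rightarrow> real^'n^'n \<Rightarrow> real^'m^'m" where
  "H_uu \<alpha> B R P = R + \<alpha> *\<^sub>R (transpose B ** P ** B)"

definition H_uw :: "real \<Rightarrow> real^'m^'n \<Rightarrow> real^'d^'n \<Rightarrow> real^'n^'n \<Rightarrow> real^'d^'m" where
  "H_uw \<alpha> B E P = \<alpha> *\<^sub>R (transpose B ** P ** E)"

definition H_ww :: "real \<Rightarrow> real^'d^'n \<Rightarrow> real \<Rightarrow> real^'n^'n \<Rightarrow> real^'d^'d" where
  "H_ww \<alpha> E lam P = \<alpha> *\<^sub>R (transpose E ** P ** E) - mat lam"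

definition G_x :: "real \<Rightarrow> real^'n^'n \<Rightarrow> real^'n \<Rightarrow> real^'n" where
  "G_x \<alpha> A g = \<alpha> *\<^sub>R (transpose A *v g)"

definition G_u :: "real \<Rightarrow> real^'m^'n \<Rightarrow> real^'n \<Rightarrow> real^'m" where
  "G_u \<alpha> B g = \<alpha> *\<^sub>R (transpose B *v g)"

definition G_w :: "real \<Rightarrow> real^'d^'n \<Rightarrow> real \<Rightarrow> real^'d \<Rightarrow> real^'n \<Rightarrow> real^'d" where
  "G_w \<alpha> E lam wbar g = \<alpha> *\<^sub>R (transpose E *v g) + (2 * lam) *\<^sub>R wbar"

text \<open>The product of block matrices common to the equations for $P$ and for $g$:
  $[H_{xu}\; H_{xw}]$ times the inverse of the lower right block of $H$. The inverse exists if
  $R > 0$, $P \ge 0$ and $\lambda I - \alpha E^\top P E > 0$; elsewhere \<open>matrix_inv\<close> is unspecified.\<close>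

definition riccati_gain ::
  "real \<Rightarrow> real \<Rightarrow> real^'n^'n \<Rightarrow> real^'m^'n \<Rightarrow> real^'d^'n \<Rightarrow> real^'m^'m \<Rightarrow> real^'n^'n \<Rightarrow> real^('m + 'd)^'n"
where
  "riccati_gain \<alpha> lam A B E R P =
     row_block (H_xu \<alpha> A B P) (H_xw \<alpha> A E P) **
     matrix_inv (sym_block (H_uu \<alpha> B R P) (H_uw \<alpha> B E P) (H_ww \<alpha> E lam P))"

definition riccati_solution ::
  "real \<Rightarrow> real \<Rightarrow> real^'n^'n \<Rightarrow> real^'m^'n \<Rightarrow> real^'d^'n \<Rightarrow> real^'n^'n \<Rightarrow> real^'m^'m \<Rightarrow> real^'n^'n \<Rightarrow> bool"
where
  "riccati_solution \<alpha> lam A B E Q R P \<longleftrightarrow>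
     P = H_xx \<alpha> A Q P -
         riccati_gain \<alpha> lam A B E R P ** transpose (row_block (H_xu \<alpha> A B P) (H_xw \<alpha> A E P))"

definition linear_term_equation ::
  "real \<Rightarrow> real \<Rightarrow> real^'n^'n \<Rightarrow> real^'m^'n \<Rightarrow> real^'d^'n \<Rightarrow> real^'m^'m \<Rightarrow> real^'d \<Rightarrow> real^'n^'n \<Rightarrow> real^'n \<Rightarrow> bool"
where
  "linear_term_equation \<alpha> lam A B E R wbar P g \<longleftrightarrow>
     g = G_x \<alpha> A g - riccati_gain \<alpha> lam A B E R P *v join (G_u \<alpha> B g) (G_w \<alpha> E lam wbar g)"

definition H_matrix ::
  "real \<Rightarrow> real \<Rightarrow> real^'n^'n \<Rightarrow> real^'m^'n \<Rightarrow> real^'d^'n \<Rightarrow> real^'n^'n \<Rightarrow> real^'m^'m \<Rightarrow> real^'n^'n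
     \<Rightarrow> real^('n + 'm + 'd)^('n + 'm + 'd)"
where
  "H_matrix \<alpha> lam A B E Q R P =
     sym_block (H_xx \<alpha> A Q P) (row_block (H_xu \<alpha> A B P) (H_xw \<alpha> A E P))
       (sym_block (H_uu \<alpha> B R P) (H_uw \<alpha> B E P) (H_ww \<alpha> E lam P))"

definition G_vector ::
  "real \<Rightarrow> real \<Rightarrow> real^'n^'n \<Rightarrow> real^'m^'n \<Rightarrow> real^'d^'n \<Rightarrow> real^'d \<Rightarrow> real^'n \<Rightarrow> real^('n + 'm + 'd)"
where
  "G_vector \<alpha> lam A B E wbar g = evec (G_x \<alpha> A g) (G_u \<alpha> B g) (G_w \<alpha> E lam wbar g)"

definition next_state ::
  "real^'n^'n \<Rightarrow> real^'m^'n \<Rightarrow> real^'d^'n \<Rightarrow> real^'n \<Rightarrow> real^'m \<Rightarrow> real^'d \<Rightarrow> real^'n" where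
  "next_state A B E x u w = A *v x + B *v u + E *v w"

definition stage_cost ::
  "real^'n^'n \<Rightarrow> real^'m^'m \<Rightarrow> real \<Rightarrow> real^'d \<Rightarrow> real^'n \<Rightarrow> real^'m \<Rightarrow> real^'d \<Rightarrow> real" where
  "stage_cost Q R lam wbar x u w =
     x \<bullet> (Q *v x) + u \<bullet> (R *v u) - lam * (norm (w - wbar))\<^sup>2"

text \<open>The list holds the pairs $(x_0,u_0),\dots,(x_{k-1},u_{k-1})$; since its length is $k$,
  strategies may depend on time.\<close>

type_synonym ('n, 'm) min_strategy = "((real^'n) \<times> (real^'m)) list \<Rightarrow> real^'n \<Rightarrow> real^'m"
type_synonym ('n, 'm, 'd) max_strategy =
  "((real^'n) \<times> (real^'m)) list \<Rightarrow> real^'n \<Rightarrow> real^'m \<Rightarrow> real^'d"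

primrec play ::
  "real^'n^'n \<Rightarrow> real^'m^'n \<Rightarrow> real^'d^'n \<Rightarrow> ('n, 'm) min_strategy \<Rightarrow> ('n, 'm, 'd) max_strategy
     \<Rightarrow> real^'n \<Rightarrow> nat \<Rightarrow> ((real^'n) \<times> (real^'m)) list \<times> (real^'n)"
where
  "play A B E \<pi> \<gamma> x0 0 = ([], x0)"
| "play A B E \<pi> \<gamma> x0 (Suc k) =
     (let (h, x) = play A B E \<pi> \<gamma> x0 k; u = \<pi> h x; w = \<gamma> h x u
      in (h @ [(x, u)], next_state A B E x u w))"

definition play_cost ::
  "real^'n^'n \<Rightarrow> real^'m^'n \<Rightarrow> real^'d^'n \<Rightarrow> real^'n^'n \<Rightarrow> real^'m^'m \<Rightarrow> real \<Rightarrow> real^'d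
     \<Rightarrow> ('n, 'm) min_strategy \<Rightarrow> ('n, 'm, 'd) max_strategy \<Rightarrow> real^'n \<Rightarrow> nat \<Rightarrow> real"
where
  "play_cost A B E Q R lam wbar \<pi> \<gamma> x0 k =
     (let (h, x) = play A B E \<pi> \<gamma> x0 k; u = \<pi> h x; w = \<gamma> h x u
      in stage_cost Q R lam wbar x u w)"

text \<open>The stage costs may have either sign, so for arbitrary strategies the discounted series need not
  converge, even in the extended reals; the upper limit of its partial sums is used.\<close>

definition total_cost ::
  "real \<Rightarrow> real^'n^'n \<Rightarrow> real^'m^'n \<Rightarrow> real^'d^'n \<Rightarrow> real^'n^'n \<Rightarrow> real^'m^'m \<Rightarrow> real \<Rightarrow> real^'d
     \<Rightarrow> ('n, 'm) min_strategy \<Rightarrow> ('n, 'm, 'd) max_strategy \<Rightarrow> real^'n \<Rightarrow> ereal"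
where
  "total_cost \<alpha> A B E Q R lam wbar \<pi> \<gamma> x0 =
     limsup (\<lambda>T. ereal (\<Sum>k<T. \<alpha> ^ k * play_cost A B E Q R lam wbar \<pi> \<gamma> x0 k))"

definition game_value ::
  "real \<Rightarrow> real^'n^'n \<Rightarrow> real^'m^'n \<Rightarrow> real^'d^'n \<Rightarrow> real^'n^'n \<Rightarrow> real^'m^'m \<Rightarrow> real \<Rightarrow> real^'d
     \<Rightarrow> real^'n \<Rightarrow> ereal"
where
  "game_value \<alpha> A B E Q R lam wbar x0 =
     (INF \<pi>. SUP \<gamma>. total_cost \<alpha> A B E Q R lam wbar \<pi> \<gamma> x0)"

definition game_Q ::
  "real \<Rightarrow> real^'n^'n \<Rightarrow> real^'m^'n \<Rightarrow> real^'d^'n \<Rightarrow> real^'n^'n \<Rightarrow> real^'m^'m \<Rightarrow> real \<Rightarrow> real^'d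
     \<Rightarrow> real^'n \<Rightarrow> real^'m \<Rightarrow> real^'d \<Rightarrow> ereal"
where
  "game_Q \<alpha> A B E Q R lam wbar x u w =
     ereal (stage_cost Q R lam wbar x u w) +
     ereal \<alpha> * game_value \<alpha> A B E Q R lam wbar (next_state A B E x u w)"

instance uprod :: (finite) finite
  by standard simp

text \<open>The monomials $e_a e_b$ with $a \le b$ are indexed by the unordered pairs $\{a,b\}$
  (with $a = b$ allowed), so no order on the index type is needed. A parameter vector has
  $q(q+1)/2 + q + 1 = (q+1)(q+2)/2$ entries.\<close>

type_synonym 'q param = "real^('q uprod + 'q + unit)"

lift_definition monomial :: "real^'q \<Rightarrow> 'q uprod \<Rightarrow> real" is
  "\<lambda>e (a, b). e $ a * e $ b"
  by auto

lemma monomial_Upair: "monomial e (Upair a b) = e $ a * e $ b"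
  by transfer simp

definition feature :: "real^'q \<Rightarrow> 'q param" where
  "feature e = join (\<chi> p. monomial e p) (join e (\<chi> _. 1))"

text \<open>The entry of $h$ at $\{a,b\}$ is $H_{aa}$ if $a = b$, and $H_{ab} + H_{ba}$ otherwise.\<close>

definition param_of :: "real^'q^'q \<Rightarrow> real^'q \<Rightarrow> real \<Rightarrow> 'q param" where
  "param_of H G s =
     join (\<chi> p. \<Sum>(a, b) | Upair a b = p. H $ a $ b) (join G (\<chi> _. s))"

definition param_H :: "'q param \<Rightarrow> real^'q^'q" where
  "param_H \<theta> = (\<chi> a b. if a = b then \<theta> $ Inl (Upair a a) else \<theta> $ Inl (Upair a b) / 2)"

definition param_G :: "'q param \<Rightarrow> real^'q" where
  "param_G \<theta> = (\<chi> a. \<theta> $ Inr (Inl a))"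

lemma inner_join: "join a b \<bullet> join c d = a \<bullet> c + b \<bullet> (d::real^'b)"
proof -
  have "join a b \<bullet> join c d = (\<Sum>i\<in>UNIV <+> UNIV. join a b $ i * join c d $ i)"
    by (simp add: inner_vec_def)
  also have "\<dots> = a \<bullet> c + b \<bullet> d"
    by (subst sum.Plus) (auto simp: inner_vec_def join_def)
  finally show ?thesis .
qed

lemma sum_monomials:
  fixes H :: "real^'q^'q" and e :: "real^'q"
  shows "(\<Sum>p\<in>UNIV. (\<Sum>(a, b) | Upair a b = p. H $ a $ b) * monomial e p) = e \<bullet> (H *v e)"
proof -
  have "(\<Sum>p\<in>UNIV. (\<Sum>(a, b) | Upair a b = p. H $ a $ b) * monomial e p)
      = (\<Sum>p\<in>UNIV. \<Sum>x\<in>{x\<in>UNIV. case_prod Upair x = p}. H $ fst x $ snd x * (e $ fst x * e $ snd x))"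
    unfolding sum_distrib_right
    by (intro sum.cong) (auto simp: monomial_Upair)
  also have "\<dots> = (\<Sum>x\<in>UNIV. H $ fst x $ snd x * (e $ fst x * e $ snd x))"
    by (rule sum.group) auto
  also have "\<dots> = (\<Sum>a\<in>UNIV. \<Sum>b\<in>UNIV. H $ a $ b * (e $ a * e $ b))"
    by (subst sum.cartesian_product) (simp add: case_prod_beta)
  also have "\<dots> = e \<bullet> (H *v e)"
    by (simp add: inner_vec_def matrix_vector_mult_def sum_distrib_left algebra_simps)
  finally show ?thesis .
qed

lemma param_of_feature: "param_of H G s \<bullet> feature e = e \<bullet> (H *v e) + G \<bullet> e + s"
  unfolding param_of_def feature_def inner_join
  by (simp add: inner_vec_def[of "vec_lambda _"] sum_monomials)

lemma param_H_param_of: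
  assumes "transpose H = H"
  shows "param_H (param_of H G s) = H"
proof -
  have s: "H $ b $ a = H $ a $ b" for a b 
    using assms by (metis transpose_def vec_lambda_beta)
  have *: "{(x, y). Upair x y = Upair a b} = {(a,b),(b,a)}" for a b :: 'a by auto
  have "(\<Sum>(x, y) | Upair x y = Upair a b. H $ x $ y) = (if a = b then H $ a $ a else 2 * H $ a $ b)" for a b
    unfolding * using s[of a b] by auto
  then show ?thesis
    by (simp add: param_H_def param_of_def join_def vec_eq_iff)
qed

definition param_Q ::
  "('n + 'm + 'd) param \<Rightarrow> real^'n \<Rightarrow> real^'m \<Rightarrow> real^'d \<Rightarrow> real" where
  "param_Q \<theta> x u w = \<theta> \<bullet> feature (evec x u w)"

definition policy_K ::
  "real^'m^'n \<Rightarrow> real^'d^'n \<Rightarrow> real^'m^'m \<Rightarrow> real^'d^'m \<Rightarrow> real^'d^'d \<Rightarrow> real^'n^'m" where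
  "policy_K Hxu Hxw Huu Huw Hww =
     matrix_inv (Huu - Huw ** matrix_inv Hww ** transpose Huw) **
     (Huw ** matrix_inv Hww ** transpose Hxw - transpose Hxu)"

definition policy_r ::
  "real^'m^'m \<Rightarrow> real^'d^'m \<Rightarrow> real^'d^'d \<Rightarrow> real^'m \<Rightarrow> real^'d \<Rightarrow> real^'m" where
  "policy_r Huu Huw Hww Gu Gw =
     (- 1 / 2) *\<^sub>R (matrix_inv (Huu - Huw ** matrix_inv Hww ** transpose Huw) *v
       (Gu - (Huw ** matrix_inv Hww) *v Gw))"

definition policy_L ::
  "real^'m^'n \<Rightarrow> real^'d^'n \<Rightarrow> real^'m^'m \<Rightarrow> real^'d^'m \<Rightarrow> real^'d^'d \<Rightarrow> real^'n^'d" where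
  "policy_L Hxu Hxw Huu Huw Hww =
     matrix_inv (Hww - transpose Huw ** matrix_inv Huu ** Huw) **
     (transpose Huw ** matrix_inv Huu ** transpose Hxu - transpose Hxw)"

definition policy_l ::
  "real^'m^'m \<Rightarrow> real^'d^'m \<Rightarrow> real^'d^'d \<Rightarrow> real^'m \<Rightarrow> real^'d \<Rightarrow> real^'d" where
  "policy_l Huu Huw Hww Gu Gw =
     (1 / 2) *\<^sub>R (matrix_inv (Hww - transpose Huw ** matrix_inv Huu ** Huw) *v
       ((transpose Huw ** matrix_inv Huu) *v Gu - Gw))"

type_synonym ('n, 'm, 'd) policies = "(real^'n^'m) \<times> (real^'m) \<times> (real^'n^'d) \<times> (real^'d)"

definition policies_of ::
  "('n::finite + 'm::finite + 'd::finite) param \<Rightarrow> ('n, 'm, 'd) policies" where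
  "policies_of \<theta> =
     (let H = param_H \<theta>; G = param_G \<theta>;
          Hxu = (\<chi> i j. H $ Inl i $ Inr (Inl j));
          Hxw = (\<chi> i j. H $ Inl i $ Inr (Inr j));
          Huu = (\<chi> i j. H $ Inr (Inl i) $ Inr (Inl j));
          Huw = (\<chi> i j. H $ Inr (Inl i) $ Inr (Inr j));
          Hww = (\<chi> i j. H $ Inr (Inr i) $ Inr (Inr j));
          Gu = (\<chi> i. G $ Inr (Inl i));
          Gw = (\<chi> i. G $ Inr (Inr i))
      in (policy_K Hxu Hxw Huu Huw Hww, policy_r Huu Huw Hww Gu Gw,
          policy_L Hxu Hxw Huu Huw Hww, policy_l Huu Huw Hww Gu Gw))"

definition std_gaussian_density :: "real^'k \<Rightarrow> real" where
  "std_gaussian_density x = (2 * pi) powr (- real CARD('k) / 2) * exp (- (norm x)\<^sup>2 / 2)"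

text \<open>Mutual independence of all the vectors $X_{i,k}$ and $Y_{i,k}$ together, through the
  sigma-algebras they generate (the library's \<open>indep_vars\<close> needs a common codomain type).\<close>

definition (in prob_space) indep_noises ::
  "(nat \<Rightarrow> nat \<Rightarrow> 'a \<Rightarrow> real^'m) \<Rightarrow> (nat \<Rightarrow> nat \<Rightarrow> 'a \<Rightarrow> real^'d) \<Rightarrow> bool" where
  "indep_noises X Y \<longleftrightarrow>
     indep_sets
       (\<lambda>j. case j of
           Inl (i, k) \<Rightarrow> {X i k -` S \<inter> space M | S. S \<in> sets borel}
         | Inr (i, k) \<Rightarrow> {Y i k -` S \<inter> space M | S. S \<in> sets borel})
       UNIV"

primrec trajectory ::
  "real^'n^'n \<Rightarrow> real^'m^'n \<Rightarrow> real^'d^'n \<Rightarrow> ('n, 'm, 'd) policies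
     \<Rightarrow> (nat \<Rightarrow> real^'m) \<Rightarrow> (nat \<Rightarrow> real^'d) \<Rightarrow> real^'n \<Rightarrow> nat \<Rightarrow> real^'n"
where
  "trajectory A B E pol o1 o2 x0 0 = x0"
| "trajectory A B E pol o1 o2 x0 (Suc k) =
     (let (K, r, L, l) = pol; x = trajectory A B E pol o1 o2 x0 k
      in next_state A B E x (K *v x + r + o1 k) (L *v x + l + o2 k))"

definition outer :: "real^'k \<Rightarrow> real^'k^'k" where
  "outer v = (\<chi> i j. v $ i * v $ j)"

definition fit ::
  "real \<Rightarrow> real^'n^'n \<Rightarrow> real^'m^'n \<Rightarrow> real^'d^'n \<Rightarrow> real^'n^'n \<Rightarrow> real^'m^'m \<Rightarrow> real \<Rightarrow> real^'d
     \<Rightarrow> nat \<Rightarrow> real^'n \<Rightarrow> (nat \<Rightarrow> real^'m) \<Rightarrow> (nat \<Rightarrow> real^'d)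
     \<Rightarrow> ('n + 'm + 'd) param \<Rightarrow> ('n, 'm, 'd) policies \<Rightarrow> ('n + 'm + 'd) param"
where
  "fit \<alpha> A B E Q R lam wbar M x0 o1 o2 \<theta> pol =
     (let (K, r, L, l) = pol;
          x = trajectory A B E pol o1 o2 x0;
          u = (\<lambda>k. K *v x k + r + o1 k);
          w = (\<lambda>k. L *v x k + l + o2 k);
          f = (\<lambda>k. feature (evec (x k) (u k) (w k)));
          d = (\<lambda>k. stage_cost Q R lam wbar (x k) (u k) (w k) +
                 \<alpha> * param_Q \<theta> (x (Suc k)) (K *v x (Suc k) + r) (L *v x (Suc k) + l))
      in matrix_inv (\<Sum>k<M. outer (f k)) *v (\<Sum>k<M. d k *\<^sub>R f k))"

primrec q_learning ::
  "real \<Rightarrow> real^'n^'n \<Rightarrow> real^'m^'n \<Rightarrow> real^'d^'n \<Rightarrow> real^'n^'n \<Rightarrow> real^'m^'m \<Rightarrow> real \<Rightarrow> real^'d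
     \<Rightarrow> nat \<Rightarrow> real^'n \<Rightarrow> (nat \<Rightarrow> nat \<Rightarrow> real^'m) \<Rightarrow> (nat \<Rightarrow> nat \<Rightarrow> real^'d)
     \<Rightarrow> nat \<Rightarrow> ('n + 'm + 'd) param \<times> ('n, 'm, 'd) policies"
where
  "q_learning \<alpha> A B E Q R lam wbar M x0 o1 o2 0 = (0, (0, 0, 0, 0))"
| "q_learning \<alpha> A B E Q R lam wbar M x0 o1 o2 (Suc i) =
     (let (\<theta>, pol) = q_learning \<alpha> A B E Q R lam wbar M x0 o1 o2 i;
          \<theta>' = fit \<alpha> A B E Q R lam wbar M x0 (o1 i) (o2 i) \<theta> pol
      in (\<theta>', policies_of \<theta>'))"

end

theory Submission
  imports Defs
begin

text \<open>Each saddle point of the stage game is the minimizer of a linear-quadratic regulator problem without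
  adversary, in which the fully actuated input \<open>y = B u + E (w - wbar)\<close> is weighted by the inverse of
  \<open>S = B R\<^sup>-\<^sup>1 B\<^sup>T - E E\<^sup>T / lam > 0\<close>. Its Bellman operator \<open>T\<close> is monotone and concave, and it has the fixed
  point \<open>V\<close> given by the Riccati equation. By observability \<open>T\<^sup>n 0\<close> is positive definite for some \<open>n\<close>, hence
  \<open>T\<^sup>n 0 \<ge> s V - C\<close> with \<open>s > 0\<close>, and concavity yields \<open>T\<^sup>k\<^sup>n 0 \<ge> (1 - (1 - s)\<^sup>k) V - o(1)\<close>. As
  \<open>T\<^sup>i 0 \<le> V + O(\<alpha>\<^sup>i)\<close>, value iteration from \<open>0\<close> converges to \<open>V\<close>; this also shows that \<open>V\<close> is the value of the game.

  If the sampled features span the parameter space, the least squares fit is exact, so that the iterates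
  are deterministic and coincide with value iteration. The Gram determinant of the features is a polynomial
  in the independent absolutely continuous noises, so it is almost surely nonzero if it is nonzero for
  one choice of the noises. Such a choice exists: among the trajectories with free initial state
  the maximal rank of \<open>k\<close> consecutive features strictly increases until it is full, and one more sample is
  enough to steer the given initial state to the start of a trajectory of full rank.\<close>

text \<open>The stage game is concave in \<open>w\<close> only while
  \<open>mat lam - \<alpha> *\<^sub>R (transpose E ** P ** E)\<close> is positive definite, so the
  iterates must be kept in that region before the reduction to a regulator applies to them. The
  hypothesis on \<open>lam\<close> puts the Riccati solution there; the iterates follow because
  their quadratic parts stay below \<open>P\<close>. The bound
  \<open>vi i x \<le> V x + \<alpha> ^ i * C\<close> carries a correction because
  \<open>V \<ge> 0\<close> is itself a consequence of the convergence; beforehand only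
  \<open>V \<ge> - C\<close> is known. Comparing leading forms is blind to such constants.

  The policy of each learning round depends on the preceding fit and is therefore random a priori.
  Excitation is proved for the deterministic policies of exact value iteration, one round at a time;
  only then, outside a countable union of null sets, is the learning sequence identified with value
  iteration by induction.\<close>

declare transpose_matrix_vector [simp del]

section \<open>Transposes, inverses and definite matrices\<close>

lemma inner_mult_right: "x \<bullet> (X *v y) = (transpose X *v x) \<bullet> y" for X :: "real^'a^'b"
  by (simp add: dot_lmul_matrix transpose_matrix_vector)

lemma inner_mult_left: "(X *v x) \<bullet> y = x \<bullet> (transpose X *v y)" for X :: "real^'a^'b"
  by (metis inner_commute inner_mult_right)

lemma transpose_diff: "transpose (X - Y) = transpose X - transpose Y"
  by (simp add: transpose_def vec_eq_iff)

lemma transpose_add: "transpose (X + Y) = transpose X + transpose Y"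
  by (simp add: transpose_def vec_eq_iff)

lemma transpose_scaleR: "transpose (c *\<^sub>R X) = c *\<^sub>R transpose X" for X :: "real^'a^'b"
  by (simp add: transpose_def vec_eq_iff)

lemma mat_mult_vec: "mat c *v x = c *\<^sub>R x" for x :: "real^'k"
  by (simp add: mat_def matrix_vector_mult_def vec_eq_iff if_distrib[where f="\<lambda>a. a * _"] sum.delta cong: if_cong)

lemma scaleR_matrix_vector: "(c *\<^sub>R X) *v x = c *\<^sub>R (X *v x)" for X :: "real^'a^'b"
  by (simp add: matrix_vector_mult_def vec_eq_iff sum_distrib_left mult.assoc)

text \<open>\<open>matrix_inv\<close> is a choice, so nothing is known about it before invertibility
  is. The criterion is a trivial kernel rather than definiteness because it must also serve the
  indefinite matrix \<open>Hv P\<close>.\<close>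

lemma inverse_of_injective:
  fixes X :: "real^'k^'k"
  assumes "\<And>x. X *v x = 0 \<Longrightarrow> x = 0"
  shows "X ** matrix_inv X = mat 1" "matrix_inv X ** X = mat 1"
proof -
  have "inj ((*v) X)"
    using assms by (metis (no_types, lifting) injI matrix_left_invertible_injective
        matrix_left_invertible_ker)
  then have "invertible X"
    using invertible_left_inverse matrix_left_invertible_injective by blast
  then have "\<exists>Y. X ** Y = mat 1 \<and> Y ** X = mat 1"
    unfolding invertible_def .
  then have "X ** matrix_inv X = mat 1 \<and> matrix_inv X ** X = mat 1"
    unfolding matrix_inv_def by (rule someI_ex)
  then show "X ** matrix_inv X = mat 1" "matrix_inv X ** X = mat 1" by auto
qed

lemma inverse_mult_vec:
  fixes X :: "real^'k^'k"
  assumes "\<And>x. X *v x = 0 \<Longrightarrow> x = 0"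
  shows "X *v (matrix_inv X *v y) = y" "matrix_inv X *v (X *v y) = y"
  by (simp_all add: matrix_vector_mul_assoc inverse_of_injective[OF assms])

lemma inverse_symmetric:
  fixes X :: "real^'k^'k"
  assumes "\<And>x. X *v x = 0 \<Longrightarrow> x = 0" and "transpose X = X"
  shows "transpose (matrix_inv X) = matrix_inv X"
proof -
  have 1: "transpose (matrix_inv X) ** X = mat 1"
    using inverse_of_injective(1)[OF assms(1)] by (metis assms(2) matrix_transpose_mul transpose_mat)
  have "transpose (matrix_inv X) = transpose (matrix_inv X) ** (X ** matrix_inv X)"
    by (simp add: inverse_of_injective[OF assms(1)])
  also have "\<dots> = matrix_inv X"
    by (simp only: matrix_mul_assoc 1 matrix_mul_lid)
  finally show ?thesis .
qed

lemma pd_injective: "pd X \<Longrightarrow> X *v x = 0 \<Longrightarrow> x = 0"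
  unfolding pd_def by (metis inner_zero_right less_irrefl)

lemma pd_inverse:
  assumes "pd X"
  shows "X *v (matrix_inv X *v y) = y" "matrix_inv X *v (X *v y) = y"
  using inverse_mult_vec[of X y] pd_injective[OF assms] by auto

lemma pd_matrix_inv:
  assumes "pd X"
  shows "pd (matrix_inv X)"
  unfolding pd_def
proof (intro conjI allI impI)
  show "transpose (matrix_inv X) = matrix_inv X"
    using pd_injective[OF assms] assms by (intro inverse_symmetric) (simp_all add: pd_def)
  fix x :: "real^'a" assume "x \<noteq> 0"
  then have "matrix_inv X *v x \<noteq> 0"
    using pd_inverse(1)[OF assms] by (metis matrix_vector_mult_0_right)
  then have "0 < (matrix_inv X *v x) \<bullet> (X *v (matrix_inv X *v x))"
    using assms by (simp add: pd_def)
  then show "0 < x \<bullet> (matrix_inv X *v x)"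
    by (simp add: pd_inverse(1)[OF assms] inner_commute)
qed

lemma pd_imp_psd: "pd X \<Longrightarrow> psd X"
  unfolding pd_def psd_def by (metis inner_zero_left less_imp_le order_refl)

lemma symmetric_inner: "transpose X = X \<Longrightarrow> x \<bullet> (X *v y) = y \<bullet> (X *v x)" for X :: "real^'k^'k"
  by (metis inner_commute inner_mult_right)

text \<open>Along \<open>x + t *\<^sub>R y\<close> with \<open>y = X *v x\<close> the form is a
  polynomial in \<open>t\<close> of degree at most two without constant term; being nonnegative, it
  has no linear term \<open>2 * t * (y \<bullet> y)\<close> either.\<close>

lemma psd_kernel:
  assumes "psd X" and "x \<bullet> (X *v x) = 0"
  shows "X *v x = 0"
proof (rule ccontr)
  define y where "y = X *v x"
  assume "X *v x \<noteq> 0"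
  then have y: "y \<bullet> y > 0" by (simp add: y_def)
  have sym: "transpose X = X" using assms(1) by (simp add: psd_def)
  have *: "0 \<le> 2 * t * (y \<bullet> y) + t\<^sup>2 * (y \<bullet> (X *v y))" for t
  proof -
    have "0 \<le> (x + t *\<^sub>R y) \<bullet> (X *v (x + t *\<^sub>R y))"
      using assms(1) by (simp add: psd_def)
    also have "\<dots> = 2 * t * (y \<bullet> y) + t\<^sup>2 * (y \<bullet> (X *v y))"
    proof -
      have "x \<bullet> (X *v y) = y \<bullet> y"
        using symmetric_inner[OF sym, of x y] by (simp add: y_def)
      then show ?thesis
        using assms(2) unfolding matrix_vector_right_distrib matrix_vector_mult_scaleR y_def[symmetric]
        by (simp add: inner_add_left inner_add_right power2_eq_square algebra_simps)
    qed
    finally show ?thesis .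
  qed
  define b where "b = y \<bullet> (X *v y)"
  have b: "b \<ge> 0" using assms(1) by (simp add: psd_def b_def)
  \<comment> \<open>A negative \<open>t\<close> small enough for the linear term to win; the summand
    1 keeps the denominator positive when \<open>b = 0\<close>.\<close>
  define t where "t = - (y \<bullet> y) / (b + 1)"
  have "t * (b + 1) = - (y \<bullet> y)" using b by (simp add: t_def)
  then have tb: "t * b = - (y \<bullet> y) - t" by (simp add: algebra_simps)
  have t: "t < 0" using y b by (simp add: t_def divide_neg_pos)
  have "0 \<le> t * (2 * (y \<bullet> y) + t * b)"
    using *[of t] by (simp add: b_def power2_eq_square algebra_simps)
  then have "2 * (y \<bullet> y) + t * b \<le> 0"
    using t by (simp add: zero_le_mult_iff)
  then show False
    using y t tb by linarith
qed

subsection \<open>Block matrices\<close>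

lemma join_cong: "join a b = join c d \<longleftrightarrow> a = c \<and> b = d"
proof
  assume *: "join a b = join c d"
  have "a $ i = c $ i" for i using arg_cong[OF *, of "\<lambda>v. v $ Inl i"] by (simp add: join_def)
  moreover have "b $ i = d $ i" for i using arg_cong[OF *, of "\<lambda>v. v $ Inr i"] by (simp add: join_def)
  ultimately show "a = c \<and> b = d" by (simp add: vec_eq_iff)
qed simp

lemma join_surj: obtains a b where "v = join a b"
proof
  show "v = join (\<chi> i. v $ Inl i) (\<chi> i. v $ Inr i)"
    by (simp add: join_def vec_eq_iff split: sum.split)
qed

lemma join_0 [simp]: "join 0 0 = 0"
  by (simp add: join_def vec_eq_iff split: sum.split)

lemma join_add: "join a b + join c d = join (a + c) (b + d)"
  by (simp add: join_def vec_eq_iff split: sum.split)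

lemma join_scaleR: "t *\<^sub>R join a b = join (t *\<^sub>R a) (t *\<^sub>R b)"
  by (simp add: join_def vec_eq_iff split: sum.split)

lemma row_block_mult: "row_block X Y *v join a b = X *v a + Y *v b"
proof -
  have "(row_block X Y *v join a b) $ i = (X *v a + Y *v b) $ i" for i
    using inner_join[of "X $ i" "Y $ i" a b]
    by (simp add: row_block_def matrix_vector_mul_component)
  then show ?thesis by (simp add: vec_eq_iff)
qed

lemma transpose_row_block_mult:
  "transpose (row_block X Y) *v x = join (transpose X *v x) (transpose Y *v x)"
  by (simp add: vec_eq_iff row_block_def join_def matrix_vector_mult_def transpose_def split: sum.split)

lemma sym_block_mult:
  "sym_block X Y Z *v join a b = join (X *v a + Y *v b) (transpose Y *v a + Z *v b)"
proof -
  have "(sym_block X Y Z *v join a b) $ i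
      = (join (X *v a + Y *v b) (transpose Y *v a + Z *v b)) $ i" for i
    using inner_join[of "X $ projl i" "Y $ projl i" a b]
      inner_join[of "transpose Y $ projr i" "Z $ projr i" a b]
    by (cases i) (simp_all add: sym_block_def row_block_def matrix_vector_mul_component join_def)
  then show ?thesis by (simp add: vec_eq_iff)
qed

lemma sym_block_symmetric:
  assumes "transpose X = X" and "transpose Z = Z"
  shows "transpose (sym_block X Y Z) = sym_block X Y Z"
proof -
  have "X $ i $ j = X $ j $ i" for i j using assms(1) by (metis transpose_def vec_lambda_beta)
  moreover have "Z $ i $ j = Z $ j $ i" for i j using assms(2) by (metis transpose_def vec_lambda_beta)
  ultimately show ?thesis
    by (auto simp: vec_eq_iff transpose_def sym_block_def row_block_def join_def split: sum.split)
qed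

section \<open>Quadratic functions and the saddle point of the stage game\<close>

definition quad :: "real^'k^'k \<Rightarrow> real^'k \<Rightarrow> real \<Rightarrow> real^'k \<Rightarrow> real" where
  "quad P g c x = x \<bullet> (P *v x) + g \<bullet> x + c"

lemma matrix_vector_mult_minus: "X *v (- x) = - (X *v x)" for X :: "real^'a^'b"
  using matrix_vector_mult_scaleR[of X "-1" x] by simp

lemmas matrix_vector_simps = matrix_vector_mul_assoc[symmetric] scaleR_matrix_vector mat_mult_vec
  matrix_vector_mult_add_rdistrib matrix_vector_mult_diff_rdistrib
  matrix_vector_right_distrib matrix_vector_mult_diff_distrib matrix_vector_mult_scaleR

lemma inner_transpose: "x \<bullet> (transpose X *v y) = (X *v x) \<bullet> y" "(transpose X *v y) \<bullet> x = y \<bullet> (X *v x)"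
  for X :: "real^'a^'b"
  by (simp_all add: inner_mult_left)

lemmas inner_expand = inner_add_left inner_add_right inner_diff_left inner_diff_right
  inner_scaleR_left inner_scaleR_right

text \<open>Observability and the Riccati solution stay out of this locale so that it can be
  interpreted a second time with \<open>wbar = 0\<close>, which isolates the quadratic part of the
  Bellman step.\<close>

locale lq_game =
  fixes A :: "real^'n^'n" and B :: "real^'m^'n" and E :: "real^'d^'n"
    and Q :: "real^'n^'n" and R :: "real^'m^'m" and \<alpha> lam :: real and wbar :: "real^'d"
  assumes psd_Q: "psd Q" and pd_R: "pd R"
    and \<alpha>_pos: "0 < \<alpha>" and \<alpha>_less: "\<alpha> < 1" and lam_pos: "0 < lam"
    and pd_S: "pd (B ** matrix_inv R ** transpose B - (1 / lam) *\<^sub>R (E ** transpose E))"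
begin

abbreviation Hxx where "Hxx P \<equiv> H_xx \<alpha> A Q P"
abbreviation Hxu where "Hxu P \<equiv> H_xu \<alpha> A B P"
abbreviation Hxw where "Hxw P \<equiv> H_xw \<alpha> A E P"
abbreviation Huu where "Huu P \<equiv> H_uu \<alpha> B R P"
abbreviation Huw where "Huw P \<equiv> H_uw \<alpha> B E P"
abbreviation Hww where "Hww P \<equiv> H_ww \<alpha> E lam P"
abbreviation Gx where "Gx g \<equiv> G_x \<alpha> A g"
abbreviation Gu where "Gu g \<equiv> G_u \<alpha> B g"
abbreviation Gw where "Gw g \<equiv> G_w \<alpha> E lam wbar g"
abbreviation Hc where "Hc P \<equiv> row_block (Hxu P) (Hxw P)"
abbreviation Hv where "Hv P \<equiv> sym_block (Huu P) (Huw P) (Hww P)"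
abbreviation Gv where "Gv g \<equiv> join (Gu g) (Gw g)"

text \<open>If both players respond to one costate \<open>p\<close> by
  \<open>u = - (matrix_inv R *v (transpose B *v p))\<close> and
  \<open>w - wbar = (1 / lam) *\<^sub>R (transpose E *v p)\<close>, their joint push on the state is
  \<open>- (S *v p)\<close>.\<close>

definition S :: "real^'n^'n" where
  "S = B ** matrix_inv R ** transpose B - (1 / lam) *\<^sub>R (E ** transpose E)"

definition ahead :: "(real^'n \<Rightarrow> real) \<Rightarrow> real^'n \<Rightarrow> real^'m \<Rightarrow> real^'d \<Rightarrow> real" where
  "ahead f x u w = stage_cost Q R lam wbar x u w + \<alpha> * f (next_state A B E x u w)"

text \<open>The second condition is negative definiteness of \<open>Hww P\<close>, that is, strict
  concavity of the stage game in \<open>w\<close>; together with the positive definite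
  \<open>Huu P\<close> it gives \<open>Hv P\<close> the shape of a saddle.\<close>

definition admissible :: "real^'n^'n \<Rightarrow> bool" where
  "admissible P \<longleftrightarrow> psd P \<and> pd (mat lam - \<alpha> *\<^sub>R (transpose E ** P ** E))"

definition riccati :: "real^'n^'n \<Rightarrow> real^'n^'n" where
  "riccati P = Hxx P - riccati_gain \<alpha> lam A B E R P ** transpose (Hc P)"

definition linear_step :: "real^'n^'n \<Rightarrow> real^'n \<Rightarrow> real^'n" where
  "linear_step P g = Gx g - riccati_gain \<alpha> lam A B E R P *v Gv g"

definition const_step :: "real^'n^'n \<Rightarrow> real^'n \<Rightarrow> real \<Rightarrow> real" where
  "const_step P g c = \<alpha> * c - lam * (wbar \<bullet> wbar) - (Gv g \<bullet> (matrix_inv (Hv P) *v Gv g)) / 4"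

text \<open>Half the gradient of \<open>ahead (quad P g c) x\<close> in the pair of inputs, set to
  zero, for symmetric \<open>P\<close>.\<close>

definition stationary :: "real^'n^'n \<Rightarrow> real^'n \<Rightarrow> real^'n \<Rightarrow> real^'m \<Rightarrow> real^'d \<Rightarrow> bool" where
  "stationary P g x u w \<longleftrightarrow>
     Hv P *v join u w = - (transpose (Hc P) *v x + (1 / 2) *\<^sub>R Gv g)"

text \<open>Half the gradient of \<open>\<alpha> * quad P g c\<close> at the next state, for
  symmetric \<open>P\<close>: the multiplier in the optimality conditions.\<close>

definition costate :: "real^'n^'n \<Rightarrow> real^'n \<Rightarrow> real^'n \<Rightarrow> real^'m \<Rightarrow> real^'d \<Rightarrow> real^'n" where
  "costate P g x u w = \<alpha> *\<^sub>R (P *v next_state A B E x u w + (1 / 2) *\<^sub>R g)"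

lemma H_matrix_eq: "H_matrix \<alpha> lam A B E Q R P = sym_block (Hxx P) (Hc P) (Hv P)"
  by (simp add: H_matrix_def)

lemma G_vector_eq: "G_vector \<alpha> lam A B E wbar g = join (Gx g) (Gv g)"
  by (simp add: G_vector_def evec_def)

lemma symmetric_blocks:
  assumes "transpose P = P"
  shows "transpose (Hxx P) = Hxx P" "transpose (Huu P) = Huu P" "transpose (Hww P) = Hww P"
    "transpose (Hv P) = Hv P"
proof -
  show "transpose (Hxx P) = Hxx P"
    using psd_Q assms by (simp add: psd_def H_xx_def transpose_add transpose_scaleR matrix_transpose_mul matrix_mul_assoc)
  show 1: "transpose (Huu P) = Huu P"
    using pd_R assms by (simp add: pd_def H_uu_def transpose_add transpose_scaleR matrix_transpose_mul matrix_mul_assoc)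
  show 2: "transpose (Hww P) = Hww P"
    using assms by (simp add: H_ww_def transpose_diff transpose_scaleR matrix_transpose_mul matrix_mul_assoc transpose_mat)
  show "transpose (Hv P) = Hv P"
    by (rule sym_block_symmetric[OF 1 2])
qed

lemma H_matrix_symmetric: "transpose P = P \<Longrightarrow> transpose (H_matrix \<alpha> lam A B E Q R P) = H_matrix \<alpha> lam A B E Q R P"
  unfolding H_matrix_eq by (intro sym_block_symmetric symmetric_blocks)

lemma ahead_quad_join:
  assumes "transpose P = P"
  shows "ahead (quad P g c) x u w = x \<bullet> (Hxx P *v x) + 2 * ((transpose (Hc P) *v x) \<bullet> join u w)
    + join u w \<bullet> (Hv P *v join u w) + Gx g \<bullet> x + Gv g \<bullet> join u w + (\<alpha> * c - lam * (wbar \<bullet> wbar))"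
proof -
  have sym: "y \<bullet> (P *v z) = z \<bullet> (P *v y)" for y z
    by (rule symmetric_inner[OF assms])
  show ?thesis
    unfolding ahead_def quad_def stage_cost_def next_state_def sym_block_mult transpose_row_block_mult inner_join
      H_xx_def H_xu_def H_xw_def H_uu_def H_uw_def H_ww_def G_x_def G_u_def G_w_def
      transpose_scaleR matrix_transpose_mul transpose_transpose assms matrix_vector_simps inner_expand inner_transpose
      dot_square_norm[symmetric]
    using sym[of "B *v u" "A *v x"] sym[of "E *v w" "A *v x"] sym[of "E *v w" "B *v u"] inner_commute[of w wbar]
      inner_commute[of "P *v (A *v x)" "B *v u"] inner_commute[of "P *v (A *v x)" "E *v w"]
    by (simp only: ring_distribs inner_commute[of g])
qed


lemma pd_Huu:
  assumes "psd P"
  shows "pd (Huu P)"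
  unfolding pd_def
proof (intro conjI allI impI)
  show "transpose (Huu P) = Huu P" using assms by (simp add: symmetric_blocks psd_def)
  fix u :: "real^'m" assume "u \<noteq> 0"
  then have "0 < u \<bullet> (R *v u)" using pd_R by (simp add: pd_def)
  moreover have "0 \<le> (B *v u) \<bullet> (P *v (B *v u))" using assms by (simp add: psd_def)
  ultimately show "0 < u \<bullet> (Huu P *v u)"
    using \<alpha>_pos by (simp add: H_uu_def matrix_vector_simps inner_expand inner_transpose add_pos_nonneg)
qed

lemma Hww_negative:
  assumes "admissible P" and "w \<noteq> 0"
  shows "w \<bullet> (Hww P *v w) < 0"
proof -
  have "0 < w \<bullet> ((mat lam - \<alpha> *\<^sub>R (transpose E ** P ** E)) *v w)"
    using assms by (simp add: admissible_def pd_def)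
  then show ?thesis
    by (simp add: H_ww_def matrix_vector_simps inner_expand)
qed

lemma Hww_nonpos: "admissible P \<Longrightarrow> w \<bullet> (Hww P *v w) \<le> 0"
  using Hww_negative[of P w] by (cases "w = 0") auto

text \<open>Pairing the first block row with \<open>u\<close> and the second with \<open>w\<close>
  produces the same mixed term, so
  \<open>u \<bullet> (Huu P *v u) = w \<bullet> (Hww P *v w)\<close>. The left side is nonnegative,
  the right side nonpositive, and each vanishes only at zero.\<close>

lemma Hv_injective:
  assumes "admissible P" and "Hv P *v v = 0"
  shows "v = 0"
proof -
  have P: "psd P" using assms by (simp add: admissible_def)
  obtain u w where v: "v = join u w" by (rule join_surj)
  have 1: "Huu P *v u + Huw P *v w = 0" and 2: "transpose (Huw P) *v u + Hww P *v w = 0"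
    using assms(2) unfolding v sym_block_mult join_0[symmetric] join_cong by auto
  have "u \<bullet> (Huu P *v u) + u \<bullet> (Huw P *v w) = 0" using arg_cong[OF 1, of "inner u"] by (simp add: inner_expand)
  moreover have "u \<bullet> (Huw P *v w) + w \<bullet> (Hww P *v w) = 0"
    using arg_cong[OF 2, of "inner w"] by (simp add: inner_add_right inner_transpose(1) inner_commute)
  ultimately have "u \<bullet> (Huu P *v u) = w \<bullet> (Hww P *v w)" by simp
  moreover have "w \<bullet> (Hww P *v w) \<le> 0" by (rule Hww_nonpos[OF assms(1)])
  moreover have "0 < u \<bullet> (Huu P *v u)" if "u \<noteq> 0" using pd_Huu[OF P] that by (simp add: pd_def)
  ultimately have u: "u = 0" by (cases "u = 0") auto
  then have "w = 0"
    using \<open>u \<bullet> (Huu P *v u) = w \<bullet> (Hww P *v w)\<close> Hww_negative[OF assms(1), of w] by (cases "w = 0") auto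
  then show ?thesis using u v by simp
qed

lemma stationary_exists:
  assumes "admissible P"
  obtains u w where "stationary P g x u w"
  using inverse_mult_vec(1)[of "Hv P", OF Hv_injective[OF assms]] join_surj
  unfolding stationary_def by metis

lemma stationary_eq:
  "stationary P g x u w \<longleftrightarrow>
     Huu P *v u + Huw P *v w = - (transpose (Hxu P) *v x + (1 / 2) *\<^sub>R Gu g) \<and>
     transpose (Huw P) *v u + Hww P *v w = - (transpose (Hxw P) *v x + (1 / 2) *\<^sub>R Gw g)"
proof -
  have "- join a b = join (- a) (- b)" for a :: "real^'m" and b :: "real^'d"
    using join_scaleR[of "-1" a b] by simp
  then show ?thesis
    unfolding stationary_def sym_block_mult transpose_row_block_mult join_scaleR join_add
    by (simp add: join_cong)
qed

text \<open>The two block equations decouple once everything that depends on the next state is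
  collected in the costate. This is what allows both inputs to be eliminated, leaving only
  \<open>S\<close>.\<close>

lemma stationary_costate:
  assumes "transpose P = P" and "stationary P g x u w"
  shows "R *v u = - (transpose B *v costate P g x u w)"
    and "lam *\<^sub>R (w - wbar) = transpose E *v costate P g x u w"
proof -
  have "R *v u + transpose B *v costate P g x u w
      = (Huu P *v u + Huw P *v w) + (transpose (Hxu P) *v x + (1 / 2) *\<^sub>R Gu g)"
    unfolding H_uu_def H_uw_def H_xu_def G_u_def costate_def next_state_def
    by (simp add: matrix_vector_simps transpose_scaleR matrix_transpose_mul assms(1) algebra_simps)
  then show "R *v u = - (transpose B *v costate P g x u w)"
    using assms(2) by (simp add: stationary_eq eq_neg_iff_add_eq_0)
  have "transpose E *v costate P g x u w - lam *\<^sub>R (w - wbar)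
      = (transpose (Huw P) *v u + Hww P *v w) + (transpose (Hxw P) *v x + (1 / 2) *\<^sub>R Gw g)"
    unfolding H_ww_def H_uw_def H_xw_def G_w_def costate_def next_state_def
    by (simp add: matrix_vector_simps transpose_scaleR matrix_transpose_mul assms(1) algebra_simps)
  then show "lam *\<^sub>R (w - wbar) = transpose E *v costate P g x u w"
    using assms(2) by (simp add: stationary_eq)
qed

lemma quad_add:
  assumes "transpose P = P"
  shows "quad P g c (z + d) = quad P g c z + 2 * (d \<bullet> (P *v z + (1 / 2) *\<^sub>R g)) + d \<bullet> (P *v d)"
  using symmetric_inner[OF assms, of z d] inner_commute[of d g]
  by (simp add: quad_def matrix_vector_right_distrib inner_expand)

text \<open>The second order expansion of a quadratic function is exact, and the optimality
  conditions cancel its first order part. Setting \<open>du = 0\<close> or \<open>dw = 0\<close>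
  then yields the two saddle inequalities.\<close>

lemma ahead_deviation:
  assumes sym: "transpose P = P" and st: "stationary P g x u w"
  shows "ahead (quad P g c) x (u + du) (w + dw) = ahead (quad P g c) x u w
    + du \<bullet> (R *v du) - lam * (dw \<bullet> dw) + \<alpha> * ((B *v du + E *v dw) \<bullet> (P *v (B *v du + E *v dw)))"
proof -
  define d where "d = B *v du + E *v dw"
  define p where "p = costate P g x u w"
  have n: "next_state A B E x (u + du) (w + dw) = next_state A B E x u w + d"
    by (simp add: next_state_def d_def matrix_vector_right_distrib)
  have "d \<bullet> p = du \<bullet> (transpose B *v p) + dw \<bullet> (transpose E *v p)"
    by (simp add: d_def inner_expand inner_transpose)
  also have "\<dots> = - (du \<bullet> (R *v u)) + lam * (dw \<bullet> (w - wbar))"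
    unfolding inner_scaleR_right[symmetric] p_def
    by (simp only: stationary_costate[OF sym st] inner_minus_right minus_minus)
  finally have dp: "\<alpha> * (d \<bullet> (P *v next_state A B E x u w + (1 / 2) *\<^sub>R g))
      = - (du \<bullet> (R *v u)) + lam * (dw \<bullet> (w - wbar))"
    by (simp add: p_def costate_def inner_scaleR_right)
  have e1: "(norm (w + dw - wbar))\<^sup>2 = (norm (w - wbar))\<^sup>2 + 2 * (dw \<bullet> (w - wbar)) + dw \<bullet> dw"
    unfolding dot_square_norm[symmetric]
    using inner_commute[of w dw] inner_commute[of wbar dw] inner_commute[of wbar w]
    by (simp add: inner_expand algebra_simps)
  have e2: "(u + du) \<bullet> (R *v (u + du)) = u \<bullet> (R *v u) + 2 * (du \<bullet> (R *v u)) + du \<bullet> (R *v du)"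
    using pd_R symmetric_inner[of R u du] by (simp add: pd_def matrix_vector_right_distrib inner_expand)
  show ?thesis
    unfolding ahead_def stage_cost_def n quad_add[OF sym] d_def[symmetric] e1 e2 ring_distribs
    using dp by (simp add: algebra_simps)
qed

lemma saddle_point:
  assumes "admissible P" and "stationary P g x u w"
  shows "ahead (quad P g c) x u w' \<le> ahead (quad P g c) x u w"
    and "ahead (quad P g c) x u w \<le> ahead (quad P g c) x u' w"
proof -
  have P: "psd P" and sym: "transpose P = P" using assms(1) by (auto simp: admissible_def psd_def)
  have "(w' - w) \<bullet> (Hww P *v (w' - w)) \<le> 0"
    by (rule Hww_nonpos[OF assms(1)])
  then have "- lam * ((w' - w) \<bullet> (w' - w)) + \<alpha> * ((E *v (w' - w)) \<bullet> (P *v (E *v (w' - w)))) \<le> 0"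
    by (simp add: H_ww_def matrix_vector_mult_diff_rdistrib mat_mult_vec scaleR_matrix_vector
        matrix_vector_mul_assoc[symmetric] inner_diff_right[of _ "\<alpha> *\<^sub>R _"] inner_transpose)
  then show "ahead (quad P g c) x u w' \<le> ahead (quad P g c) x u w"
    using ahead_deviation[OF sym assms(2), of c 0 "w' - w"] by simp
  have "0 \<le> (u' - u) \<bullet> (R *v (u' - u))"
    using pd_imp_psd[OF pd_R] by (simp add: psd_def)
  moreover have "0 \<le> (B *v (u' - u)) \<bullet> (P *v (B *v (u' - u)))"
    using P by (simp add: psd_def)
  ultimately show "ahead (quad P g c) x u w \<le> ahead (quad P g c) x u' w"
    using ahead_deviation[OF sym assms(2), of c "u' - u" 0] \<alpha>_pos by simp
qed

text \<open>Completion of the square: with \<open>J\<close> the inverse of \<open>Hv P\<close>, the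
  stationary input is \<open>- (J *v h) - (1 / 2) *\<^sub>R (J *v Gv g)\<close>, and substituting it
  produces the Riccati map together with its linear and constant companions.\<close>

lemma stationary_value:
  assumes "admissible P" and "stationary P g x u w"
  shows "ahead (quad P g c) x u w = quad (riccati P) (linear_step P g) (const_step P g c) x"
proof -
  have sym: "transpose P = P" using assms(1) by (simp add: admissible_def psd_def)
  define v where "v = join u w"
  define h where "h = transpose (Hc P) *v x"
  define J where "J = matrix_inv (Hv P)"
  have st: "Hv P *v v = - (h + (1 / 2) *\<^sub>R Gv g)"
    using assms(2) by (simp add: stationary_def v_def h_def)
  then have v: "v = - (J *v h) - (1 / 2) *\<^sub>R (J *v Gv g)"
    using inverse_mult_vec(2)[of "Hv P" v, OF Hv_injective[OF assms(1)]]
    by (simp add: J_def matrix_vector_right_distrib matrix_vector_mult_scaleR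
        matrix_vector_mult_diff_distrib matrix_vector_mult_minus)
  have J: "a \<bullet> (J *v b) = b \<bullet> (J *v a)" for a b
    unfolding J_def
    using Hv_injective[OF assms(1)] symmetric_blocks(4)[OF sym]
    by (intro symmetric_inner inverse_symmetric)
  have "ahead (quad P g c) x u w = x \<bullet> (Hxx P *v x) + Gx g \<bullet> x + h \<bullet> v + (Gv g \<bullet> v) / 2
      + (\<alpha> * c - lam * (wbar \<bullet> wbar))"
    unfolding ahead_quad_join[OF sym] v_def[symmetric] h_def[symmetric] st
    using inner_commute[of v h] inner_commute[of v "Gv g"] by (simp add: inner_expand)
  also have "\<dots> = x \<bullet> (Hxx P *v x) + Gx g \<bullet> x - h \<bullet> (J *v h) - h \<bullet> (J *v Gv g)
      - (Gv g \<bullet> (J *v Gv g)) / 4 + (\<alpha> * c - lam * (wbar \<bullet> wbar))"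
    unfolding v using J[of "Gv g" h] by (simp add: inner_expand add_divide_distrib diff_divide_distrib)
  also have "\<dots> = quad (riccati P) (linear_step P g) (const_step P g c) x"
  proof -
    have hJ: "h \<bullet> (J *v y) = x \<bullet> (Hc P *v (J *v y))" for y
      unfolding h_def by (rule inner_transpose)
    have "x \<bullet> (riccati P *v x) = x \<bullet> (Hxx P *v x) - h \<bullet> (J *v h)"
      by (simp only: riccati_def riccati_gain_def J_def[symmetric] matrix_vector_mult_diff_rdistrib
          matrix_vector_mul_assoc[symmetric] inner_diff_right h_def[symmetric] hJ)
    moreover have "linear_step P g \<bullet> x = Gx g \<bullet> x - h \<bullet> (J *v Gv g)"
      by (simp only: linear_step_def riccati_gain_def J_def[symmetric] matrix_vector_mul_assoc[symmetric]
          inner_diff_right hJ inner_commute[of _ x])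
    ultimately show ?thesis
      unfolding quad_def const_step_def J_def[symmetric] by simp
  qed
  finally show ?thesis .
qed

definition lq_cost :: "real^'n \<Rightarrow> real^'n \<Rightarrow> real" where
  "lq_cost x y = x \<bullet> (Q *v x) + y \<bullet> (matrix_inv S *v y)"

definition lq_next :: "real^'n \<Rightarrow> real^'n \<Rightarrow> real^'n" where
  "lq_next x y = A *v x + E *v wbar + y"

text \<open>A relation instead of an operator built on an infimum: attainment is part of the notion,
  and no lower bound for \<open>f\<close> has to be supplied.\<close>

definition lq_step :: "(real^'n \<Rightarrow> real) \<Rightarrow> (real^'n \<Rightarrow> real) \<Rightarrow> bool" where
  "lq_step f f' \<longleftrightarrow> (\<forall>x. (\<forall>y. f' x \<le> lq_cost x y + \<alpha> * f (lq_next x y)) \<and>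
                           (\<exists>y. f' x = lq_cost x y + \<alpha> * f (lq_next x y)))"

lemma S_pd: "pd S"
  using pd_S by (simp add: S_def)

text \<open>The combined effect \<open>y = B u + E (w - wbar)\<close> of the saddle point minimizes a regulator
  problem in which the weight of \<open>y\<close> is the inverse of \<open>S\<close>.\<close>

lemma lq_step_quad:
  assumes "admissible P"
  shows "lq_step (quad P g c) (quad (riccati P) (linear_step P g) (const_step P g c))"
  unfolding lq_step_def
proof
  fix x
  let ?V = "quad P g c"
  have P: "psd P" and sym: "transpose P = P" using assms(1) by (auto simp: admissible_def psd_def)
  obtain u w where st: "stationary P g x u w" by (rule stationary_exists[OF assms])
  define p where "p = costate P g x u w"
  define y where "y = - (S *v p)"
  have u: "u = - (matrix_inv R *v (transpose B *v p))"
    using pd_inverse(2)[OF pd_R, of u] stationary_costate(1)[OF sym st]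
    by (simp add: p_def matrix_vector_mult_minus)
  have w: "w - wbar = (1 / lam) *\<^sub>R (transpose E *v p)"
    using lam_pos by (simp add: p_def flip: stationary_costate(2)[OF sym st])
  have y: "B *v u + E *v (w - wbar) = y"
    unfolding w u y_def S_def
    by (simp add: matrix_vector_simps matrix_vector_mult_minus)
  have next_y: "next_state A B E x u w = lq_next x y"
    unfolding y[symmetric] next_state_def lq_next_def by (simp add: matrix_vector_mult_diff_distrib)
  have Sy: "matrix_inv S *v y = - p"
    using pd_inverse(2)[OF S_pd, of "- p"] by (simp add: y_def matrix_vector_mult_minus)
  \<comment> \<open>Pairing the optimality conditions with the inputs turns the indefinite input
    cost into \<open>- (p \<bullet> y)\<close>, and \<open>matrix_inv S *v y = - p\<close> makes
    this the nonnegative \<open>y \<bullet> (matrix_inv S *v y)\<close>.\<close>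
  have "u \<bullet> (R *v u) - lam * (norm (w - wbar))\<^sup>2 = u \<bullet> (R *v u) - (w - wbar) \<bullet> (lam *\<^sub>R (w - wbar))"
    by (simp add: dot_square_norm)
  also have "\<dots> = - (p \<bullet> (B *v u + E *v (w - wbar)))"
    using stationary_costate[OF sym st]
    by (simp add: p_def inner_expand inner_transpose inner_commute)
  also have "\<dots> = y \<bullet> (matrix_inv S *v y)"
    by (simp add: y Sy inner_commute)
  finally have val: "ahead ?V x u w = lq_cost x y + \<alpha> * ?V (lq_next x y)"
    by (simp add: ahead_def stage_cost_def lq_cost_def next_y)
  have "lq_cost x y + \<alpha> * ?V (lq_next x y) \<le> lq_cost x y' + \<alpha> * ?V (lq_next x y')" for y'
  proof -
    define d where "d = y' - y"
    have iS: "psd (matrix_inv S)" by (rule pd_imp_psd[OF pd_matrix_inv[OF S_pd]])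
    have "\<alpha> * ?V (lq_next x y') = \<alpha> * ?V (lq_next x y) + 2 * (d \<bullet> p) + \<alpha> * (d \<bullet> (P *v d))"
    proof -
      have "lq_next x y' = lq_next x y + d" by (simp add: lq_next_def d_def)
      moreover have "p = \<alpha> *\<^sub>R (P *v lq_next x y + (1 / 2) *\<^sub>R g)"
        by (simp add: p_def costate_def next_y)
      ultimately show ?thesis
        by (simp only: quad_add[OF sym] inner_scaleR_right) (simp add: algebra_simps)
    qed
    moreover have "lq_cost x y' = lq_cost x y + 2 * (d \<bullet> (matrix_inv S *v y)) + d \<bullet> (matrix_inv S *v d)"
    proof -
      have y': "y' = y + d" by (simp add: d_def)
      show ?thesis
        unfolding y' using iS symmetric_inner[of "matrix_inv S" y d]
        by (simp add: lq_cost_def psd_def matrix_vector_right_distrib inner_expand)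
    qed
    moreover have "0 \<le> d \<bullet> (P *v d)" "0 \<le> d \<bullet> (matrix_inv S *v d)"
      using P iS by (simp_all add: psd_def)
    ultimately show ?thesis
      using \<alpha>_pos Sy by simp
  qed
  then show "(\<forall>y. quad (riccati P) (linear_step P g) (const_step P g c) x \<le> lq_cost x y + \<alpha> * ?V (lq_next x y)) \<and>
     (\<exists>y. quad (riccati P) (linear_step P g) (const_step P g c) x = lq_cost x y + \<alpha> * ?V (lq_next x y))"
    using val stationary_value[OF assms st, of c] by auto
qed

end

subsection \<open>Growth of quadratic functions\<close>

lemma pd_coercive:
  fixes P :: "real^'k^'k"
  assumes "pd P"
  obtains \<mu> where "\<mu> > 0" "\<And>x. \<mu> * (norm x)\<^sup>2 \<le> x \<bullet> (P *v x)"
proof -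
  have "compact (sphere (0::real^'k) 1)" by simp
  moreover have "sphere (0::real^'k) 1 \<noteq> {}" by simp
  moreover have "continuous_on (sphere 0 1) (\<lambda>x. x \<bullet> (P *v x))"
    by (intro continuous_intros)
  ultimately obtain z where z: "z \<in> sphere 0 1" and min: "\<And>y. y \<in> sphere 0 1 \<Longrightarrow> z \<bullet> (P *v z) \<le> y \<bullet> (P *v y)"
    using continuous_attains_inf[of "sphere (0::real^'k) 1" "\<lambda>x. x \<bullet> (P *v x)"] by blast
  have "z \<noteq> 0" using z by auto
  show thesis
  proof
    show "0 < z \<bullet> (P *v z)" using assms \<open>z \<noteq> 0\<close> by (simp add: pd_def)
    fix x :: "real^'k"
    show "(z \<bullet> (P *v z)) * (norm x)\<^sup>2 \<le> x \<bullet> (P *v x)"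
    proof (cases "x = 0")
      case False
      define y where "y = (1 / norm x) *\<^sub>R x"
      have x: "x = norm x *\<^sub>R y" using False by (simp add: y_def)
      have "y \<in> sphere 0 1" using False by (simp add: y_def)
      then have "(norm x)\<^sup>2 * (z \<bullet> (P *v z)) \<le> (norm x)\<^sup>2 * (y \<bullet> (P *v y))"
        by (intro mult_left_mono min) auto
      also have "\<dots> = (norm x *\<^sub>R y) \<bullet> (P *v (norm x *\<^sub>R y))"
        by (simp add: matrix_vector_mult_scaleR power2_eq_square)
      also have "\<dots> = x \<bullet> (P *v x)"
        by (simp only: x[symmetric])
      finally show ?thesis by (simp add: mult.commute)
    qed simp
  qed
qed

lemma quad_lower:
  fixes P :: "real^'k^'k"
  assumes "pd P"
  obtains \<mu> C where "\<mu> > 0" "\<And>x. \<mu> * (norm x)\<^sup>2 - C \<le> quad P g c x"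
proof -
  obtain \<mu> where \<mu>: "\<mu> > 0" "\<And>x. \<mu> * (norm x)\<^sup>2 \<le> x \<bullet> (P *v x)"
    using pd_coercive[OF assms] by blast
  show thesis
  proof
    show "\<mu> / 2 > 0" using \<mu> by simp
    fix x :: "real^'k"
    have "\<bar>g \<bullet> x\<bar> \<le> norm g * norm x" by (rule Cauchy_Schwarz_ineq2)
    moreover have "0 \<le> (\<mu> * norm x - norm g)\<^sup>2 / (2 * \<mu>)" using \<mu> by simp
    then have "0 \<le> (\<mu> / 2) * (norm x)\<^sup>2 - norm g * norm x + (norm g)\<^sup>2 / (2 * \<mu>)"
      using \<mu>(1) by (simp add: power2_eq_square field_simps)
    ultimately show "\<mu> / 2 * (norm x)\<^sup>2 - ((norm g)\<^sup>2 / (2 * \<mu>) - c) \<le> quad P g c x"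
      using \<mu>(2)[of x] unfolding quad_def by (simp add: algebra_simps)
  qed
qed

lemma quad_upper:
  fixes P :: "real^'k^'k"
  obtains D where "D > 0" "\<And>x. quad P g c x \<le> D * ((norm x)\<^sup>2 + 1)"
proof -
  obtain K where K: "\<And>x. norm (P *v x) \<le> norm x * K"
    using bounded_linear.bounded[OF matrix_vector_mul_bounded_linear[of P]] by blast
  show thesis
  proof
    show "\<bar>K\<bar> + norm g + \<bar>c\<bar> + 1 > 0" by (simp add: add_nonneg_pos)
    fix x :: "real^'k"
    have "x \<bullet> (P *v x) \<le> norm x * norm (P *v x)" by (rule norm_cauchy_schwarz)
    also have "\<dots> \<le> norm x * (norm x * K)" using K by (intro mult_left_mono) auto
    also have "\<dots> \<le> \<bar>K\<bar> * (norm x)\<^sup>2"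
      by (metis abs_ge_self mult.assoc mult.commute mult_left_mono power2_eq_square zero_le_power2)
    finally have 1: "x \<bullet> (P *v x) \<le> \<bar>K\<bar> * (norm x)\<^sup>2" .
    have "2 * norm x \<le> (norm x)\<^sup>2 + 1"
      using zero_le_power2[of "norm x - 1"] unfolding power2_diff by simp
    then have "norm x \<le> (norm x)\<^sup>2 + 1"
      using norm_ge_zero[of x] by linarith
    then have "norm g * norm x \<le> norm g * ((norm x)\<^sup>2 + 1)"
      by (rule mult_left_mono) simp
    then have 2: "g \<bullet> x \<le> norm g * ((norm x)\<^sup>2 + 1)"
      using norm_cauchy_schwarz[of g x] by simp
    have "0 \<le> \<bar>c\<bar> * (norm x)\<^sup>2" "0 \<le> \<bar>K\<bar>" "c \<le> \<bar>c\<bar>" "0 \<le> (norm x)\<^sup>2" by auto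
    then show "quad P g c x \<le> (\<bar>K\<bar> + norm g + \<bar>c\<bar> + 1) * ((norm x)\<^sup>2 + 1)"
      using 1 2 unfolding quad_def distrib_right distrib_left by linarith
  qed
qed

lemma quad_dominated:
  fixes P P' :: "real^'k^'k"
  assumes "pd P'"
  obtains t C where "0 < t" "t \<le> 1" "0 \<le> C" "\<And>x. t * quad P g c x - C \<le> quad P' g' c' x"
proof -
  obtain \<mu> C where \<mu>: "\<mu> > 0" "\<And>x. \<mu> * (norm x)\<^sup>2 - C \<le> quad P' g' c' x"
    using quad_lower[OF assms] by blast
  obtain D where D: "D > 0" "\<And>x. quad P g c x \<le> D * ((norm x)\<^sup>2 + 1)"
    using quad_upper by blast
  \<comment> \<open>\<open>\<mu> / D\<close> is the ratio of the two growth constants; the cap at 1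
    makes \<open>t\<close> usable as a weight in convex combinations.\<close>
  define t where "t = min 1 (\<mu> / D)"
  have t: "0 < t" "t \<le> 1" "t * D \<le> \<mu>"
    using \<mu> D by (auto simp: t_def min_def field_simps)
  show thesis
  proof
    show "0 < t" "t \<le> 1" "0 \<le> \<mu> + \<bar>C\<bar>" using t \<mu> by auto
    fix x :: "real^'k"
    have "t * quad P g c x \<le> (t * D) * ((norm x)\<^sup>2 + 1)"
      using D(2)[of x] t by (simp add: mult.assoc)
    also have "\<dots> \<le> \<mu> * ((norm x)\<^sup>2 + 1)"
      using t by (intro mult_right_mono) auto
    finally show "t * quad P g c x - (\<mu> + \<bar>C\<bar>) \<le> quad P' g' c' x"
      using \<mu>(2)[of x] unfolding distrib_left by linarith
  qed
qed

text \<open>On the ray through \<open>x\<close> the difference of the two functions is a polynomial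
  in \<open>t\<close> bounded above, so its leading coefficient is not positive. Hence a bound up to
  an additive constant already orders the quadratic parts.\<close>

lemma quad_le_form:
  fixes P P' :: "real^'k^'k"
  assumes "\<And>x. quad P g c x \<le> quad P' g' c' x"
  shows "x \<bullet> (P *v x) \<le> x \<bullet> (P' *v x)"
proof (rule ccontr)
  define a b d where "a = x \<bullet> (P *v x) - x \<bullet> (P' *v x)" and "b = g \<bullet> x - g' \<bullet> x" and "d = c - c'"
  assume "\<not> ?thesis"
  then have a: "a > 0" by (simp add: a_def)
  have *: "a * t\<^sup>2 + b * t + d \<le> 0" for t
    using assms[of "t *\<^sub>R x"]
    by (simp add: quad_def matrix_vector_mult_scaleR a_def b_def d_def power2_eq_square algebra_simps)
  define t where "t = (\<bar>b\<bar> + \<bar>d\<bar>) / a + 1"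
  have t: "t \<ge> 1" and at: "a * t = \<bar>b\<bar> + \<bar>d\<bar> + a"
    using a by (auto simp: t_def field_simps)
  have "a * t\<^sup>2 = (a * t) * t" by (simp add: power2_eq_square)
  moreover define Y where "Y = (\<bar>b\<bar> + \<bar>d\<bar> + a + b) * t"
  ultimately have "a * t\<^sup>2 + b * t = Y"
    unfolding at by (simp add: algebra_simps)
  moreover have "(\<bar>d\<bar> + a) * 1 \<le> Y"
    unfolding Y_def using t a by (intro mult_mono) auto
  ultimately show False using *[of t] a by simp
qed


context lq_game
begin

subsection \<open>Value iteration\<close>

text \<open>The minimizing input for \<open>h\<close> is a competitor for \<open>f\<close>; a
  uniform gap \<open>a\<close> between the two functions is discounted once.\<close>

lemma lq_step_mono:
  assumes "lq_step f f'" and "lq_step h h'" and "\<And>x. f x \<le> h x + a"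
  shows "f' x \<le> h' x + \<alpha> * a"
proof -
  obtain y where y: "h' x = lq_cost x y + \<alpha> * h (lq_next x y)"
    using assms(2) by (auto simp: lq_step_def)
  have "f' x \<le> lq_cost x y + \<alpha> * f (lq_next x y)"
    using assms(1) by (simp add: lq_step_def)
  also have "\<dots> \<le> lq_cost x y + \<alpha> * (h (lq_next x y) + a)"
    using assms(3) \<alpha>_pos by simp
  finally show ?thesis by (simp add: y distrib_left)
qed

text \<open>A pointwise minimum of expressions affine in \<open>f\<close> is concave in
  \<open>f\<close>. The input that is optimal for \<open>k\<close> serves as competitor for both
  \<open>f\<close> and \<open>h\<close>.\<close>

lemma lq_step_concave:
  assumes "lq_step f f'" and "lq_step h h'" and "lq_step k k'"
    and "0 \<le> t" "t \<le> 1" and "\<And>x. t * f x + (1 - t) * h x - a \<le> k x"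
  shows "t * f' x + (1 - t) * h' x - \<alpha> * a \<le> k' x"
proof -
  obtain y where y: "k' x = lq_cost x y + \<alpha> * k (lq_next x y)"
    using assms(3) by (auto simp: lq_step_def)
  let ?z = "lq_next x y"
  have "t * f' x \<le> t * (lq_cost x y + \<alpha> * f ?z)"
    using assms(1,4) by (intro mult_left_mono) (auto simp: lq_step_def)
  moreover have "(1 - t) * h' x \<le> (1 - t) * (lq_cost x y + \<alpha> * h ?z)"
    using assms(2,5) by (intro mult_left_mono) (auto simp: lq_step_def)
  moreover have "\<alpha> * (t * f ?z + (1 - t) * h ?z - a) \<le> \<alpha> * k ?z"
    using assms(6)[of ?z] \<alpha>_pos by simp
  ultimately show ?thesis
    unfolding y by (simp add: algebra_simps)
qed

lemma psd_inverse_S: "psd (matrix_inv S)"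
  by (rule pd_imp_psd[OF pd_matrix_inv[OF S_pd]])

lemma lq_cost_nonneg: "0 \<le> lq_cost x y"
  using psd_Q psd_inverse_S by (simp add: lq_cost_def psd_def)

lemma lq_step_nonneg:
  assumes "lq_step f f'" and "\<And>x. 0 \<le> f x"
  shows "0 \<le> f' x"
proof -
  obtain y where "f' x = lq_cost x y + \<alpha> * f (lq_next x y)"
    using assms(1) by (auto simp: lq_step_def)
  then show ?thesis using lq_cost_nonneg assms(2) \<alpha>_pos by simp
qed

lemma riccati_symmetric:
  assumes "admissible P"
  shows "transpose (riccati P) = riccati P"
proof -
  have sym: "transpose P = P" using assms by (simp add: admissible_def psd_def)
  have "transpose (matrix_inv (Hv P)) = matrix_inv (Hv P)"
    using Hv_injective[OF assms] symmetric_blocks(4)[OF sym] by (intro inverse_symmetric)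
  then show ?thesis
    unfolding riccati_def riccati_gain_def
    by (simp add: transpose_diff matrix_transpose_mul matrix_mul_assoc symmetric_blocks[OF sym])
qed

text \<open>For \<open>wbar = 0\<close> and no linear term, the regulator step is homogeneous.\<close>

lemma riccati_form:
  assumes "admissible P"
  obtains y where "x \<bullet> (riccati P *v x) = lq_cost x y + \<alpha> * ((A *v x + y) \<bullet> (P *v (A *v x + y)))"
proof -
  interpret hom: lq_game A B E Q R \<alpha> lam 0
    using psd_Q pd_R \<alpha>_pos \<alpha>_less lam_pos pd_S by unfold_locales
  have "hom.Gv 0 = 0" by (simp add: G_u_def G_w_def)
  then have *: "hom.linear_step P 0 = 0" "hom.const_step P 0 0 = 0"
    by (simp_all add: hom.linear_step_def hom.const_step_def G_x_def)
  then show thesis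
    using that hom.lq_step_quad[OF assms, of 0 0]
    unfolding * hom.lq_step_def hom.lq_next_def quad_def by auto
qed

text \<open>The terms of the regulator cost are nonnegative, so all of them vanish; the input term
  has a definite weight, which forces \<open>y = 0\<close>, and the state moves by \<open>A\<close>
  alone. Null vectors are thus passed along the orbits of \<open>A\<close>, where observability can
  exclude them.\<close>

lemma riccati_kernel:
  assumes "admissible P" and "x \<bullet> (riccati P *v x) = 0"
  shows "x \<bullet> (Q *v x) = 0" "(A *v x) \<bullet> (P *v (A *v x)) = 0"
proof -
  obtain y where y: "x \<bullet> (riccati P *v x) = lq_cost x y + \<alpha> * ((A *v x + y) \<bullet> (P *v (A *v x + y)))"
    using riccati_form[OF assms(1)] by blast
  have "0 \<le> x \<bullet> (Q *v x)" "0 \<le> y \<bullet> (matrix_inv S *v y)" "0 \<le> \<alpha> * ((A *v x + y) \<bullet> (P *v (A *v x + y)))"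
    using psd_Q psd_inverse_S assms(1) \<alpha>_pos by (simp_all add: psd_def admissible_def)
  then have *: "x \<bullet> (Q *v x) = 0" "y \<bullet> (matrix_inv S *v y) = 0" "\<alpha> * ((A *v x + y) \<bullet> (P *v (A *v x + y))) = 0"
    using y assms(2) unfolding lq_cost_def by linarith+
  then show "x \<bullet> (Q *v x) = 0" by simp
  have "y = 0"
    using *(2) pd_matrix_inv[OF S_pd] by (metis less_irrefl pd_def)
  then show "(A *v x) \<bullet> (P *v (A *v x)) = 0" using *(3) \<alpha>_pos by simp
qed

primrec vi_P :: "nat \<Rightarrow> real^'n^'n" where
  "vi_P 0 = 0"
| "vi_P (Suc i) = riccati (vi_P i)"

primrec vi_g :: "nat \<Rightarrow> real^'n" where
  "vi_g 0 = 0"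
| "vi_g (Suc i) = linear_step (vi_P i) (vi_g i)"

primrec vi_c :: "nat \<Rightarrow> real" where
  "vi_c 0 = 0"
| "vi_c (Suc i) = const_step (vi_P i) (vi_g i) (vi_c i)"

definition vi :: "nat \<Rightarrow> real^'n \<Rightarrow> real" where
  "vi i = quad (vi_P i) (vi_g i) (vi_c i)"

lemma vi_0: "vi 0 x = 0"
  by (simp add: vi_def quad_def)

lemma lq_step_vi: "admissible (vi_P i) \<Longrightarrow> lq_step (vi i) (vi (Suc i))"
  unfolding vi_def by (simp add: lq_step_quad)

end

section \<open>Convergence of value iteration to the Riccati solution\<close>

locale lq_solution = lq_game A B E Q R \<alpha> lam wbar
  for A :: "real^'n^'n" and B :: "real^'m^'n" and E :: "real^'d^'n"
    and Q :: "real^'n^'n" and R :: "real^'m^'m" and \<alpha> lam :: real and wbar :: "real^'d" +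
  fixes P :: "real^'n^'n" and g :: "real^'n"
  assumes observable: "(\<And>k. (((*v) A ^^ k) x) \<bullet> (Q *v (((*v) A ^^ k) x)) = 0) \<Longrightarrow> x = 0"
    and admissible_P: "admissible P"
    and riccati_P: "riccati P = P" and linear_step_g: "linear_step P g = g"
begin

definition c_fix :: real where
  "c_fix = const_step P g 0 / (1 - \<alpha>)"

definition V :: "real^'n \<Rightarrow> real" where
  "V = quad P g c_fix"

lemma const_step_c_fix: "const_step P g c_fix = c_fix"
proof -
  have "const_step P g c_fix = \<alpha> * c_fix + const_step P g 0"
    by (simp add: const_step_def)
  also have "\<dots> = c_fix" using \<alpha>_less by (simp add: c_fix_def field_simps)
  finally show ?thesis .
qed

lemma lq_step_V: "lq_step V V"
  using lq_step_quad[OF admissible_P, of g c_fix]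
  by (simp add: V_def riccati_P linear_step_g const_step_c_fix)

lemma symmetric_P: "transpose P = P"
  using admissible_P by (simp add: admissible_def psd_def)

text \<open>Since \<open>P\<close> is a fixed point of the Riccati map, the forms of
  \<open>P\<close> and \<open>Q\<close> vanish along the whole orbit under \<open>A\<close> of a
  null vector of \<open>P\<close>; observability leaves only \<open>x = 0\<close>.\<close>

lemma pd_P: "pd P"
proof -
  have "x = 0" if "x \<bullet> (P *v x) = 0" for x
  proof -
    have "(((*v) A ^^ k) x) \<bullet> (P *v (((*v) A ^^ k) x)) = 0" for k
      using that riccati_kernel(2)[OF admissible_P] by (induction k) (auto simp: riccati_P)
    then show ?thesis
      using observable riccati_kernel(1)[OF admissible_P] by (simp add: riccati_P)
  qed
  then show ?thesis
    using admissible_P unfolding pd_def admissible_def psd_def by (metis order_le_less)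
qed

lemma V_bounded_below: obtains C where "0 \<le> C" "\<And>x. - C \<le> V x"
proof -
  obtain \<mu> C where *: "\<mu> > 0" "\<And>x. \<mu> * (norm x)\<^sup>2 - C \<le> V x"
    using quad_lower[OF pd_P] unfolding V_def by blast
  have "- \<bar>C\<bar> \<le> V x" for x
  proof -
    have "0 \<le> \<mu> * (norm x)\<^sup>2" using *(1) by simp
    then show ?thesis using *(2)[of x] by linarith
  qed
  then show thesis using that[of "\<bar>C\<bar>"] by simp
qed

text \<open>The Bellman step is available only at an admissible matrix, while admissibility of the
  next matrix comes from the upper bound which that step produces; hence one joint induction. The
  upper bound orders the quadratic parts, so the definiteness condition is inherited from
  \<open>P\<close>.\<close>

lemma vi_invariant:
  assumes "0 \<le> C" and "\<And>x. - C \<le> V x"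
  shows "admissible (vi_P i) \<and> (\<forall>x. 0 \<le> vi i x \<and> vi i x \<le> V x + \<alpha> ^ i * C)"
proof (induction i)
  case 0
  have "transpose 0 = (0 :: real^'n^'n)" by (simp add: transpose_def vec_eq_iff)
  moreover have "pd (mat lam :: real^'d^'d)"
    using lam_pos by (simp add: pd_def transpose_mat mat_mult_vec)
  moreover have "0 \<le> V x + C" for x using assms(2)[of x] by linarith
  ultimately show ?case
    by (simp add: vi_0 admissible_def psd_def)
next
  case (Suc i)
  then have adm: "admissible (vi_P i)" and step: "lq_step (vi i) (vi (Suc i))"
    by (auto intro: lq_step_vi)
  have nonneg: "0 \<le> vi (Suc i) x" for x
    using lq_step_nonneg[OF step] Suc by blast
  have le: "vi (Suc i) x \<le> V x + \<alpha> ^ Suc i * C" for x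
    using lq_step_mono[OF step lq_step_V, of "\<alpha> ^ i * C"] Suc by (simp add: mult.assoc)
  have 1: "0 \<le> x \<bullet> (vi_P (Suc i) *v x)" for x
    using quad_le_form[of 0 0 0 "vi_P (Suc i)" "vi_g (Suc i)" "vi_c (Suc i)" x] nonneg
    by (simp add: vi_def quad_def)
  have 2: "x \<bullet> (vi_P (Suc i) *v x) \<le> x \<bullet> (P *v x)" for x
    by (rule quad_le_form[of _ "vi_g (Suc i)" "vi_c (Suc i)" _ g "c_fix + \<alpha> ^ Suc i * C"])
      (use le in \<open>simp add: vi_def quad_def V_def add.assoc\<close>)
  have sym: "transpose (vi_P (Suc i)) = vi_P (Suc i)"
    using riccati_symmetric[OF adm] by simp
  have "pd (mat lam - \<alpha> *\<^sub>R (transpose E ** vi_P (Suc i) ** E))"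
    unfolding pd_def
  proof (intro conjI allI impI)
    show "transpose (mat lam - \<alpha> *\<^sub>R (transpose E ** vi_P (Suc i) ** E)) = mat lam - \<alpha> *\<^sub>R (transpose E ** vi_P (Suc i) ** E)"
      using sym by (simp add: transpose_diff transpose_scaleR matrix_transpose_mul matrix_mul_assoc transpose_mat)
    fix w :: "real^'d" assume "w \<noteq> 0"
    then have "0 < w \<bullet> ((mat lam - \<alpha> *\<^sub>R (transpose E ** P ** E)) *v w)"
      using admissible_P by (simp add: admissible_def pd_def)
    also have "\<dots> \<le> w \<bullet> ((mat lam - \<alpha> *\<^sub>R (transpose E ** vi_P (Suc i) ** E)) *v w)"
      using 2[of "E *v w"] \<alpha>_pos
      by (simp add: matrix_vector_simps inner_expand inner_transpose del: vi_P.simps)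
    finally show "0 < w \<bullet> ((mat lam - \<alpha> *\<^sub>R (transpose E ** vi_P (Suc i) ** E)) *v w)" .
  qed
  then show ?case
    using 1 sym nonneg le by (auto simp: admissible_def psd_def simp del: vi_P.simps)
qed

lemma admissible_vi: "admissible (vi_P i)"
  using V_bounded_below vi_invariant by metis

lemma vi_nonneg: "0 \<le> vi i x"
  using V_bounded_below vi_invariant by metis

lemmas lq_step_value_iteration = lq_step_vi[OF admissible_vi]

lemma vi_incseq: "vi i x \<le> vi (Suc i) x"
proof (induction i arbitrary: x)
  case 0
  then show ?case by (simp add: vi_0 vi_nonneg)
next
  case (Suc i)
  then show ?case
    using lq_step_mono[OF lq_step_value_iteration lq_step_value_iteration, of i "Suc i" 0] by simp
qed

lemma vi_P_mono: "i \<le> j \<Longrightarrow> x \<bullet> (vi_P i *v x) \<le> x \<bullet> (vi_P j *v x)"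
proof (rule lift_Suc_mono_le[of "\<lambda>i. x \<bullet> (vi_P i *v x)"])
  fix n show "x \<bullet> (vi_P n *v x) \<le> x \<bullet> (vi_P (Suc n) *v x)"
    by (rule quad_le_form[of _ "vi_g n" "vi_c n" _ "vi_g (Suc n)" "vi_c (Suc n)"])
      (use vi_incseq in \<open>simp add: vi_def del: vi_P.simps vi_g.simps vi_c.simps\<close>)
qed

text \<open>The unit null vectors of \<open>vi_P n\<close> form a decreasing sequence of compact
  sets. If none were empty, a common point would be null for all iterates, and so would its whole
  orbit under \<open>A\<close>, against observability.\<close>

lemma vi_P_pd: obtains n where "pd (vi_P n)" "0 < n"
proof -
  define K where "K n = {x. norm x = 1 \<and> x \<bullet> (vi_P n *v x) = 0}" for n
  have psd: "psd (vi_P n)" for n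
    using admissible_vi by (simp add: admissible_def)
  have comp: "compact (K n)" for n
  proof -
    have "K n = sphere 0 1 \<inter> {x. x \<bullet> (vi_P n *v x) = 0}" by (auto simp: K_def)
    moreover have "closed {x. x \<bullet> (vi_P n *v x) = 0}"
      by (intro closed_Collect_eq continuous_intros)
    ultimately show ?thesis by (simp add: compact_Int_closed)
  qed
  have nest: "K n \<subseteq> K m" if "m \<le> n" for m n
  proof
    fix x assume "x \<in> K n"
    moreover have "0 \<le> x \<bullet> (vi_P m *v x)" using psd by (simp add: psd_def)
    ultimately show "x \<in> K m"
      using vi_P_mono[OF that, of x] by (simp add: K_def)
  qed
  have "\<exists>n. K n = {}"
  proof (rule ccontr)
    assume "\<nexists>n. K n = {}"
    then have "\<Inter> (range K) \<noteq> {}"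
      by (intro compact_nest comp nest) auto
    then obtain x where x: "norm x = 1" "\<And>n. x \<bullet> (vi_P n *v x) = 0"
      by (auto simp: K_def)
    have "\<forall>n. (((*v) A ^^ k) x) \<bullet> (vi_P n *v (((*v) A ^^ k) x)) = 0" for k
    proof (induction k)
      case (Suc k)
      show ?case
      proof
        fix n
        have "(((*v) A ^^ k) x) \<bullet> (riccati (vi_P n) *v (((*v) A ^^ k) x)) = 0"
          using Suc by (simp flip: vi_P.simps(2))
        then show "(((*v) A ^^ Suc k) x) \<bullet> (vi_P n *v (((*v) A ^^ Suc k) x)) = 0"
          using riccati_kernel(2)[OF admissible_vi] by simp
      qed
    qed (use x in simp)
    then have "(((*v) A ^^ k) x) \<bullet> (Q *v (((*v) A ^^ k) x)) = 0" for k
      by (intro riccati_kernel(1)[OF admissible_vi]) (simp flip: vi_P.simps(2))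
    then have "x = 0" by (rule observable)
    then show False using x by simp
  qed
  then obtain n where n: "K n = {}" by blast
  have "pd (vi_P n)"
    unfolding pd_def
  proof (intro conjI allI impI)
    show "transpose (vi_P n) = vi_P n" using psd by (simp add: psd_def)
    fix x :: "real^'n" assume x: "x \<noteq> 0"
    have "(1 / norm x) *\<^sub>R x \<notin> K n" using n by simp
    then have "x \<bullet> (vi_P n *v x) \<noteq> 0"
      using x by (simp add: K_def matrix_vector_mult_scaleR)
    moreover have "0 \<le> x \<bullet> (vi_P n *v x)" using psd by (simp add: psd_def)
    ultimately show "0 < x \<bullet> (vi_P n *v x)" by simp
  qed
  \<comment> \<open>A positive \<open>n\<close> is what gives \<open>\<alpha> ^ n < 1\<close> and
    makes the multiples of \<open>n\<close> a subsequence.\<close>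
  moreover have "n \<noteq> 0"
  proof
    assume "n = 0"
    then have "pd (0 :: real^'n^'n)" using \<open>pd (vi_P n)\<close> by simp
    then have "(axis undefined 1 :: real^'n) = 0" by (rule pd_injective) simp
    then show False by (simp add: axis_eq_0_iff)
  qed
  ultimately show thesis using that by simp
qed

text \<open>The initial bound reads as a convex combination of \<open>V\<close> and the zero
  function, less the loss \<open>a\<close>. Each step fixes \<open>V\<close>, advances the zero
  function by value iteration, and discounts the loss.\<close>

lemma vi_concave:
  assumes "0 \<le> t" "t \<le> 1" and "\<And>x. t * V x - a \<le> vi i x"
  shows "t * V x + (1 - t) * vi j x - \<alpha> ^ j * a \<le> vi (i + j) x"
proof (induction j arbitrary: x)
  case (Suc j)
  then show ?case
    using lq_step_concave[OF lq_step_V lq_step_value_iteration lq_step_value_iteration assms(1,2), of j "\<alpha> ^ j * a" "i + j"]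
    by (simp add: mult.assoc)
qed (use assms in \<open>simp add: vi_0\<close>)

lemma vi_tendsto: "(\<lambda>i. vi i x) \<longlonglongrightarrow> V x"
proof -
  obtain n where n: "pd (vi_P n)" "0 < n" by (rule vi_P_pd)
  obtain s C where s: "0 < s" "s \<le> 1" "0 \<le> C" "\<And>x. s * V x - C \<le> vi n x"
    using quad_dominated[OF n(1)] unfolding V_def vi_def by blast
  define \<rho> where "\<rho> = max (\<alpha> ^ n) (1 - s)"
  have \<rho>: "\<alpha> ^ n \<le> \<rho>" "1 - s \<le> \<rho>" "0 < \<rho>" "\<rho> < 1"
    using s \<alpha>_pos \<alpha>_less n(2) by (auto simp: \<rho>_def power_less_one_iff less_max_iff_disj)
  \<comment> \<open>The losses obey a recursion of the form
    \<open>e' = \<alpha> ^ n * e + (1 - s) ^ k * C\<close>, whose two rates are at most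
    \<open>\<rho>\<close> and may coincide. A rate strictly above \<open>\<rho>\<close> avoids a
    factor growing with \<open>k\<close>, and \<open>D\<close> is the solution of
    \<open>\<rho> * D + C = \<sigma> * D\<close>.\<close>
  define \<sigma> where "\<sigma> = (1 + \<rho>) / 2"
  have \<sigma>: "\<rho> < \<sigma>" "\<sigma> < 1" using \<rho> by (auto simp: \<sigma>_def)
  define D where "D = C / (\<sigma> - \<rho>)"
  have D: "0 \<le> D" "\<rho> * D + C = \<sigma> * D"
    using s \<sigma> by (auto simp: D_def field_simps)
  have lower: "(1 - (1 - s) ^ k) * V x - D * \<sigma> ^ k \<le> vi (n * k) x" for k x
  proof (induction k arbitrary: x)
    case (Suc k)
    define t where "t = 1 - (1 - s) ^ k"
    have t: "0 \<le> t" "t \<le> 1" using s by (auto simp: t_def power_le_one)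
    have "t * V x + (1 - t) * vi n x - \<alpha> ^ n * (D * \<sigma> ^ k) \<le> vi (n * k + n) x"
      by (rule vi_concave[OF t]) (use Suc in \<open>simp add: t_def\<close>)
    moreover have "(1 - t) * (s * V x - C) \<le> (1 - t) * vi n x"
      using s t by (intro mult_left_mono) auto
    moreover have "\<alpha> ^ n * (D * \<sigma> ^ k) + (1 - t) * C \<le> D * \<sigma> ^ Suc k"
    proof -
      have "1 - t \<le> \<sigma> ^ k"
        unfolding t_def using s \<rho> \<sigma> by (auto intro!: power_mono)
      then have "(1 - t) * C \<le> \<sigma> ^ k * C" using s by (intro mult_right_mono) auto
      moreover have "\<alpha> ^ n * (D * \<sigma> ^ k) \<le> \<rho> * (D * \<sigma> ^ k)"
        using \<rho> \<sigma> D by (intro mult_right_mono) auto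
      moreover have "\<rho> * (D * \<sigma> ^ k) + \<sigma> ^ k * C = (\<rho> * D + C) * \<sigma> ^ k" by (simp add: algebra_simps)
      moreover have "(\<rho> * D + C) * \<sigma> ^ k = D * \<sigma> ^ Suc k" by (simp add: D(2))
      ultimately show ?thesis by linarith
    qed
    moreover have "t * V x + (1 - t) * (s * V x) = (1 - (1 - s) ^ Suc k) * V x"
      by (simp add: t_def algebra_simps)
    ultimately show ?case by (simp add: algebra_simps)
  qed (use D in \<open>simp add: vi_0\<close>)
  obtain K where K: "0 \<le> K" "\<And>x. - K \<le> V x" by (rule V_bounded_below) blast
  have upper: "vi i x \<le> V x + \<alpha> ^ i * K" for i
    using vi_invariant[OF K] by blast
  \<comment> \<open>The lower estimate is available only at multiples of \<open>n\<close>;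
    monotonicity supplies a limit of the full sequence, which the subsequence then
    identifies.\<close>
  have inc: "incseq (\<lambda>i. vi i x)" by (intro incseq_SucI vi_incseq)
  have "vi i x \<le> V x + K" for i
    using upper[of i] mult_right_mono[OF power_le_one K(1), of \<alpha> i] \<alpha>_pos \<alpha>_less by simp
  then obtain L where L: "(\<lambda>i. vi i x) \<longlonglongrightarrow> L"
    using incseq_convergent[OF inc] by blast
  then have "(\<lambda>k. vi (n * k) x) \<longlonglongrightarrow> L"
    using LIMSEQ_subseq_LIMSEQ[OF L, of "\<lambda>k. n * k"] n(2) by (simp add: strict_mono_def comp_def)
  moreover have "(\<lambda>k. vi (n * k) x) \<longlonglongrightarrow> V x"
  proof (rule tendsto_sandwich)
    show "eventually (\<lambda>k. (1 - (1 - s) ^ k) * V x - D * \<sigma> ^ k \<le> vi (n * k) x) sequentially"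
      using lower by simp
    show "eventually (\<lambda>k. vi (n * k) x \<le> V x + (\<alpha> ^ n) ^ k * K) sequentially"
      unfolding power_mult[symmetric] by (intro always_eventually allI upper)
    have "(\<lambda>k. (1 - (1 - s) ^ k) * V x - D * \<sigma> ^ k) \<longlonglongrightarrow> (1 - 0) * V x - D * 0"
      using s \<rho> \<sigma> by (intro tendsto_intros LIMSEQ_power_zero) auto
    then show "(\<lambda>k. (1 - (1 - s) ^ k) * V x - D * \<sigma> ^ k) \<longlonglongrightarrow> V x" by simp
    have "(\<lambda>k. V x + (\<alpha> ^ n) ^ k * K) \<longlonglongrightarrow> V x + 0 * K"
      using \<rho> \<alpha>_pos by (intro tendsto_intros LIMSEQ_power_zero) auto
    then show "(\<lambda>k. V x + (\<alpha> ^ n) ^ k * K) \<longlonglongrightarrow> V x" by simp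
  qed
  ultimately show ?thesis using L LIMSEQ_unique by blast
qed

end

context lq_game
begin

subsection \<open>Policies and the value of the game\<close>

definition pol :: "real^'n^'n \<Rightarrow> real^'n \<Rightarrow> ('n, 'm, 'd) policies" where
  "pol P g =
     (policy_K (Hxu P) (Hxw P) (Huu P) (Huw P) (Hww P), policy_r (Huu P) (Huw P) (Hww P) (Gu g) (Gw g),
      policy_L (Hxu P) (Hxw P) (Huu P) (Huw P) (Hww P), policy_l (Huu P) (Huw P) (Hww P) (Gu g) (Gw g))"

abbreviation q_param :: "real^'n^'n \<Rightarrow> real^'n \<Rightarrow> real \<Rightarrow> ('n + 'm + 'd) param" where
  "q_param P g c \<equiv> param_of (H_matrix \<alpha> lam A B E Q R P) (G_vector \<alpha> lam A B E wbar g)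
     (\<alpha> * c - lam * (wbar \<bullet> wbar))"

lemma ahead_quad:
  assumes "transpose P = P"
  shows "ahead (quad P g c) x u w = evec x u w \<bullet> (H_matrix \<alpha> lam A B E Q R P *v evec x u w)
    + G_vector \<alpha> lam A B E wbar g \<bullet> evec x u w + (\<alpha> * c - lam * (wbar \<bullet> wbar))"
  unfolding ahead_quad_join[OF assms] H_matrix_eq G_vector_eq evec_def sym_block_mult[of _ _ _ x] inner_join[of x]
    inner_join[of "Gx g"]
  by (simp add: inner_add_right inner_transpose(2) inner_commute[of "join u w" "transpose (Hc P) *v x"])

lemma param_Q_q_param:
  assumes "transpose P = P"
  shows "param_Q (q_param P g c) x u w = ahead (quad P g c) x u w"
  by (simp add: param_Q_def param_of_feature ahead_quad[OF assms])

lemma policies_of_q_param: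
  assumes "transpose P = P"
  shows "policies_of (q_param P g c) = pol P g"
proof -
  have H: "param_H (q_param P g c) = sym_block (Hxx P) (Hc P) (Hv P)"
    using H_matrix_symmetric[OF assms] by (simp add: param_H_param_of H_matrix_eq)
  have G: "param_G (q_param P g c) = join (Gx g) (Gv g)"
    by (simp add: param_G_def param_of_def G_vector_eq join_def vec_eq_iff)
  show ?thesis
    unfolding policies_of_def Let_def H G pol_def
    by (simp add: sym_block_def row_block_def join_def)
qed

text \<open>The formulas for \<open>K\<close>, \<open>r\<close> eliminate \<open>w\<close> from the
  stationarity equations, those for \<open>L\<close>, \<open>l\<close> eliminate \<open>u\<close>.
  Both Schur complements are injective: the eliminated block has the opposite sign, so eliminating
  it only strengthens the definiteness of the other.\<close>

lemma pol_stationary: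
  assumes adm: "admissible P" and pol: "pol P g = (K, r, L, l)"
  shows "stationary P g x (K *v x + r) (L *v x + l)"
proof -
  have P: "psd P" using adm by (simp add: admissible_def)
  obtain u w where st: "stationary P g x u w" by (rule stationary_exists[OF adm])
  define h1 where "h1 = - (transpose (Hxu P) *v x + (1 / 2) *\<^sub>R Gu g)"
  define h2 where "h2 = - (transpose (Hxw P) *v x + (1 / 2) *\<^sub>R Gw g)"
  define iu where "iu = matrix_inv (Huu P)"
  define iw where "iw = matrix_inv (Hww P)"
  have 1: "Huu P *v u + Huw P *v w = h1" and 2: "transpose (Huw P) *v u + Hww P *v w = h2"
    using st by (auto simp: stationary_eq h1_def h2_def)
  have Hww_inj: "v = 0" if "Hww P *v v = 0" for v
    using that Hww_negative[OF adm, of v] by (cases "v = 0") auto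
  have iw: "Hww P *v (iw *v v) = v" "iw *v (Hww P *v v) = v" for v
    using inverse_mult_vec[of "Hww P"] Hww_inj by (auto simp: iw_def)
  have iu: "Huu P *v (iu *v v) = v" "iu *v (Huu P *v v) = v" for v
    using pd_inverse[OF pd_Huu[OF P]] by (auto simp: iu_def)
  define Su where "Su = Huu P - Huw P ** iw ** transpose (Huw P)"
  define Sw where "Sw = Hww P - transpose (Huw P) ** iu ** Huw P"
  have Su_inj: "v = 0" if "Su *v v = 0" for v
  proof (rule ccontr)
    assume "v \<noteq> 0"
    then have "0 < v \<bullet> (Huu P *v v)" using pd_Huu[OF P] by (simp add: pd_def)
    moreover define y where "y = iw *v (transpose (Huw P) *v v)"
    have "y \<bullet> (Hww P *v y) \<le> 0" by (rule Hww_nonpos[OF adm])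
    then have "y \<bullet> (transpose (Huw P) *v v) \<le> 0" by (simp add: y_def iw)
    moreover have "v \<bullet> (Su *v v) = v \<bullet> (Huu P *v v) - y \<bullet> (transpose (Huw P) *v v)"
      by (simp add: Su_def y_def matrix_vector_simps inner_diff_right inner_transpose inner_commute)
    ultimately show False using that by simp
  qed
  have Sw_inj: "v = 0" if "Sw *v v = 0" for v
  proof (rule ccontr)
    assume "v \<noteq> 0"
    then have "v \<bullet> (Hww P *v v) < 0" by (rule Hww_negative[OF adm])
    moreover define y where "y = iu *v (Huw P *v v)"
    have "0 \<le> y \<bullet> (Huu P *v y)" using pd_imp_psd[OF pd_Huu[OF P]] by (simp add: psd_def)
    then have "0 \<le> y \<bullet> (Huw P *v v)" by (simp add: y_def iu)
    moreover have "v \<bullet> (Sw *v v) = v \<bullet> (Hww P *v v) - y \<bullet> (Huw P *v v)"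
      by (simp add: Sw_def y_def matrix_vector_simps inner_diff_right inner_transpose inner_commute)
    ultimately show False using that by simp
  qed
  have "iw *v (h2 - transpose (Huw P) *v u) = w"
    by (simp add: iw(2) flip: 2)
  then have "Huw P *v w = Huw P *v (iw *v h2) - Huw P *v (iw *v (transpose (Huw P) *v u))"
    by (metis matrix_vector_mult_diff_distrib)
  then have "Su *v u = h1 - Huw P *v (iw *v h2)"
    by (simp add: Su_def matrix_vector_simps flip: 1)
  then have "u = matrix_inv Su *v (h1 - Huw P *v (iw *v h2))"
    using inverse_mult_vec(2)[of Su u] Su_inj by simp
  also have "\<dots> = K *v x + r"
    using pol
    by (simp add: pol_def policy_K_def policy_r_def h1_def h2_def flip: iw_def)
      (auto simp: matrix_vector_simps matrix_vector_mult_minus algebra_simps simp flip: Su_def)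
  finally have u: "u = K *v x + r" .
  have "iu *v (h1 - Huw P *v w) = u"
    by (simp add: iu(2) flip: 1)
  then have "transpose (Huw P) *v u = transpose (Huw P) *v (iu *v h1) - transpose (Huw P) *v (iu *v (Huw P *v w))"
    by (metis matrix_vector_mult_diff_distrib)
  then have "Sw *v w = h2 - transpose (Huw P) *v (iu *v h1)"
    by (simp add: Sw_def matrix_vector_simps flip: 2)
  then have "w = matrix_inv Sw *v (h2 - transpose (Huw P) *v (iu *v h1))"
    using inverse_mult_vec(2)[of Sw w] Sw_inj by simp
  also have "\<dots> = L *v x + l"
    using pol
    by (simp add: pol_def policy_L_def policy_l_def h1_def h2_def flip: iu_def)
      (auto simp: matrix_vector_simps matrix_vector_mult_minus algebra_simps simp flip: Sw_def)
  finally have w: "w = L *v x + l" .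
  show ?thesis using st u w by simp
qed

lemma length_play: "length (fst (play A B E \<pi> \<gamma> x0 k)) = k"
  by (induction k) (simp_all add: case_prod_beta Let_def)

lemma play_cost_ahead:
  assumes "play A B E \<pi> \<gamma> x0 k = (h, x)"
  shows "play_cost A B E Q R lam wbar \<pi> \<gamma> x0 k + \<alpha> * f (snd (play A B E \<pi> \<gamma> x0 (Suc k)))
    = ahead f x (\<pi> h x) (\<gamma> h x (\<pi> h x))"
  using assms by (simp add: play_cost_def ahead_def Let_def)

end

context lq_solution
begin

text \<open>Under the affine saddle policy of the minimizer, the accumulated discounted cost plus
  the discounted \<open>V\<close> of the current state never increases, whatever the reply. The
  remainder \<open>\<alpha> ^ T * V\<close> is at least \<open>- \<alpha> ^ T * C\<close> and
  disappears in the upper limit.\<close>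

lemma game_value_le: "game_value \<alpha> A B E Q R lam wbar x0 \<le> ereal (V x0)"
proof -
  obtain K r L l where pol: "pol P g = (K, r, L, l)" by (metis prod.exhaust)
  define \<pi> :: "('n, 'm) min_strategy" where "\<pi> h x = K *v x + r" for h x
  obtain C where C: "0 \<le> C" "\<And>x. - C \<le> V x" by (rule V_bounded_below) blast
  have "total_cost \<alpha> A B E Q R lam wbar \<pi> \<gamma> x0 \<le> ereal (V x0)" for \<gamma>
  proof -
    let ?S = "\<lambda>T. \<Sum>k<T. \<alpha> ^ k * play_cost A B E Q R lam wbar \<pi> \<gamma> x0 k"
    have step: "play_cost A B E Q R lam wbar \<pi> \<gamma> x0 k + \<alpha> * V (snd (play A B E \<pi> \<gamma> x0 (Suc k)))
        \<le> V (snd (play A B E \<pi> \<gamma> x0 k))" for k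
    proof -
      obtain h x where hx: "play A B E \<pi> \<gamma> x0 k = (h, x)" by (metis prod.exhaust)
      have st: "stationary P g x (K *v x + r) (L *v x + l)"
        by (rule pol_stationary[OF admissible_P pol])
      have "ahead V x (K *v x + r) (\<gamma> h x (K *v x + r)) \<le> ahead V x (K *v x + r) (L *v x + l)"
        unfolding V_def by (rule saddle_point(1)[OF admissible_P st])
      also have "\<dots> = V x"
        unfolding V_def stationary_value[OF admissible_P st] riccati_P linear_step_g const_step_c_fix ..
      finally show ?thesis
        unfolding play_cost_ahead[OF hx] hx by (simp add: \<pi>_def)
    qed
    have sum: "?S T + \<alpha> ^ T * V (snd (play A B E \<pi> \<gamma> x0 T)) \<le> V x0" for T
    proof (induction T)
      case (Suc T)
      have "?S (Suc T) + \<alpha> ^ Suc T * V (snd (play A B E \<pi> \<gamma> x0 (Suc T)))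
          = ?S T + \<alpha> ^ T * (play_cost A B E Q R lam wbar \<pi> \<gamma> x0 T + \<alpha> * V (snd (play A B E \<pi> \<gamma> x0 (Suc T))))"
        by (simp add: algebra_simps del: play.simps)
      also have "\<dots> \<le> ?S T + \<alpha> ^ T * V (snd (play A B E \<pi> \<gamma> x0 T))"
        using step[of T] \<alpha>_pos by (intro add_left_mono mult_left_mono) auto
      finally show ?case using Suc by linarith
    qed simp
    have "?S T \<le> V x0 + \<alpha> ^ T * C" for T
    proof -
      have "\<alpha> ^ T * (- C) \<le> \<alpha> ^ T * V (snd (play A B E \<pi> \<gamma> x0 T))"
        using C \<alpha>_pos by (intro mult_left_mono) auto
      then show ?thesis using sum[of T] by simp
    qed
    then have "limsup (\<lambda>T. ereal (?S T)) \<le> limsup (\<lambda>T. ereal (V x0 + \<alpha> ^ T * C))"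
      by (intro Limsup_mono) auto
    also have "(\<lambda>T. V x0 + \<alpha> ^ T * C) \<longlonglongrightarrow> V x0 + 0 * C"
      using \<alpha>_pos \<alpha>_less by (intro tendsto_intros LIMSEQ_power_zero) auto
    then have "limsup (\<lambda>T. ereal (V x0 + \<alpha> ^ T * C)) = ereal (V x0)"
      by (intro lim_imp_Limsup) auto
    finally show ?thesis by (simp add: total_cost_def)
  qed
  then have "(SUP \<gamma>. total_cost \<alpha> A B E Q R lam wbar \<pi> \<gamma> x0) \<le> ereal (V x0)"
    by (intro SUP_least)
  then show ?thesis
    unfolding game_value_def by (intro INF_lower2[of \<pi>]) auto
qed

text \<open>The maximizer plays the saddle points of the game that ends after \<open>T\<close> stages, and
  \<open>wbar\<close> afterwards, so that all later costs are nonnegative.\<close>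

lemma vi_le_game_value: "ereal (vi T x0) \<le> game_value \<alpha> A B E Q R lam wbar x0"
  unfolding game_value_def
proof (rule INF_greatest)
  fix \<pi> :: "('n, 'm) min_strategy"
  define opt where "opt i x = (case pol (vi_P i) (vi_g i) of (K, r, L, l) \<Rightarrow> L *v x + l)" for i x
  define \<gamma> :: "('n, 'm, 'd) max_strategy"
    where "\<gamma> h x u = (if length h < T then opt (T - Suc (length h)) x else wbar)" for h x u
  have opt: "vi (Suc i) x \<le> ahead (vi i) x u (opt i x)" for i x u
  proof -
    obtain K r L l where pol: "pol (vi_P i) (vi_g i) = (K, r, L, l)" by (metis prod.exhaust)
    note st = pol_stationary[OF admissible_vi pol, of x]
    show ?thesis
      using saddle_point(2)[OF admissible_vi st, of "vi_c i" u]
        stationary_value[OF admissible_vi st, of "vi_c i"]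
      by (simp add: vi_def opt_def pol)
  qed
  let ?x = "\<lambda>k. snd (play A B E \<pi> \<gamma> x0 k)"
  let ?c = "play_cost A B E Q R lam wbar \<pi> \<gamma> x0"
  have step: "vi (T - k) (?x k) \<le> ?c k + \<alpha> * vi (T - Suc k) (?x (Suc k))" if "k < T" for k
  proof -
    obtain h x where hx: "play A B E \<pi> \<gamma> x0 k = (h, x)" by (metis prod.exhaust)
    then have "length h = k" using length_play[of \<pi> \<gamma> x0 k] by simp
    then show ?thesis
      unfolding play_cost_ahead[OF hx]
      using opt[of "T - Suc k" x "\<pi> h x"] that by (simp add: hx \<gamma>_def Suc_diff_Suc)
  qed
  have before: "vi T x0 \<le> (\<Sum>j<k. \<alpha> ^ j * ?c j) + \<alpha> ^ k * vi (T - k) (?x k)" if "k \<le> T" for k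
    using that
  proof (induction k)
    case (Suc k)
    have "\<alpha> ^ k * vi (T - k) (?x k) \<le> \<alpha> ^ k * (?c k + \<alpha> * vi (T - Suc k) (?x (Suc k)))"
      using step[of k] Suc.prems \<alpha>_pos by (intro mult_left_mono) auto
    then show ?case
      using Suc by (simp add: algebra_simps del: play.simps)
  qed simp
  have after: "0 \<le> ?c k" if "T \<le> k" for k
  proof -
    obtain h x where hx: "play A B E \<pi> \<gamma> x0 k = (h, x)" by (metis prod.exhaust)
    then have "length h = k" using length_play[of \<pi> \<gamma> x0 k] by simp
    then show ?thesis
      using that psd_Q pd_imp_psd[OF pd_R]
      by (simp add: play_cost_def hx \<gamma>_def stage_cost_def psd_def Let_def)
  qed
  have "vi T x0 \<le> (\<Sum>j<n. \<alpha> ^ j * ?c j)" if "T \<le> n" for n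
  proof -
    have "vi T x0 \<le> (\<Sum>j<T. \<alpha> ^ j * ?c j)"
      using before[of T] by (simp add: vi_0)
    also have "\<dots> \<le> (\<Sum>j<n. \<alpha> ^ j * ?c j)"
      using that after \<alpha>_pos by (intro sum_mono2) auto
    finally show ?thesis .
  qed
  then have "eventually (\<lambda>n. ereal (vi T x0) \<le> ereal (\<Sum>j<n. \<alpha> ^ j * ?c j)) sequentially"
    by (auto simp: eventually_sequentially)
  then have "limsup (\<lambda>n. ereal (vi T x0)) \<le> total_cost \<alpha> A B E Q R lam wbar \<pi> \<gamma> x0"
    unfolding total_cost_def by (rule Limsup_mono)
  then have "ereal (vi T x0) \<le> total_cost \<alpha> A B E Q R lam wbar \<pi> \<gamma> x0"
    by (simp add: Limsup_const)
  then show "ereal (vi T x0) \<le> (SUP \<gamma>. total_cost \<alpha> A B E Q R lam wbar \<pi> \<gamma> x0)"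
    by (intro SUP_upper2[of \<gamma>]) auto
qed

lemma game_value_eq: "game_value \<alpha> A B E Q R lam wbar x0 = ereal (V x0)"
proof (rule antisym[OF game_value_le])
  have "(\<lambda>T. ereal (vi T x0)) \<longlonglongrightarrow> ereal (V x0)"
    using vi_tendsto by simp
  then show "ereal (V x0) \<le> game_value \<alpha> A B E Q R lam wbar x0"
    by (rule LIMSEQ_le_const2) (use vi_le_game_value in auto)
qed

lemma game_Q_eq:
  "game_Q \<alpha> A B E Q R lam wbar x u w = ereal (evec x u w \<bullet> (H_matrix \<alpha> lam A B E Q R P *v evec x u w)
    + G_vector \<alpha> lam A B E wbar g \<bullet> evec x u w + (\<alpha> * c_fix - lam * (wbar \<bullet> wbar)))"
  unfolding ahead_quad[OF symmetric_P, symmetric]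
  by (simp add: game_Q_def game_value_eq ahead_def V_def)

end

subsection \<open>Quadratic features and least squares\<close>

lemma param_H_symmetric: "transpose (param_H \<theta>) = param_H \<theta>"
  by (simp add: param_H_def transpose_def vec_eq_iff Upair_inject) (metis Upair_inject)

lemma param_of_param_H:
  fixes \<theta> :: "'q::finite param"
  shows "param_of (param_H \<theta>) (param_G \<theta>) (\<theta> $ Inr (Inr ())) = \<theta>"
proof -
  have *: "{(x, y). Upair x y = Upair a b} = {(a,b),(b,a)}" for a b :: 'q by auto
  have "(\<Sum>(x, y) | Upair x y = p. param_H \<theta> $ x $ y) = \<theta> $ Inl p" for p
  proof (cases p)
    case (Upair a b)
    have "Upair b a = Upair a b" by simp
    then have "\<theta> $ Inl (Upair b a) = \<theta> $ Inl (Upair a b)" by (rule arg_cong)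
    then show ?thesis
      unfolding Upair * by (cases "a = b") (simp_all add: param_H_def)
  qed
  then show ?thesis
    by (simp add: param_of_def param_G_def join_def vec_eq_iff split: sum.split)
qed

text \<open>A parameter orthogonal to every feature is a quadratic polynomial that vanishes
  identically. Its constant is the value at 0, its linear part vanishes by comparing
  \<open>e\<close> with \<open>- e\<close>, and a symmetric matrix whose form is zero is zero by
  \<open>psd_kernel\<close>.\<close>

lemma span_features: "span (range feature) = (UNIV :: 'q::finite param set)"
proof (rule ccontr)
  assume "\<not> ?thesis"
  then have "dim (range feature :: 'q param set) < DIM('q param)"
    using dim_eq_full dim_subset_UNIV le_neq_implies_less by blast
  then obtain \<theta> :: "'q param" where \<theta>: "\<theta> \<noteq> 0" "\<And>y. y \<in> span (range feature) \<Longrightarrow> orthogonal \<theta> y"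
    using orthogonal_to_subspace_exists by blast
  define H G s where "H = param_H \<theta>" and "G = param_G \<theta>" and "s = \<theta> $ Inr (Inr ())"
  have zero: "e \<bullet> (H *v e) + G \<bullet> e + s = 0" for e
    using \<theta>(2)[OF span_base[OF rangeI], of e] param_of_feature[of H G s e]
    by (simp add: H_def G_def s_def param_of_param_H orthogonal_def)
  have s: "s = 0" using zero[of 0] by simp
  have "G \<bullet> e = 0" for e
    using zero[of e] zero[of "- e"] s by (simp add: matrix_vector_mult_minus)
  then have G: "G = 0" using inner_eq_zero_iff by blast
  have H0: "e \<bullet> (H *v e) = 0" for e
    using zero[of e] s G by simp
  then have "psd H" by (simp add: psd_def H_def param_H_symmetric)
  then have "H *v e = 0" for e using psd_kernel H0 by blast
  then have "H = 0" by (simp add: matrix_eq)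
  moreover have "param_of (0 :: real^'q^'q) 0 0 = 0"
    by (simp add: param_of_def vec_eq_iff join_def split: sum.split)
  ultimately have "\<theta> = 0"
    using param_of_param_H[of \<theta>] G s unfolding H_def G_def s_def by simp
  then show False using \<theta>(1) by simp
qed

text \<open>The test vectors against which convergence holds form a subspace. As the features span,
  pointwise convergence of the Q-functions is convergence of every coordinate of the
  parameter.\<close>

lemma tendsto_param:
  fixes \<theta> :: "nat \<Rightarrow> 'q::finite param"
  assumes "\<And>e. (\<lambda>i. \<theta> i \<bullet> feature e) \<longlonglongrightarrow> \<theta>' \<bullet> feature e"
  shows "\<theta> \<longlonglongrightarrow> \<theta>'"
proof -
  have sub: "subspace {y. (\<lambda>i. \<theta> i \<bullet> y) \<longlonglongrightarrow> \<theta>' \<bullet> y}"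
    by (auto simp: subspace_def inner_add_right intro!: tendsto_intros)
  have "y \<in> {y. (\<lambda>i. \<theta> i \<bullet> y) \<longlonglongrightarrow> \<theta>' \<bullet> y}" for y
    using span_minimal[OF _ sub, of "range feature"] assms by (auto simp: span_features)
  then have "(\<lambda>i. \<theta> i \<bullet> axis j 1) \<longlonglongrightarrow> \<theta>' \<bullet> axis j 1" for j
    by simp
  then show ?thesis
    by (intro vec_tendstoI) (simp add: inner_axis)
qed

lemma gram_mult:
  fixes f :: "'i \<Rightarrow> real^'k"
  shows "(\<Sum>k\<in>I. outer (f k)) *v y = (\<Sum>k\<in>I. (f k \<bullet> y) *\<^sub>R f k)"
proof -
  have "outer z *v y = (z \<bullet> y) *\<^sub>R z" for z
    by (simp add: outer_def matrix_vector_mult_def inner_vec_def vec_eq_iff sum_distrib_left sum_distrib_right mult_ac)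
  moreover have "(\<Sum>k\<in>I. X k) *v y = (\<Sum>k\<in>I. X k *v y)" for X :: "'i \<Rightarrow> real^'k^'k"
    by (induction I rule: infinite_finite_induct) (simp_all add: matrix_vector_mult_add_rdistrib)
  ultimately show ?thesis by simp
qed

lemma gram_injective:
  fixes f :: "nat \<Rightarrow> real^'k"
  assumes "span (f ` I) = UNIV" and "finite I" and "(\<Sum>k\<in>I. outer (f k)) *v y = 0"
  shows "y = 0"
proof -
  have "(\<Sum>k\<in>I. (f k \<bullet> y)\<^sup>2) = y \<bullet> ((\<Sum>k\<in>I. outer (f k)) *v y)"
    by (simp add: gram_mult inner_sum_right power2_eq_square inner_commute)
  also have "\<dots> = 0" using assms(3) by simp
  finally have "\<forall>k\<in>I. (f k \<bullet> y)\<^sup>2 = 0"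
    using assms(2) by (subst (asm) sum_nonneg_eq_0_iff) auto
  then have "orthogonal y z" if "z \<in> f ` I" for z
    using that by (auto simp: orthogonal_def inner_commute)
  then have "orthogonal y y"
    using orthogonal_to_span[of y "f ` I" y] assms(1) by auto
  then show ?thesis by (simp add: orthogonal_self)
qed

lemma gram_span:
  fixes f :: "nat \<Rightarrow> real^'k"
  assumes "det (\<Sum>k\<in>I. outer (f k)) \<noteq> 0"
  shows "span (f ` I) = UNIV"
proof -
  have "invertible (\<Sum>k\<in>I. outer (f k))"
    using assms by (simp add: invertible_det_nz)
  then have "\<exists>y. (\<Sum>k\<in>I. outer (f k)) *v y = z" for z
    by (metis invertible_def matrix_vector_mul_assoc matrix_vector_mul_lid)
  then have "z \<in> span (f ` I)" for z
    unfolding gram_mult by (metis (no_types, lifting) image_eqI span_base span_scale span_sum)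
  then show ?thesis by auto
qed

lemma span_gram:
  fixes f :: "nat \<Rightarrow> real^'k"
  assumes "span (f ` I) = UNIV" and "finite I"
  shows "det (\<Sum>k\<in>I. outer (f k)) \<noteq> 0"
  using gram_injective[OF assms] inverse_of_injective(1)
  by (metis invertible_det_nz invertible_right_inverse)

lemma least_squares_exact:
  fixes f :: "nat \<Rightarrow> real^'k"
  assumes "span (f ` I) = UNIV" and "finite I"
  shows "matrix_inv (\<Sum>k\<in>I. outer (f k)) *v (\<Sum>k\<in>I. (f k \<bullet> \<theta>) *\<^sub>R f k) = \<theta>"
  unfolding gram_mult[symmetric]
  by (rule inverse_mult_vec(2)) (rule gram_injective[OF assms])

section \<open>Exactness of the learning rounds\<close>

definition sample_feature ::
  "real^'n^'n \<Rightarrow> real^'m^'n \<Rightarrow> real^'d^'n \<Rightarrow> ('n::finite, 'm::finite, 'd::finite) policies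
     \<Rightarrow> real^'n \<Rightarrow> (nat \<Rightarrow> real^'m) \<Rightarrow> (nat \<Rightarrow> real^'d) \<Rightarrow> nat \<Rightarrow> ('n + 'm + 'd) param"
where
  "sample_feature A B E p x0 o1 o2 k =
     (let (K, r, L, l) = p; x = trajectory A B E p o1 o2 x0 k
      in feature (evec x (K *v x + r + o1 k) (L *v x + l + o2 k)))"

context lq_solution
begin

text \<open>A Q-function is one lookahead beyond its value function: the parameter at
  \<open>Suc i\<close> encodes \<open>ahead (vi i)\<close>. Entry 0 is the initialization of the
  algorithm; its zero parameter represents \<open>vi 0\<close>, whatever the policies.\<close>

fun exact_iterate :: "nat \<Rightarrow> ('n + 'm + 'd) param \<times> ('n, 'm, 'd) policies" where
  "exact_iterate 0 = (0, (0, 0, 0, 0))"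
| "exact_iterate (Suc i) = (q_param (vi_P i) (vi_g i) (vi_c i), pol (vi_P i) (vi_g i))"

lemma symmetric_vi: "transpose (vi_P i) = vi_P i"
  using admissible_vi by (simp add: admissible_def psd_def)

lemma exact_iterate_value:
  assumes "exact_iterate i = (\<theta>, (K, r, L, l))"
  shows "param_Q \<theta> x (K *v x + r) (L *v x + l) = vi i x"
proof (cases i)
  case 0
  then show ?thesis using assms by (simp add: param_Q_def vi_0)
next
  case (Suc j)
  then have p: "pol (vi_P j) (vi_g j) = (K, r, L, l)" and \<theta>: "\<theta> = q_param (vi_P j) (vi_g j) (vi_c j)"
    using assms by auto
  show ?thesis
    unfolding \<theta> param_Q_q_param[OF symmetric_vi]
    using stationary_value[OF admissible_vi pol_stationary[OF admissible_vi p]]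
    by (simp add: Suc vi_def)
qed

text \<open>Each target uses the observed next state and inputs without exploration noise, so it
  equals \<open>ahead (vi i)\<close> at the sampled point. That is a linear functional of the
  feature, which least squares recovers.\<close>

lemma fit_exact:
  assumes "span (sample_feature A B E p x0 o1 o2 ` {..<M}) = UNIV" and "exact_iterate i = (\<theta>, p)"
  shows "fit \<alpha> A B E Q R lam wbar M x0 o1 o2 \<theta> p = q_param (vi_P i) (vi_g i) (vi_c i)"
proof -
  obtain K r L l where p: "p = (K, r, L, l)" by (metis prod.exhaust)
  define x where "x = trajectory A B E p o1 o2 x0"
  define u where "u k = K *v x k + r + o1 k" for k
  define w where "w k = L *v x k + l + o2 k" for k
  define f where "f k = feature (evec (x k) (u k) (w k))" for k
  let ?\<theta> = "q_param (vi_P i) (vi_g i) (vi_c i)"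
  have f: "f = sample_feature A B E p x0 o1 o2"
    by (simp add: fun_eq_iff f_def sample_feature_def x_def u_def w_def p Let_def)
  have "x (Suc k) = next_state A B E (x k) (u k) (w k)" for k
    by (simp add: x_def u_def w_def p Let_def)
  then have "stage_cost Q R lam wbar (x k) (u k) (w k)
      + \<alpha> * param_Q \<theta> (x (Suc k)) (K *v x (Suc k) + r) (L *v x (Suc k) + l) = f k \<bullet> ?\<theta>" for k
    using exact_iterate_value[of i \<theta> K r L l] assms(2) param_Q_q_param[OF symmetric_vi, of i "vi_g i" "vi_c i" "x k" "u k" "w k"]
    by (simp add: p ahead_def param_Q_def f_def inner_commute vi_def)
  then have "fit \<alpha> A B E Q R lam wbar M x0 o1 o2 \<theta> p
      = matrix_inv (\<Sum>k<M. outer (f k)) *v (\<Sum>k<M. (f k \<bullet> ?\<theta>) *\<^sub>R f k)"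
    unfolding fit_def Let_def p by (simp add: f_def u_def w_def x_def p)
  also have "\<dots> = ?\<theta>"
    using assms(1) by (intro least_squares_exact) (simp_all add: f)
  finally show ?thesis .
qed

lemma q_learning_exact:
  assumes "\<And>i. span (sample_feature A B E (snd (exact_iterate i)) x0 (o1 i) (o2 i) ` {..<M}) = UNIV"
  shows "q_learning \<alpha> A B E Q R lam wbar M x0 o1 o2 i = exact_iterate i"
proof (induction i)
  case (Suc i)
  obtain \<theta> p where e: "exact_iterate i = (\<theta>, p)" by (metis prod.exhaust)
  have "fit \<alpha> A B E Q R lam wbar M x0 (o1 i) (o2 i) \<theta> p = q_param (vi_P i) (vi_g i) (vi_c i)"
    by (rule fit_exact[OF _ e]) (use assms[of i] e in simp)
  then show ?case
    using Suc by (simp add: e policies_of_q_param[OF symmetric_vi])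
qed simp

lemma exact_iterate_tendsto: "(\<lambda>i. fst (exact_iterate i)) \<longlonglongrightarrow> q_param P g c_fix"
proof -
  have "(\<lambda>i. fst (exact_iterate (Suc i))) \<longlonglongrightarrow> q_param P g c_fix"
  proof (rule tendsto_param)
    fix e :: "real^('n + 'm + 'd)"
    obtain x uw where e1: "e = join x uw" by (rule join_surj)
    obtain u w where e2: "uw = join u w" by (rule join_surj)
    have e: "e = evec x u w" by (simp add: e1 e2 evec_def)
    have "(\<lambda>i. ahead (vi i) x u w) \<longlonglongrightarrow> ahead V x u w"
      unfolding ahead_def by (intro tendsto_intros vi_tendsto)
    then show "(\<lambda>i. fst (exact_iterate (Suc i)) \<bullet> feature e) \<longlonglongrightarrow> q_param P g c_fix \<bullet> feature e"
      using param_Q_q_param[OF symmetric_vi, of _ _ _ x u w] param_Q_q_param[OF symmetric_P, of g c_fix x u w]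
      by (simp add: param_Q_def e vi_def V_def)
  qed
  then show ?thesis by (rule LIMSEQ_imp_Suc)
qed

end

subsection \<open>Zeros of polynomials have measure zero\<close>

lemma real_polynomial_finite_zeros:
  fixes h :: "real \<Rightarrow> real"
  assumes "real_polynomial_function h" and "h a \<noteq> 0"
  shows "finite {t. h t = 0}"
proof -
  obtain c n where h: "h = (\<lambda>x. \<Sum>i\<le>n. c i * x ^ i)"
    using real_polynomial_function_imp_sum[OF assms(1)] by blast
  then have "\<exists>i\<le>n. c i \<noteq> 0"
    using assms(2) by (metis (no_types, lifting) atMost_iff mult_zero_left sum.neutral)
  then show ?thesis
    unfolding h by (subst polyfun_finite_roots)
qed

text \<open>Along every line through a point where \<open>f\<close> does not vanish there are finitely many zeros, so by
  Fubini's theorem almost every homothety with that centre maps almost every point to a nonzero of \<open>f\<close>.\<close>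

lemma AE_real_polynomial_nonzero:
  fixes f :: "'b::euclidean_space \<Rightarrow> real"
  assumes poly: "real_polynomial_function f" and a: "f a \<noteq> 0"
  shows "AE y in lborel. f y \<noteq> 0"
proof -
  have cont: "continuous_on UNIV f"
    using continuous_real_polymonial_function[OF poly] by (simp add: continuous_on_eq_continuous_at)
  then have f [measurable]: "f \<in> borel_measurable borel"
    by (rule borel_measurable_continuous_onI)
  have meas: "{z \<in> space (lborel \<Otimes>\<^sub>M lborel). f (a + fst z *\<^sub>R snd z) \<noteq> 0} \<in> sets (lborel \<Otimes>\<^sub>M (lborel :: 'b measure))"
    by measurable
  have "AE t in lborel. f (a + t *\<^sub>R x) \<noteq> 0" for x
  proof -
    have "polynomial_function (\<lambda>t::real. a + t *\<^sub>R x)"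
      by (intro polynomial_function_add polynomial_function_const polynomial_function_mult polynomial_function_id)
    then have "real_polynomial_function (f \<circ> (\<lambda>t. a + t *\<^sub>R x))"
      by (rule real_polynomial_function_compose[OF _ poly])
    then have "finite {t. f (a + t *\<^sub>R x) = 0}"
      using real_polynomial_finite_zeros[of "f \<circ> (\<lambda>t. a + t *\<^sub>R x)" 0] a by (simp add: comp_def)
    then have "{t. f (a + t *\<^sub>R x) = 0} \<in> null_sets lborel"
      by (rule finite_imp_null_set_lborel)
    then show ?thesis
      by (rule AE_I'[where N = "{t. f (a + t *\<^sub>R x) = 0}"]) auto
  qed
  then have "AE t in lborel. AE x in (lborel :: 'b measure). f (a + t *\<^sub>R x) \<noteq> 0"
    by (subst lborel_pair.AE_commute[OF meas]) simp
  moreover have "AE t in lborel. t \<noteq> (0::real)"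
    by (rule AE_lborel_singleton)
  ultimately have ae: "AE t in lborel. t \<noteq> (0::real) \<and> (AE x in (lborel :: 'b measure). f (a + t *\<^sub>R x) \<noteq> 0)"
    by eventually_elim simp
  have "ae_filter (lborel :: real measure) \<noteq> bot"
    by (simp add: ae_filter_eq_bot_iff)
  then obtain t :: real where t: "t \<noteq> 0" "AE x in (lborel :: 'b measure). f (a + t *\<^sub>R x) \<noteq> 0"
    using eventually_happens'[OF _ ae] by blast
  \<comment> \<open>Up to the factor \<open>\<bar>t\<bar> ^ DIM('b)\<close>, Lebesgue measure is its
    own image under the homothety, so the statement about images of points becomes one about
    points.\<close>
  have "AE y in distr lborel borel (\<lambda>x. a + t *\<^sub>R x). f y \<noteq> 0"
    by (subst AE_distr_iff) (use t(2) in auto)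
  then have "AE y in density (distr lborel borel (\<lambda>x. a + t *\<^sub>R x)) (\<lambda>_. \<bar>t\<bar> ^ DIM('b)). f y \<noteq> 0"
    by (subst AE_density) auto
  then show ?thesis
    by (simp only: lborel_affine[OF t(1), symmetric])
qed

text \<open>Measures of this kind are determined by their values on rectangles. The lemma serves
  twice: for a block of noises against the next noise, and for the two components of one
  noise.\<close>

lemma (in prob_space) distr_pair_indep:
  assumes X [measurable]: "X \<in> measurable M S" and Y [measurable]: "Y \<in> measurable M T"
    and "\<And>C D. C \<in> sets S \<Longrightarrow> D \<in> sets T \<Longrightarrow>
      prob ((X -` C \<inter> space M) \<inter> (Y -` D \<inter> space M)) = prob (X -` C \<inter> space M) * prob (Y -` D \<inter> space M)"
  shows "distr M S X \<Otimes>\<^sub>M distr M T Y = distr M (S \<Otimes>\<^sub>M T) (\<lambda>\<omega>. (X \<omega>, Y \<omega>))"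
proof -
  interpret DX: prob_space "distr M S X" by (rule prob_space_distr) measurable
  interpret DY: prob_space "distr M T Y" by (rule prob_space_distr) measurable
  show ?thesis
  proof (rule pair_measure_eqI)
    show "sigma_finite_measure (distr M S X)" "sigma_finite_measure (distr M T Y)" ..
    fix C D assume C: "C \<in> sets (distr M S X)" and D: "D \<in> sets (distr M T Y)"
    have C': "C \<in> sets S" and D': "D \<in> sets T" using C D by simp_all
    have "(\<lambda>\<omega>. (X \<omega>, Y \<omega>)) -` (C \<times> D) \<inter> space M = (X -` C \<inter> space M) \<inter> (Y -` D \<inter> space M)"
      by auto
    then show "emeasure (distr M S X) C * emeasure (distr M T Y) D
        = emeasure (distr M (S \<Otimes>\<^sub>M T) (\<lambda>\<omega>. (X \<omega>, Y \<omega>))) (C \<times> D)"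
      using C' D' assms(3)[OF C' D']
      by (simp add: emeasure_distr emeasure_eq_measure ennreal_mult)
  qed (simp cong: sets_pair_measure_cong)
qed

text \<open>The coordinates of a point \<open>s\<close> where \<open>f\<close> does not vanish are replaced one after the other
  by the random ones.\<close>

lemma (in prob_space) AE_polynomial_of_indep_nonzero:
  fixes Z :: "nat \<Rightarrow> 'a \<Rightarrow> 'b::euclidean_space" and f :: "(nat \<Rightarrow> 'b) \<Rightarrow> real"
  assumes indep: "indep_vars (\<lambda>_. borel) Z UNIV"
    and abs_cont: "\<And>k N. N \<in> null_sets lborel \<Longrightarrow> AE \<omega> in M. Z k \<omega> \<notin> N"
    and meas: "f \<in> borel_measurable (PiM UNIV (\<lambda>_. borel))"
    and poly: "\<And>s k. real_polynomial_function (\<lambda>y. f (s(k := y)))"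
    and dep: "\<And>s s'. (\<And>k. k < n \<Longrightarrow> s k = s' k) \<Longrightarrow> f s = f s'"
    and nonzero: "f s \<noteq> 0"
  shows "AE \<omega> in M. f (\<lambda>k. Z k \<omega>) \<noteq> 0"
proof -
  have Z [measurable]: "Z k \<in> borel_measurable M" for k
    using indep by (simp add: indep_vars_def)
  have ae: "AE \<omega> in M. f (\<lambda>k. if k < j then Z k \<omega> else s k) \<noteq> 0" for j
  proof (induction j)
    case (Suc j)
    let ?S = "PiM {..<j} (\<lambda>_. borel :: 'b measure)"
    define X where "X \<omega> = restrict (\<lambda>k. Z k \<omega>) {..<j}" for \<omega>
    \<comment> \<open>\<open>x\<close> supplies the coordinates before \<open>j\<close>, which are
      random already, \<open>y\<close> the one being exchanged, and \<open>s\<close> the later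
      ones.\<close>
    define h where "h x y = f (\<lambda>k. if k < j then x k else if k = j then y else s k)" for x y
    have X [measurable]: "X \<in> measurable M ?S"
      unfolding X_def by measurable
    have "indep_var ?S X (PiM {j} (\<lambda>_. borel)) (\<lambda>\<omega>. restrict (\<lambda>k. Z k \<omega>) {j})"
      unfolding X_def by (rule indep_var_restrict[OF indep]) auto
    then have ind: "distr M ?S X \<Otimes>\<^sub>M distr M borel (Z j) = distr M (?S \<Otimes>\<^sub>M borel) (\<lambda>\<omega>. (X \<omega>, Z j \<omega>))"
    proof (intro distr_pair_indep)
      fix C :: "(nat \<Rightarrow> 'b) set" and D :: "'b set"
      assume ind: "indep_var ?S X (PiM {j} (\<lambda>_. borel)) (\<lambda>\<omega>. restrict (\<lambda>k. Z k \<omega>) {j})"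
        and C: "C \<in> sets ?S" and D [measurable]: "D \<in> sets borel"
      define D' where "D' = {x \<in> space (PiM {j} (\<lambda>_. borel :: 'b measure)). x j \<in> D}"
      let ?W = "\<lambda>\<omega>. restrict (\<lambda>k. Z k \<omega>) {j}"
      have "D' \<in> sets (PiM {j} (\<lambda>_. borel))"
        unfolding D'_def by measurable
      then have b: "?W -` D' \<inter> space M \<in> sigma_sets (space M) {?W -` A \<inter> space M |A. A \<in> sets (PiM {j} (\<lambda>_. borel))}"
        by (intro sigma_sets.Basic) blast
      have a: "X -` C \<inter> space M \<in> sigma_sets (space M) {X -` A \<inter> space M |A. A \<in> sets ?S}"
        using C by (intro sigma_sets.Basic) blast
      have "\<forall>a\<in>sigma_sets (space M) {X -` A \<inter> space M |A. A \<in> sets ?S}.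
          \<forall>b\<in>sigma_sets (space M) {?W -` A \<inter> space M |A. A \<in> sets (PiM {j} (\<lambda>_. borel))}.
            prob (a \<inter> b) = prob a * prob b"
        using ind unfolding indep_var_eq indep_sets2_eq by (elim conjE)
      from bspec[OF bspec[OF this a] b]
      have "prob ((X -` C \<inter> space M) \<inter> (?W -` D' \<inter> space M)) = prob (X -` C \<inter> space M) * prob (?W -` D' \<inter> space M)" .
      moreover have "(\<lambda>\<omega>. restrict (\<lambda>k. Z k \<omega>) {j}) -` D' = Z j -` D"
        by (auto simp: D'_def space_PiM)
      ultimately show "prob ((X -` C \<inter> space M) \<inter> (Z j -` D \<inter> space M))
          = prob (X -` C \<inter> space M) * prob (Z j -` D \<inter> space M)" by simp
    qed measurable
    interpret DX: prob_space "distr M ?S X" by (rule prob_space_distr) measurable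
    interpret DZ: prob_space "distr M borel (Z j)" by (rule prob_space_distr) measurable
    have h [measurable]: "(\<lambda>z. h (fst z) (snd z)) \<in> borel_measurable (?S \<Otimes>\<^sub>M borel)"
    proof -
      have "(\<lambda>z. (if k < j then fst z k else if k = j then snd z else s k)) \<in> borel_measurable (?S \<Otimes>\<^sub>M borel)" for k
        by (cases "k < j") (auto intro: measurable_compose[OF measurable_fst measurable_component_singleton])
      then have "(\<lambda>z k. (if k < j then fst z k else if k = j then snd z else s k)) \<in> measurable (?S \<Otimes>\<^sub>M borel) (PiM UNIV (\<lambda>_. borel))"
        by (intro measurable_PiM_single') auto
      then show ?thesis unfolding h_def by (rule measurable_compose[OF _ meas])
    qed
    define W where "W = {z \<in> space (?S \<Otimes>\<^sub>M borel). h (fst z) (snd z) = 0}"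
    have W [measurable]: "W \<in> sets (?S \<Otimes>\<^sub>M borel)"
      unfolding W_def by measurable
    have W': "W \<in> sets (?S \<Otimes>\<^sub>M distr M borel (Z j))"
      using W by (simp cong: sets_pair_measure_cong)
    \<comment> \<open>If \<open>f\<close> is nonzero before the exchange, then
      \<open>h (X \<omega>)\<close> is a polynomial that is nonzero at \<open>s j\<close>. Its zeros
      form a Lebesgue null set, which \<open>Z j\<close> avoids almost surely.\<close>
    have slice: "emeasure (distr M borel (Z j)) (Pair (X \<omega>) -` W) = 0"
      if "f (\<lambda>k. if k < j then Z k \<omega> else s k) \<noteq> 0" "\<omega> \<in> space M" for \<omega>
    proof -
      let ?s = "\<lambda>k. if k < j then Z k \<omega> else s k"
      have X\<omega>: "X \<omega> \<in> space ?S" by (rule measurable_space[OF X that(2)])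
      have h_eq: "h (X \<omega>) y = f (?s(j := y))" for y
        unfolding h_def by (intro arg_cong[where f = f]) (auto simp: X_def)
      have "h (X \<omega>) (s j) \<noteq> 0"
        using that(1) unfolding h_eq by (simp add: fun_upd_idem)
      then have "AE y in lborel. h (X \<omega>) y \<noteq> 0"
        using AE_real_polynomial_nonzero[OF poly, of ?s j "s j"] unfolding h_eq by simp
      moreover have N: "Pair (X \<omega>) -` W = {y. h (X \<omega>) y = 0}"
        using X\<omega> by (auto simp: W_def space_pair_measure)
      moreover have NW: "Pair (X \<omega>) -` W \<in> sets borel"
        by (rule sets_Pair1[OF W])
      ultimately have "Pair (X \<omega>) -` W \<in> null_sets lborel"
        by (subst (asm) AE_iff_null) auto
      then have "AE \<omega>' in M. Z j \<omega>' \<notin> Pair (X \<omega>) -` W" by (rule abs_cont)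
      moreover have *: "{\<omega>' \<in> space M. \<not> Z j \<omega>' \<notin> Pair (X \<omega>) -` W} = Z j -` (Pair (X \<omega>) -` W) \<inter> space M"
        by auto
      ultimately have "emeasure M (Z j -` (Pair (X \<omega>) -` W) \<inter> space M) = 0"
        using measurable_sets[OF Z NW, of j] by (subst (asm) AE_iff_measurable[OF _ *]) auto
      then show ?thesis
        using NW by (simp add: emeasure_distr)
    qed
    have "emeasure (distr M (?S \<Otimes>\<^sub>M borel) (\<lambda>\<omega>. (X \<omega>, Z j \<omega>))) W
        = (\<integral>\<^sup>+ x. emeasure (distr M borel (Z j)) (Pair x -` W) \<partial>distr M ?S X)"
      unfolding ind[symmetric]
      by (rule DZ.emeasure_pair_measure_alt) (use W in \<open>simp cong: sets_pair_measure_cong\<close>)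
    also have "\<dots> = (\<integral>\<^sup>+ \<omega>. emeasure (distr M borel (Z j)) (Pair (X \<omega>) -` W) \<partial>M)"
      by (rule nn_integral_distr[OF X]) (simp add: DZ.measurable_emeasure_Pair[OF W'])
    also have "\<dots> = (\<integral>\<^sup>+ \<omega>. 0 \<partial>M)"
    proof (rule nn_integral_cong_AE)
      show "AE \<omega> in M. emeasure (distr M borel (Z j)) (Pair (X \<omega>) -` W) = 0"
        using Suc AE_space
      proof eventually_elim
        case (elim \<omega>)
        then show ?case by (rule slice)
      qed
    qed
    finally have "emeasure M ((\<lambda>\<omega>. (X \<omega>, Z j \<omega>)) -` W \<inter> space M) = 0"
      by (simp add: emeasure_distr)
    then have "AE \<omega> in M. (X \<omega>, Z j \<omega>) \<notin> W"
      by (intro AE_I[where N = "(\<lambda>\<omega>. (X \<omega>, Z j \<omega>)) -` W \<inter> space M"]) auto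
    then have "AE \<omega> in M. h (X \<omega>) (Z j \<omega>) \<noteq> 0"
      using AE_space
    proof eventually_elim
      case (elim \<omega>)
      then show ?case
        using measurable_space[OF X, of \<omega>] by (simp add: W_def space_pair_measure)
    qed
    moreover have "h (X \<omega>) (Z j \<omega>) = f (\<lambda>k. if k < Suc j then Z k \<omega> else s k)" for \<omega>
      unfolding h_def by (intro arg_cong[where f = f]) (auto simp: X_def less_Suc_eq)
    ultimately show ?case by simp
  qed (use nonzero in simp)
  have "f (\<lambda>k. if k < n then Z k \<omega> else s k) = f (\<lambda>k. Z k \<omega>)" for \<omega>
    by (rule dep) simp
  then show ?thesis using ae[of n] by simp
qed

subsection \<open>The exploration noises\<close>

lemma Int_stable_vimage: "Int_stable {W -` S \<inter> X | S. S \<in> sets N}"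
proof (rule Int_stableI)
  fix a b assume "a \<in> {W -` S \<inter> X | S. S \<in> sets N}" "b \<in> {W -` S \<inter> X | S. S \<in> sets N}"
  then obtain S T where "a = W -` S \<inter> X" "b = W -` T \<inter> X" "S \<in> sets N" "T \<in> sets N" by blast
  then have "a \<inter> b = W -` (S \<inter> T) \<inter> X" "S \<inter> T \<in> sets N" by auto
  then show "a \<inter> b \<in> {W -` S \<inter> X | S. S \<in> sets N}" by blast
qed

text \<open>The index set is cut into blocks \<open>{Inl (i, k), Inr (i, k)}\<close>. Disjoint
  blocks of intersection-stable families generate independent sigma-algebras, and each pair is
  measurable with respect to that of its block.\<close>

lemma (in prob_space) indep_vars_noise_pairs:
  fixes X :: "nat \<Rightarrow> nat \<Rightarrow> 'a \<Rightarrow> real^'m" and Y :: "nat \<Rightarrow> nat \<Rightarrow> 'a \<Rightarrow> real^'d"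
  assumes indep: "indep_noises X Y"
    and [measurable]: "\<And>i k. X i k \<in> borel_measurable M" "\<And>i k. Y i k \<in> borel_measurable M"
  shows "indep_vars (\<lambda>_. borel) (\<lambda>k \<omega>. (X i k \<omega>, Y i k \<omega>)) UNIV"
proof -
  define F where "F = (\<lambda>j. case j of
       Inl (i, k) \<Rightarrow> {X i k -` S \<inter> space M | S. S \<in> sets borel}
     | Inr (i, k) \<Rightarrow> {Y i k -` S \<inter> space M | S. S \<in> sets borel})"
  define I where "I k = {Inl (i, k), Inr (i, k)}" for k :: nat
  have "indep_sets F UNIV"
    using indep by (simp add: indep_noises_def F_def)
  then have "indep_sets F (\<Union> (range I))"
    by (rule indep_sets_mono_index[rotated]) simp
  moreover have "Int_stable (F j)" for j
    unfolding F_def by (cases j) (auto intro: Int_stable_vimage)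
  moreover have "disjoint_family I" by (auto simp: disjoint_family_on_def I_def)
  ultimately have "indep_sets (\<lambda>k. sigma_sets (space M) (\<Union> (F ` I k))) UNIV"
    by (intro indep_sets_collect_sigma)
  moreover have "{(\<lambda>\<omega>. (X i k \<omega>, Y i k \<omega>)) -` S \<inter> space M | S. S \<in> sets borel} \<subseteq> sigma_sets (space M) (\<Union> (F ` I k))" for k
  proof -
    let ?G = "\<Union> (F ` I k)"
    let ?N = "sigma (space M) ?G"
    have G: "?G \<subseteq> Pow (space M)" by (auto simp: F_def I_def)
    have sets: "sets ?N = sigma_sets (space M) ?G" and space: "space ?N = space M"
      using G by (simp_all add: space_measure_of_conv)
    have X: "X i k \<in> borel_measurable ?N"
    proof (rule measurableI)
      fix S :: "(real^'m) set" assume "S \<in> sets borel"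
      then have "X i k -` S \<inter> space M \<in> ?G" by (auto simp: F_def I_def)
      then show "X i k -` S \<inter> space ?N \<in> sets ?N" unfolding space sets by (rule sigma_sets.Basic)
    qed simp
    have Y: "Y i k \<in> borel_measurable ?N"
    proof (rule measurableI)
      fix S :: "(real^'d) set" assume "S \<in> sets borel"
      then have "Y i k -` S \<inter> space M \<in> ?G" by (auto simp: F_def I_def)
      then show "Y i k -` S \<inter> space ?N \<in> sets ?N" unfolding space sets by (rule sigma_sets.Basic)
    qed simp
    have XY: "(\<lambda>\<omega>. (X i k \<omega>, Y i k \<omega>)) \<in> borel_measurable ?N"
      by (rule borel_measurable_Pair[OF X Y])
    have "(\<lambda>\<omega>. (X i k \<omega>, Y i k \<omega>)) -` S \<inter> space M \<in> sigma_sets (space M) ?G" if "S \<in> sets borel" for S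
      using measurable_sets[OF XY that] by (simp only: space sets)
    then show ?thesis by blast
  qed
  ultimately have "indep_sets (\<lambda>k. {(\<lambda>\<omega>. (X i k \<omega>, Y i k \<omega>)) -` S \<inter> space M | S. S \<in> sets borel}) UNIV"
    by (rule indep_sets_mono_sets)
  then show ?thesis
    unfolding indep_vars_def2 by simp
qed

text \<open>Independence of the two components gives the pair the product density, so its law is
  absolutely continuous on the product space.\<close>

lemma (in prob_space) AE_noise_pair_notin:
  fixes X :: "nat \<Rightarrow> nat \<Rightarrow> 'a \<Rightarrow> real^'m" and Y :: "nat \<Rightarrow> nat \<Rightarrow> 'a \<Rightarrow> real^'d"
  assumes indep: "indep_noises X Y"
    and X: "distributed M lborel (X i k) p" and Y: "distributed M lborel (Y i k) p'"
    and N: "N \<in> null_sets lborel"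
  shows "AE \<omega> in M. (X i k \<omega>, Y i k \<omega>) \<notin> N"
proof -
  have XY [measurable]: "X i k \<in> borel_measurable M" "Y i k \<in> borel_measurable M"
    using X Y by (auto dest: distributed_measurable)
  define F where "F = (\<lambda>j. case j of
       Inl (i, k) \<Rightarrow> {X i k -` S \<inter> space M | S. S \<in> sets borel}
     | Inr (i, k) \<Rightarrow> {Y i k -` S \<inter> space M | S. S \<in> sets borel})"
  have F: "indep_sets F UNIV"
    using indep by (simp add: indep_noises_def F_def)
  have "prob ((X i k -` C \<inter> space M) \<inter> (Y i k -` D \<inter> space M))
      = prob (X i k -` C \<inter> space M) * prob (Y i k -` D \<inter> space M)"
    if "C \<in> sets lborel" "D \<in> sets lborel" for C D
  proof -
    define a where "a = X i k -` C \<inter> space M"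
    define b where "b = Y i k -` D \<inter> space M"
    have "a \<in> F (Inl (i, k))" "b \<in> F (Inr (i, k))"
      using that by (auto simp: F_def a_def b_def)
    then have "\<forall>j\<in>{Inl (i, k), Inr (i, k)}. case_sum (\<lambda>_. a) (\<lambda>_. b) j \<in> F j" by simp
    from indep_setsD[OF F _ _ _ this] show ?thesis
      by (simp add: a_def b_def)
  qed
  then have "distr M lborel (X i k) \<Otimes>\<^sub>M distr M lborel (Y i k)
      = distr M (lborel \<Otimes>\<^sub>M lborel) (\<lambda>\<omega>. (X i k \<omega>, Y i k \<omega>))"
    by (intro distr_pair_indep) (use XY in simp_all)
  then have "distributed M (lborel \<Otimes>\<^sub>M lborel) (\<lambda>\<omega>. (X i k \<omega>, Y i k \<omega>)) (\<lambda>(x, y). p x * p' y)"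
    by (intro distributed_joint_indep' X Y lborel.sigma_finite_measure_axioms)
  then have D: "distributed M lborel (\<lambda>\<omega>. (X i k \<omega>, Y i k \<omega>)) (\<lambda>(x, y). p x * p' y)"
    by (simp add: lborel_prod)
  have "AE z in lborel. z \<notin> N" using N by (rule AE_not_in)
  moreover have [measurable]: "N \<in> sets borel" using N by auto
  ultimately show ?thesis
    using distributed_AE2[OF D, of "\<lambda>z. z \<notin> N"] by auto
qed

subsection \<open>Ranks along lines\<close>

lemma real_polynomial_det:
  fixes X :: "'b::real_normed_vector \<Rightarrow> real^'p^'p"
  assumes "\<And>i j. real_polynomial_function (\<lambda>t. X t $ i $ j)"
  shows "real_polynomial_function (\<lambda>t. det (X t))"
  unfolding det_def
  by (intro real_polynomial_function_sum real_polynomial_function.intros(4) real_polynomial_function.intros(2)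
      real_polynomial_function_prod assms) (auto simp: finite_permutations)

text \<open>A basis \<open>C\<close> chosen among the vectors at \<open>t0\<close> is completed by
  constant vectors to a square matrix, whose determinant is a polynomial in \<open>t\<close> that is
  nonzero at \<open>t0\<close>. Where it is nonzero, the constant rows account for only
  \<open>card (D - C)\<close> dimensions, so the moving vectors have rank at least
  \<open>card C\<close>.\<close>

lemma finite_rank_drop:
  fixes v :: "'i \<Rightarrow> real \<Rightarrow> real^'p"
  assumes "finite I" and poly: "\<And>i a. i \<in> I \<Longrightarrow> real_polynomial_function (\<lambda>t. v i t $ a)"
  shows "finite {t. dim ((\<lambda>i. v i t) ` I) < dim ((\<lambda>i. v i t0) ` I)}"
proof -
  obtain C where C: "C \<subseteq> (\<lambda>i. v i t0) ` I" "independent C" "(\<lambda>i. v i t0) ` I \<subseteq> span C"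
      "card C = dim ((\<lambda>i. v i t0) ` I)"
    by (rule basis_exists)
  obtain D where D: "C \<subseteq> D" "D \<subseteq> UNIV" "independent D" "UNIV \<subseteq> span D"
    by (rule maximal_independent_subset_extend[OF subset_UNIV C(2)])
  have fin: "finite D" using D(3) by (rule independent_imp_finite)
  have "card D = dim (UNIV :: (real^'p) set)"
    using D(3,4) by (intro basis_card_eq_dim) auto
  then have cD: "card D = CARD('p)" by simp
  then obtain \<phi> where \<phi>: "bij_betw \<phi> (UNIV :: 'p set) D"
    using finite_same_card_bij[of "UNIV :: 'p set" D] fin by auto
  have "\<forall>c\<in>C. \<exists>i\<in>I. v i t0 = c" using C(1) by auto
  then obtain idx where idx: "\<And>c. c \<in> C \<Longrightarrow> idx c \<in> I \<and> v (idx c) t0 = c" by metis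
  define X where "X t = (\<chi> r. if \<phi> r \<in> C then v (idx (\<phi> r)) t else \<phi> r)" for t
  have "rows (X t0) = D"
  proof -
    have "row r (X t0) = \<phi> r" for r using idx by (simp add: row_def X_def)
    then show ?thesis using \<phi> by (auto simp: rows_def bij_betw_def)
  qed
  then have "det (X t0) \<noteq> 0"
    using cD D(3) by (simp add: det_eq_0_rank row_rank_def dim_eq_card_independent)
  moreover have "real_polynomial_function (\<lambda>t. X t $ i $ j)" for i j
    using poly idx by (cases "\<phi> i \<in> C") (simp_all add: X_def real_polynomial_function.intros(2))
  ultimately have zeros: "finite {t. det (X t) = 0}"
    by (intro real_polynomial_finite_zeros[of _ t0] real_polynomial_det)
  have "dim ((\<lambda>i. v i t0) ` I) \<le> dim ((\<lambda>i. v i t) ` I)" if "det (X t) \<noteq> 0" for t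
  proof -
    let ?W = "(\<lambda>i. v i t) ` I"
    obtain T where T: "T \<subseteq> ?W" "independent T" "?W \<subseteq> span T" "card T = dim ?W"
      by (rule basis_exists)
    have finT: "finite T" using T(2) by (rule independent_imp_finite)
    have "row r (X t) \<in> span (T \<union> (D - C))" for r
    proof (cases "\<phi> r \<in> C")
      case True
      then have "row r (X t) \<in> ?W" using idx by (simp add: row_def X_def)
      then show ?thesis using T(3) span_mono[of T "T \<union> (D - C)"] by blast
    next
      case False
      then have "row r (X t) \<in> D - C" using bij_betwE[OF \<phi>] by (simp add: row_def X_def)
      then show ?thesis by (intro span_base) simp
    qed
    then have "dim (rows (X t)) \<le> card (T \<union> (D - C))"
      using fin finT by (intro dim_le_card) (auto simp: rows_def)
    also have "\<dots> \<le> card T + card (D - C)" by (rule card_Un_le)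
    also have "card (D - C) = card D - card C"
      using D(1) fin by (simp add: card_Diff_subset finite_subset)
    finally have "CARD('p) \<le> dim ?W + (CARD('p) - card C)"
      using that by (simp add: det_eq_0_rank row_rank_def T(4) cD)
    moreover have "card C \<le> CARD('p)" using card_mono[OF fin D(1)] cD by simp
    ultimately show ?thesis using C(4) by simp
  qed
  then have "{t. dim ((\<lambda>i. v i t) ` I) < dim ((\<lambda>i. v i t0) ` I)} \<subseteq> {t. det (X t) = 0}"
    by (auto simp: not_le[symmetric])
  then show ?thesis using zeros by (rule finite_subset)
qed

lemma real_polynomial_feature:
  fixes e :: "'b::real_normed_vector \<Rightarrow> real^'q"
  assumes "\<And>a. real_polynomial_function (\<lambda>t. e t $ a)"
  shows "real_polynomial_function (\<lambda>t. feature (e t) $ j)"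
proof (cases j)
  case (Inl p)
  obtain a b where "p = Upair a b" by (cases p)
  then show ?thesis
    using assms by (simp add: Inl feature_def join_def monomial_Upair real_polynomial_function.intros(4))
next
  case (Inr c)
  then show ?thesis
    using assms by (cases c) (simp_all add: feature_def join_def real_polynomial_function.intros(2))
qed

subsection \<open>Free trajectories\<close>

text \<open>The initial state is left arbitrary, so that the trajectories form a shift-invariant linear space.\<close>

context lq_game
begin

definition state :: "real^('n + 'm + 'd) \<Rightarrow> real^'n" where
  "state e = (\<chi> i. e $ Inl i)"

definition next_matrix :: "real^('n + 'm + 'd)^'n" where
  "next_matrix = row_block A (row_block B E)"

definition free_trajectories :: "(nat \<Rightarrow> real^('n + 'm + 'd)) set" where
  "free_trajectories = {e. \<forall>k. state (e (Suc k)) = next_matrix *v e k}"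

lemma state_evec [simp]: "state (evec x u w) = x"
  by (simp add: state_def evec_def join_def vec_eq_iff)

lemma next_matrix_evec: "next_matrix *v evec x u w = next_state A B E x u w"
  by (simp add: next_matrix_def evec_def row_block_mult next_state_def add.assoc)

lemma state_line: "state (s *\<^sub>R a + t *\<^sub>R b) = s *\<^sub>R state a + t *\<^sub>R state b"
  by (simp add: state_def vec_eq_iff)

lemma free_line:
  "a \<in> free_trajectories \<Longrightarrow> b \<in> free_trajectories \<Longrightarrow> (\<lambda>k. s *\<^sub>R a k + t *\<^sub>R b k) \<in> free_trajectories"
  by (simp add: free_trajectories_def state_line matrix_vector_right_distrib matrix_vector_mult_scaleR)

lemma free_shift: "e \<in> free_trajectories \<Longrightarrow> (\<lambda>k. e (k + j)) \<in> free_trajectories"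
  by (simp add: free_trajectories_def)

text \<open>On the kernel of \<open>transpose B\<close> the form of \<open>S\<close> is
  \<open>- (transpose E *v z) \<bullet> (transpose E *v z) / lam\<close>, so definiteness of
  \<open>S\<close> makes this kernel trivial. Every state can then be reached from every other in
  one step.\<close>

lemma B_surj: obtains u where "B *v u = y"
proof -
  have "z = 0" if "transpose B *v z = 0" for z
  proof -
    have "z \<bullet> (S *v z) = - ((transpose E *v z) \<bullet> (transpose E *v z)) / lam"
      using that by (simp add: S_def matrix_vector_simps inner_diff_right inner_mult_right[of z E])
    also have "\<dots> \<le> 0" using lam_pos by (simp add: divide_nonneg_pos)
    finally show ?thesis using S_pd by (meson leD pd_def)
  qed
  then have "\<exists>X. X ** transpose B = mat 1"
    by (simp add: matrix_left_invertible_ker)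
  then have "\<exists>X. B ** X = mat 1"
    by (metis left_invertible_transpose transpose_transpose)
  then show thesis
    using that by (metis matrix_vector_mul_assoc matrix_vector_mul_lid)
qed

lemma steer: obtains u where "next_matrix *v evec x u 0 = y"
proof -
  obtain u where "B *v u = y - A *v x" by (rule B_surj)
  then have "next_matrix *v evec x u 0 = y" by (simp add: next_matrix_evec next_state_def)
  then show thesis by (rule that)
qed

lemma free_extend:
  assumes "e \<in> free_trajectories" and "next_matrix *v y = state (e 0)"
  shows "case_nat y e \<in> free_trajectories"
  using assms by (auto simp: free_trajectories_def split: nat.split)

lemma free_visit:
  assumes "finite G"
  obtains e n where "e \<in> free_trajectories" "G \<subseteq> e ` {..<n::nat}"
proof -
  have "\<exists>e\<in>free_trajectories. \<exists>n::nat. G \<subseteq> e ` {..<n}"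
    using assms
  proof (induction G rule: finite_induct)
    case empty
    have "(\<lambda>_. 0) \<in> free_trajectories"
      by (simp add: free_trajectories_def state_def vec_eq_iff)
    then show ?case by blast
  next
    case (insert z G)
    then obtain e n where e: "e \<in> free_trajectories" "G \<subseteq> e ` {..<n::nat}" by blast
    obtain u where u: "next_matrix *v evec (next_matrix *v z) u 0 = state (e 0)" by (rule steer)
    \<comment> \<open>The state following \<open>z\<close> is forced, so one intermediate point is
      inserted whose input steers to the start of \<open>e\<close>.\<close>
    define e' where "e' = case_nat z (case_nat (evec (next_matrix *v z) u 0) e)"
    have "e' \<in> free_trajectories"
      unfolding e'_def by (intro free_extend e u) simp
    moreover have "insert z G \<subseteq> e' ` {..<Suc (Suc n)}"
    proof -
      have "z \<in> e' ` {..<Suc (Suc n)}"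
        by (rule image_eqI[of _ _ 0]) (simp_all add: e'_def)
      moreover have "y \<in> e' ` {..<Suc (Suc n)}" if y: "y \<in> G" for y
      proof -
        obtain k where "y = e k" "k < n" using e(2) y by blast
        then show ?thesis by (intro image_eqI[of _ _ "Suc (Suc k)"]) (simp_all add: e'_def)
      qed
      ultimately show ?thesis by blast
    qed
    ultimately show ?case by blast
  qed
  then show thesis using that by blast
qed

definition feature_rank :: "(nat \<Rightarrow> real^('n + 'm + 'd)) \<Rightarrow> nat set \<Rightarrow> nat" where
  "feature_rank e T = dim ((\<lambda>k. feature (e k)) ` T)"

text \<open>On the line joining two trajectories, each rank falls below its value at an endpoint for
  finitely many parameters only. Any other point of the line meets the bounds of both endpoints at
  once.\<close>

lemma feature_rank_generic:
  assumes "finite W" and "\<And>T. T \<in> W \<Longrightarrow> finite T \<and> (\<exists>e\<in>free_trajectories. r T \<le> feature_rank e T)"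
  shows "\<exists>e\<in>free_trajectories. \<forall>T\<in>W. r T \<le> feature_rank e T"
  using assms
proof (induction W rule: finite_induct)
  case empty
  show ?case using free_visit[of "{}"] by blast
next
  case (insert T W)
  then obtain a where a: "a \<in> free_trajectories" "\<And>U. U \<in> W \<Longrightarrow> r U \<le> feature_rank a U" by auto
  obtain b where b: "b \<in> free_trajectories" "r T \<le> feature_rank b T" using insert.prems by blast
  define c where "c t k = (1 - t) *\<^sub>R a k + t *\<^sub>R b k" for t k
  have c: "c t \<in> free_trajectories" for t
    unfolding c_def using free_line[OF a(1) b(1)] by simp
  have poly: "real_polynomial_function (\<lambda>t. feature (c t k) $ j)" for k j
  proof (rule real_polynomial_feature)
    fix j
    have "real_polynomial_function (\<lambda>t. (1 - t) * a k $ j + t * b k $ j)"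
      by (intro real_polynomial_function.intros(2-4) real_polynomial_function_diff
          real_polynomial_function.intros(1)[OF bounded_linear_ident])
    then show "real_polynomial_function (\<lambda>t. c t k $ j)" by (simp add: c_def)
  qed
  have drop: "finite {t. feature_rank (c t) U < feature_rank (c t0) U}" if "finite U" for U t0
    unfolding feature_rank_def by (rule finite_rank_drop[OF that poly])
  have "finite ((\<Union>U\<in>W. {t. feature_rank (c t) U < feature_rank (c 0) U}) \<union> {t. feature_rank (c t) T < feature_rank (c 1) T})"
    using insert by (intro finite_UnI finite_UN_I drop) auto
  then obtain t where t: "t \<notin> (\<Union>U\<in>W. {t. feature_rank (c t) U < feature_rank (c 0) U}) \<union> {t. feature_rank (c t) T < feature_rank (c 1) T}"
    using ex_new_if_finite infinite_UNIV_char_0 by blast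
  have "c 0 = a" "c 1 = b" by (simp_all add: c_def fun_eq_iff)
  then have "r U \<le> feature_rank (c t) U" if "U \<in> insert T W" for U
  proof (cases "U = T")
    case True
    then show ?thesis using t b(2) \<open>c 1 = b\<close> by (simp add: not_less)
  next
    case False
    then have "U \<in> W" using that by simp
    then show ?thesis using t a(2)[of U] \<open>c 0 = a\<close> by (auto simp: not_less intro: order_trans)
  qed
  then show ?case using c by blast
qed

lemma feature_rank_le: "feature_rank e T \<le> CARD(('n + 'm + 'd) uprod + ('n + 'm + 'd) + unit)"
  unfolding feature_rank_def using dim_subset_UNIV_cart by blast

lemma feature_rank_shift: "feature_rank (\<lambda>k. e (k + j)) {0..<k} = feature_rank e {j..<j + k}"
proof -
  have "feature_rank (\<lambda>k. e (k + j)) {0..<k} = dim ((\<lambda>k. feature (e k)) ` ((\<lambda>k. k + j) ` {0..<k}))"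
    by (simp only: feature_rank_def image_image)
  also have "(\<lambda>k. k + j) ` {0..<k} = {j..<j + k}"
    by (simp add: add.commute)
  finally show ?thesis by (simp only: feature_rank_def)
qed

text \<open>Reachability in one step lets a trajectory be prolonged into the past: each prepended
  point has state 0 and an input that hits the old initial state.\<close>

lemma feature_rank_shift_back:
  assumes "e \<in> free_trajectories"
  shows "\<exists>e'\<in>free_trajectories. feature_rank e' {j..<j + k} = feature_rank e {0..<k}"
proof -
  have "\<exists>e'\<in>free_trajectories. (\<lambda>k. e' (k + j)) = e"
  proof (induction j)
    case (Suc j)
    then obtain e' where e': "e' \<in> free_trajectories" "(\<lambda>k. e' (k + j)) = e" by blast
    obtain u where u: "next_matrix *v evec 0 u 0 = state (e' 0)" by (rule steer)
    then show ?case
      using free_extend[OF e'(1) u] e'(2) by (intro bexI[of _ "case_nat (evec 0 u 0) e'"]) auto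
  qed (use assms in auto)
  then obtain e' where e': "e' \<in> free_trajectories" "(\<lambda>k. e' (k + j)) = e" by blast
  have "feature_rank e' {j..<j + k} = feature_rank e {0..<k}"
    by (simp only: feature_rank_shift[symmetric] e'(2))
  then show ?thesis using e'(1) by blast
qed

text \<open>The maximal rank of \<open>k\<close> consecutive features grows strictly with \<open>k\<close> until it is full: if it does
  not, then along a generic trajectory all windows of length \<open>k\<close> span the same space.\<close>

lemma exists_spanning_trajectory:
  obtains e where "e \<in> free_trajectories"
    "span ((\<lambda>k. feature (e k)) ` {0..<CARD(('n + 'm + 'd) uprod + ('n + 'm + 'd) + unit)}) = UNIV"
proof -
  let ?p = "CARD(('n + 'm + 'd) uprod + ('n + 'm + 'd) + unit)"
  define r where "r k = Max ((\<lambda>e. feature_rank e {0..<k}) ` free_trajectories)" for k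
  have fin: "finite ((\<lambda>e. feature_rank e {0..<k}) ` free_trajectories)" for k
    by (rule finite_subset[OF image_subsetI[OF iffD2[OF atMost_iff feature_rank_le]] finite_atMost])
  have ne: "free_trajectories \<noteq> {}"
    by (rule free_visit[of "{}"]) auto
  have r_attained: "\<exists>e\<in>free_trajectories. feature_rank e {0..<k} = r k" for k
  proof -
    have "r k \<in> (\<lambda>e. feature_rank e {0..<k}) ` free_trajectories"
      unfolding r_def using fin ne by (intro Max_in) auto
    then show ?thesis by (metis imageE)
  qed
  have r_max0: "feature_rank e {0..<k} \<le> r k" if "e \<in> free_trajectories" for e k
    unfolding r_def by (rule Max_ge[OF fin imageI[OF that]])
  have r_max: "feature_rank e {j..<j + k} \<le> r k" if "e \<in> free_trajectories" for e j k
  proof -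
    have "feature_rank (\<lambda>i. e (i + j)) {0..<k} \<le> r k"
      by (rule r_max0[OF free_shift[OF that]])
    then show ?thesis by (simp only: feature_rank_shift[of e j k])
  qed
  have r_mono: "r k \<le> r (Suc k)" for k
  proof -
    obtain e where e: "e \<in> free_trajectories" "feature_rank e {0..<k} = r k"
      using r_attained[of k] by (elim bexE)
    have "feature_rank e {0..<k} \<le> feature_rank e {0..<Suc k}"
      unfolding feature_rank_def by (rule dim_subset[OF image_mono]) auto
    then show ?thesis using e r_max0[OF e(1), of "Suc k"] by simp
  qed
  have full: "?p \<le> r k" if stop: "r (Suc k) \<le> r k" for k
  proof -
    \<comment> \<open>Finitely many points have features that form a basis. A trajectory visiting
      them has full rank on some initial segment, whose length \<open>n\<close> is not
      controlled.\<close>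
    obtain Bs :: "('n + 'm + 'd) param set" where Bs: "Bs \<subseteq> range feature" "independent Bs" "range feature \<subseteq> span Bs"
      "card Bs = dim (range feature :: ('n + 'm + 'd) param set)"
      by (rule basis_exists)
    have "finite Bs" using Bs(2) by (rule independent_imp_finite)
    then obtain G where G: "finite G" "Bs = feature ` G"
      using finite_subset_image[OF _ Bs(1)] by blast
    obtain e1 n where e1: "e1 \<in> free_trajectories" "G \<subseteq> e1 ` {..<n::nat}"
      using free_visit[OF G(1)] by blast
    have "span ((\<lambda>k. feature (e1 k)) ` {..<n}) = UNIV"
    proof -
      have "Bs \<subseteq> (\<lambda>k. feature (e1 k)) ` {..<n}" using e1(2) G(2) by blast
      then have "span Bs \<subseteq> span ((\<lambda>k. feature (e1 k)) ` {..<n})" by (rule span_mono)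
      moreover have "span Bs = UNIV"
        using span_minimal[OF Bs(3) subspace_span] by (simp add: span_features top.extremum_unique)
      ultimately show ?thesis by blast
    qed
    then have e1_full: "feature_rank e1 {..<n} = ?p"
      unfolding feature_rank_def dim_span[of "_ ` _", symmetric] by simp
    \<comment> \<open>A trajectory generic for \<open>W\<close> attains full rank on the long
      segment and, simultaneously, the maximal rank \<open>r k\<close> on every window of length
      \<open>k\<close> starting at 0 to \<open>n\<close>.\<close>
    define W where "W = insert {..<n} ((\<lambda>j. {j..<j + k}) ` {..n})"
    have "\<exists>e\<in>free_trajectories. \<forall>T\<in>W. (if T = {..<n} then feature_rank e1 {..<n} else r k) \<le> feature_rank e T"
    proof (rule feature_rank_generic)
      fix T assume T: "T \<in> W"
      show "finite T \<and> (\<exists>e\<in>free_trajectories. (if T = {..<n} then feature_rank e1 {..<n} else r k) \<le> feature_rank e T)"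
      proof (cases "T = {..<n}")
        case False
        then obtain j where j: "T = {j..<j + k}" using T by (auto simp: W_def)
        obtain e where "e \<in> free_trajectories" "feature_rank e {0..<k} = r k" using r_attained[of k] by blast
        then obtain e' where "e' \<in> free_trajectories" "r k \<le> feature_rank e' T"
          using feature_rank_shift_back[of e j k] j by auto
        moreover have "finite T" by (simp add: j)
        ultimately show ?thesis using False by (simp only: if_False) blast
      qed (use e1 in auto)
    qed (simp add: W_def)
    then obtain e where e: "e \<in> free_trajectories"
      "\<And>T. T \<in> W \<Longrightarrow> (if T = {..<n} then feature_rank e1 {..<n} else r k) \<le> feature_rank e T" by blast
    let ?f = "\<lambda>k. feature (e k)"
    \<comment> \<open>If the segment \<open>{..<n}\<close> is itself one of the windows, then that
      window has full rank and the claim is immediate; otherwise the required rank on every window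
      is \<open>r k\<close>.\<close>
    show ?thesis
    proof (cases "{..<n} \<in> (\<lambda>j. {j..<j + k}) ` {..n}")
      case True
      then obtain j where "{..<n} = {j..<j + k}" by blast
      then have "?p \<le> feature_rank e {j..<j + k}" using e(2)[of "{..<n}"] e1_full by (simp add: W_def)
      then show ?thesis using r_max[OF e(1), of j k] by simp
    next
      case False
      have win: "feature_rank e {j..<j + k} = r k" if "j \<le> n" for j
      proof -
        have "{j..<j + k} \<in> W" "{j..<j + k} \<noteq> {..<n}" using False that by (auto simp: W_def)
        then show ?thesis using e(2)[of "{j..<j + k}"] r_max[OF e(1), of j k] by simp
      qed
      \<comment> \<open>A window of length \<open>Suc k\<close> has rank at most
        \<open>r (Suc k) \<le> r k\<close>, so each of its two subwindows of length \<open>k\<close>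
        already spans it. Consecutive windows therefore span the same space.\<close>
      have ext: "span (?f ` {j'..<j' + k}) = span (?f ` {j..<j + Suc k})" if "j \<le> n" "j' \<in> {j, Suc j}" "j' \<le> n" for j j'
      proof (rule dim_eq_span)
        show "?f ` {j'..<j' + k} \<subseteq> ?f ` {j..<j + Suc k}" using that by (intro image_mono) auto
        show "dim (?f ` {j..<j + Suc k}) \<le> dim (?f ` {j'..<j' + k})"
          using r_max[OF e(1), of j "Suc k"] stop win[OF that(3)] by (simp add: feature_rank_def)
      qed
      have same: "span (?f ` {j..<j + k}) = span (?f ` {0..<k})" if "j \<le> n" for j
        using that
      proof (induction j)
        case (Suc j)
        then show ?case using ext[of j j] ext[of j "Suc j"] by simp
      qed simp
      have "?f j \<in> span (?f ` {0..<k})" if "j < n" for j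
      proof -
        have "?f j \<in> span (?f ` {j..<j + Suc k})" by (intro span_base) auto
        then show ?thesis using ext[of j j] same[of j] that by simp
      qed
      then have "dim (?f ` {..<n}) \<le> dim (span (?f ` {0..<k}))"
        by (intro dim_subset) auto
      also have "\<dots> = r k" using win[of 0] by (simp add: feature_rank_def dim_span)
      also have "dim (?f ` {..<n}) = feature_rank e {..<n}" by (simp add: feature_rank_def)
      finally show ?thesis using e(2)[of "{..<n}"] e1_full by (simp add: W_def)
    qed
  qed
  have growth: "k \<le> r k \<or> ?p \<le> r k" for k
  proof (induction k)
    case (Suc k)
    show ?case
    proof (cases "r (Suc k) \<le> r k")
      case True
      then show ?thesis using full[OF True] r_mono[of k] by linarith
    next
      case False
      then show ?thesis using Suc r_mono[of k] by linarith
    qed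
  qed simp
  obtain e where e: "e \<in> free_trajectories" "feature_rank e {0..<?p} = r ?p"
    using r_attained[of ?p] by (elim bexE)
  have "span ((\<lambda>k. feature (e k)) ` {0..<?p}) = span UNIV"
  proof (rule dim_eq_span)
    have "?p \<le> feature_rank e {0..<?p}"
      unfolding e(2) using growth[of ?p] by (elim disjE)
    then show "dim (UNIV :: ('n + 'm + 'd) param set) \<le> dim ((\<lambda>k. feature (e k)) ` {0..<?p})"
      by (simp only: feature_rank_def dim_UNIV DIM_cart DIM_real mult.right_neutral)
  qed simp
  then have "span ((\<lambda>k. feature (e k)) ` {0..<?p}) = UNIV"
    by (simp only: span_UNIV)
  then show thesis by (rule that[OF e(1)])
qed

end

context lq_game
begin

text \<open>A freely chosen noise can cancel the feedback, so every free trajectory starting in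
  \<open>x0\<close> is realized under any affine policy. The threshold on \<open>M\<close> is the
  number of parameters, and its strictness provides the extra sample for steering.\<close>

lemma exists_exciting_noise:
  assumes "real M > 1 / 2 * (real (CARD('n) + CARD('m) + CARD('d)) + 1) * (real (CARD('n) + CARD('m) + CARD('d)) + 2)"
  shows "\<exists>o1 o2. span (sample_feature A B E p x0 o1 o2 ` {..<M}) = UNIV"
proof -
  let ?d = "CARD(('n + 'm + 'd) uprod + ('n + 'm + 'd) + unit)"
  obtain e where e: "e \<in> free_trajectories" "span ((\<lambda>k. feature (e k)) ` {0..<?d}) = UNIV"
    by (rule exists_spanning_trajectory)
  have M: "?d < M"
  proof -
    define q where "q = CARD('n) + CARD('m) + CARD('d)"
    have 1: "CARD(('n + 'm + 'd) uprod) = q * (q + 1) div 2"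
      by (simp add: card_UNIV_uprod q_def add.assoc)
    have 2: "?d = CARD(('n + 'm + 'd) uprod) + (q + 1)" by (simp add: q_def)
    have less: "t < M" if u: "u = q * (q + 1) div 2" and t: "t = u + (q + 1)" for t u
    proof -
      have "2 * u = q * (q + 1)" using u by simp
      then have "2 * t = (q + 1) * (q + 2)" by (simp add: t algebra_simps)
      then have "real (2 * t) = real ((q + 1) * (q + 2))" by (rule arg_cong)
      then have "2 * real t = (real q + 1) * (real q + 2)"
        by (simp only: of_nat_mult of_nat_add of_nat_1 of_nat_numeral)
      then show ?thesis using assms[folded q_def] by simp
    qed
    show ?thesis by (rule less[OF 1 2])
  qed
  \<comment> \<open>\<open>D\<close> hides the cardinality of the parameter index type from further
    simplification.\<close>
  obtain D where D: "D < M" "span ((\<lambda>k. feature (e k)) ` {0..<D}) = UNIV"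
    by (rule that[OF M e(2)])
  obtain u0 where u0: "next_matrix *v evec x0 u0 0 = state (e 0)" by (rule steer)
  define e' where "e' = case_nat (evec x0 u0 0) e"
  have e': "e' \<in> free_trajectories"
    unfolding e'_def by (rule free_extend[OF e(1) u0])
  obtain K r L l where p: "p = (K, r, L, l)" by (metis prod.exhaust)
  define x where "x k = state (e' k)" for k
  \<comment> \<open>The noise is the prescribed input less the feedback, so that the sampled points
    are those of \<open>e'\<close>.\<close>
  define o1 where "o1 k = (\<chi> i. e' k $ Inr (Inl i)) - (K *v x k + r)" for k
  define o2 where "o2 k = (\<chi> i. e' k $ Inr (Inr i)) - (L *v x k + l)" for k
  have e'_eq: "evec (x k) (K *v x k + r + o1 k) (L *v x k + l + o2 k) = e' k" for k
    by (simp add: o1_def o2_def x_def state_def evec_def join_def vec_eq_iff split: sum.split)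
  have traj: "trajectory A B E p o1 o2 x0 k = x k" for k
  proof (induction k)
    case 0
    show ?case by (simp add: x_def e'_def)
  next
    case (Suc k)
    have "trajectory A B E p o1 o2 x0 (Suc k) = next_matrix *v e' k"
      using Suc by (simp add: p Let_def next_matrix_evec[symmetric] e'_eq)
    then show ?case using e' by (simp add: free_trajectories_def x_def)
  qed
  have same: "sample_feature A B E p x0 o1 o2 k = feature (e' k)" for k
    using traj[of k] by (simp add: sample_feature_def p Let_def e'_eq)
  have "(\<lambda>k. feature (e k)) ` {0..<D} \<subseteq> sample_feature A B E p x0 o1 o2 ` {..<M}"
  proof (rule image_subsetI)
    fix k assume "k \<in> {0..<D}"
    then have "Suc k \<in> {..<M}" using D(1) by simp
    moreover have "feature (e k) = sample_feature A B E p x0 o1 o2 (Suc k)" by (simp add: same e'_def)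
    ultimately show "feature (e k) \<in> sample_feature A B E p x0 o1 o2 ` {..<M}" by (simp only: imageI)
  qed
  from span_mono[OF this] have "span (sample_feature A B E p x0 o1 o2 ` {..<M}) = UNIV"
    unfolding D(2) by (rule top.extremum_uniqueI)
  then show ?thesis by blast
qed

end

subsection \<open>Almost sure excitation\<close>

text \<open>The Gram determinant belongs to this class. Its measurability, its dependence on finitely many noises
  only, and its being a polynomial in each single noise then follow by induction.\<close>

inductive_set noise_poly :: "nat \<Rightarrow> ((nat \<Rightarrow> (real^'m) \<times> (real^'d)) \<Rightarrow> real) set" for n :: nat where
  const: "(\<lambda>_. c) \<in> noise_poly n"
| coord1: "k < n \<Longrightarrow> (\<lambda>s. fst (s k) $ a) \<in> noise_poly n"
| coord2: "k < n \<Longrightarrow> (\<lambda>s. snd (s k) $ b) \<in> noise_poly n"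
| add: "f \<in> noise_poly n \<Longrightarrow> f' \<in> noise_poly n \<Longrightarrow> (\<lambda>s. f s + f' s) \<in> noise_poly n"
| mult: "f \<in> noise_poly n \<Longrightarrow> f' \<in> noise_poly n \<Longrightarrow> (\<lambda>s. f s * f' s) \<in> noise_poly n"

lemma noise_poly_sum:
  assumes "\<And>i. i \<in> I \<Longrightarrow> f i \<in> noise_poly n"
  shows "(\<lambda>s. \<Sum>i\<in>I. f i s) \<in> noise_poly n"
  using assms by (induction I rule: infinite_finite_induct) (auto intro: noise_poly.intros(1,4))

lemma noise_poly_prod:
  assumes "\<And>i. i \<in> I \<Longrightarrow> f i \<in> noise_poly n"
  shows "(\<lambda>s. \<Prod>i\<in>I. f i s) \<in> noise_poly n"
  using assms by (induction I rule: infinite_finite_induct) (auto intro: noise_poly.intros(1,5))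

lemma noise_poly_mult_vec:
  assumes "\<And>j. (\<lambda>s. f s $ j) \<in> noise_poly n"
  shows "(\<lambda>s. (X *v f s) $ i) \<in> noise_poly n"
  unfolding matrix_vector_mult_def vec_lambda_beta
  by (intro noise_poly_sum noise_poly.mult noise_poly.const assms)

lemma noise_poly_det:
  assumes "\<And>i j. (\<lambda>s. X s $ i $ j) \<in> noise_poly n"
  shows "(\<lambda>s. det (X s)) \<in> noise_poly n"
  unfolding det_def
  by (intro noise_poly_sum noise_poly.mult noise_poly.const noise_poly_prod assms)

lemma noise_poly_polynomial:
  fixes f :: "(nat \<Rightarrow> (real^'m) \<times> (real^'d)) \<Rightarrow> real"
  assumes "f \<in> noise_poly n"
  shows "real_polynomial_function (\<lambda>y. f (s(k := y)))"
  using assms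
proof induction
  case (coord1 j a)
  have "bounded_linear (\<lambda>y :: (real^'m) \<times> (real^'d). fst y $ a)"
    by (intro bounded_linear_compose[OF bounded_linear_vec_nth bounded_linear_fst])
  then show ?case
    by (cases "j = k") (auto intro: real_polynomial_function.intros(1,2))
next
  case (coord2 j a)
  have "bounded_linear (\<lambda>y :: (real^'m) \<times> (real^'d). snd y $ a)"
    by (intro bounded_linear_compose[OF bounded_linear_vec_nth bounded_linear_snd])
  then show ?case
    by (cases "j = k") (auto intro: real_polynomial_function.intros(1,2))
qed (auto intro: real_polynomial_function.intros(2-4))

lemma noise_poly_measurable:
  fixes f :: "(nat \<Rightarrow> (real^'m) \<times> (real^'d)) \<Rightarrow> real"
  assumes "f \<in> noise_poly n"
  shows "f \<in> borel_measurable (PiM UNIV (\<lambda>_. borel))"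
  using assms
proof induction
  case (coord1 j a)
  have "continuous_on UNIV (\<lambda>y :: (real^'m) \<times> (real^'d). fst y $ a)"
    by (intro continuous_intros)
  then have "(\<lambda>y :: (real^'m) \<times> (real^'d). fst y $ a) \<in> borel_measurable borel"
    by (rule borel_measurable_continuous_onI)
  moreover have "(\<lambda>s. s j) \<in> measurable (PiM UNIV (\<lambda>_. borel)) (borel :: ((real^'m) \<times> (real^'d)) measure)"
    by (rule measurable_component_singleton) simp
  ultimately show ?case by (rule measurable_compose[rotated])
next
  case (coord2 j a)
  have "continuous_on UNIV (\<lambda>y :: (real^'m) \<times> (real^'d). snd y $ a)"
    by (intro continuous_intros)
  then have "(\<lambda>y :: (real^'m) \<times> (real^'d). snd y $ a) \<in> borel_measurable borel"
    by (rule borel_measurable_continuous_onI)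
  moreover have "(\<lambda>s. s j) \<in> measurable (PiM UNIV (\<lambda>_. borel)) (borel :: ((real^'m) \<times> (real^'d)) measure)"
    by (rule measurable_component_singleton) simp
  ultimately show ?case by (rule measurable_compose[rotated])
qed auto

lemma noise_poly_cong:
  assumes "f \<in> noise_poly n" and "\<And>k. k < n \<Longrightarrow> s k = s' k"
  shows "f s = f s'"
  using assms(1) by induction (simp_all add: assms(2))

text \<open>The state at time \<open>k\<close> involves only the noises before \<open>k\<close>,
  which is why \<open>k = n\<close> is allowed here, whereas a feature at time \<open>k\<close> also
  uses the noise at \<open>k\<close>.\<close>

lemma noise_poly_trajectory:
  assumes "k \<le> n"
  shows "(\<lambda>s. trajectory A B E p (\<lambda>k. fst (s k)) (\<lambda>k. snd (s k)) x0 k $ i) \<in> noise_poly n"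
  using assms
proof (induction k arbitrary: i)
  case 0
  then show ?case by (simp add: noise_poly.const)
next
  case (Suc k)
  obtain K r L l where p: "p = (K, r, L, l)" by (metis prod.exhaust)
  let ?x = "\<lambda>s. trajectory A B E p (\<lambda>k. fst (s k)) (\<lambda>k. snd (s k)) x0 k"
  have x: "(\<lambda>s. ?x s $ j) \<in> noise_poly n" for j using Suc by simp
  have u: "(\<lambda>s. (K *v ?x s + r + fst (s k)) $ j) \<in> noise_poly n" for j
    unfolding vector_add_component using Suc.prems
    by (intro noise_poly.add noise_poly_mult_vec x noise_poly.const noise_poly.coord1) simp
  have w: "(\<lambda>s. (L *v ?x s + l + snd (s k)) $ j) \<in> noise_poly n" for j
    unfolding vector_add_component using Suc.prems
    by (intro noise_poly.add noise_poly_mult_vec x noise_poly.const noise_poly.coord2) simp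
  have "(\<lambda>s. (A *v ?x s + B *v (K *v ?x s + r + fst (s k)) + E *v (L *v ?x s + l + snd (s k))) $ i) \<in> noise_poly n"
    unfolding vector_add_component[of "_ + _" "E *v _"] vector_add_component[of "A *v _" "B *v _"]
    by (intro noise_poly.add noise_poly_mult_vec x u w)
  then show ?case by (simp add: p Let_def next_state_def)
qed

lemma noise_poly_sample_feature:
  assumes "k < n"
  shows "(\<lambda>s. sample_feature A B E p x0 (\<lambda>k. fst (s k)) (\<lambda>k. snd (s k)) k $ i) \<in> noise_poly n"
proof -
  obtain K r L l where p: "p = (K, r, L, l)" by (metis prod.exhaust)
  let ?x = "\<lambda>s. trajectory A B E p (\<lambda>k. fst (s k)) (\<lambda>k. snd (s k)) x0 k"
  have x: "(\<lambda>s. ?x s $ j) \<in> noise_poly n" for j using assms by (simp add: noise_poly_trajectory)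
  have u: "(\<lambda>s. (K *v ?x s + r + fst (s k)) $ j) \<in> noise_poly n" for j
    unfolding vector_add_component using assms
    by (intro noise_poly.add noise_poly_mult_vec x noise_poly.const noise_poly.coord1)
  have w: "(\<lambda>s. (L *v ?x s + l + snd (s k)) $ j) \<in> noise_poly n" for j
    unfolding vector_add_component using assms
    by (intro noise_poly.add noise_poly_mult_vec x noise_poly.const noise_poly.coord2)
  define e where "e s = evec (?x s) (K *v ?x s + r + fst (s k)) (L *v ?x s + l + snd (s k))" for s
  have e: "(\<lambda>s. e s $ j) \<in> noise_poly n" for j
  proof (cases j)
    case (Inl a)
    then show ?thesis using x by (simp add: e_def evec_def join_def)
  next
    case (Inr b)
    then show ?thesis using u w by (cases b) (simp_all add: e_def evec_def join_def)
  qed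
  have "(\<lambda>s. feature (e s) $ i) \<in> noise_poly n"
  proof (cases i)
    case (Inl p)
    obtain a b where "p = Upair a b" by (cases p)
    then show ?thesis
      using e by (simp add: Inl feature_def join_def monomial_Upair noise_poly.mult)
  next
    case (Inr c)
    then show ?thesis
      using e by (cases c) (simp_all add: feature_def join_def noise_poly.const)
  qed
  moreover have "(\<lambda>s. sample_feature A B E p x0 (\<lambda>k. fst (s k)) (\<lambda>k. snd (s k)) k $ i) = (\<lambda>s. feature (e s) $ i)"
    by (simp add: sample_feature_def p Let_def e_def)
  ultimately show ?thesis by simp
qed

text \<open>For a fixed policy \<open>p\<close> the Gram determinant of round \<open>i\<close> is a
  polynomial in the noises of that round alone, and one choice of noises at which it is nonzero
  suffices.\<close>

lemma (in lq_game) AE_exciting: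
  fixes \<Omega> :: "'z measure" and o1 :: "nat \<Rightarrow> nat \<Rightarrow> 'z \<Rightarrow> real^'m" and o2 :: "nat \<Rightarrow> nat \<Rightarrow> 'z \<Rightarrow> real^'d"
  assumes \<Omega>: "prob_space \<Omega>"
    and o1: "\<And>i k. distributed \<Omega> lborel (o1 i k) \<rho>1" and o2: "\<And>i k. distributed \<Omega> lborel (o2 i k) \<rho>2"
    and indep: "prob_space.indep_noises \<Omega> o1 o2"
    and M: "real M > 1 / 2 * (real (CARD('n) + CARD('m) + CARD('d)) + 1) * (real (CARD('n) + CARD('m) + CARD('d)) + 2)"
  shows "AE \<omega> in \<Omega>. span (sample_feature A B E p x0 (\<lambda>k. o1 i k \<omega>) (\<lambda>k. o2 i k \<omega>) ` {..<M}) = UNIV"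
proof -
  interpret prob_space \<Omega> by fact
  define f where "f s = det (\<Sum>k<M. outer (sample_feature A B E p x0 (\<lambda>k. fst (s k)) (\<lambda>k. snd (s k)) k))" for s
  have f: "f \<in> noise_poly M"
    unfolding f_def outer_def
    by (intro noise_poly_det) (auto intro!: noise_poly_sum noise_poly.mult noise_poly_sample_feature)
  obtain n1 n2 where "span (sample_feature A B E p x0 n1 n2 ` {..<M}) = UNIV"
    using exists_exciting_noise[OF M] by blast
  then have nz: "f (\<lambda>k. (n1 k, n2 k)) \<noteq> 0"
    by (simp add: f_def span_gram)
  have [measurable]: "o1 i k \<in> borel_measurable \<Omega>" "o2 i k \<in> borel_measurable \<Omega>" for i k
    using distributed_measurable[OF o1] distributed_measurable[OF o2] by simp_all
  have "AE \<omega> in \<Omega>. f (\<lambda>k. (o1 i k \<omega>, o2 i k \<omega>)) \<noteq> 0"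
  proof (rule AE_polynomial_of_indep_nonzero[OF _ _ noise_poly_measurable[OF f] noise_poly_polynomial[OF f]])
    show "indep_vars (\<lambda>_. borel) (\<lambda>k \<omega>. (o1 i k \<omega>, o2 i k \<omega>)) UNIV"
      by (rule indep_vars_noise_pairs[OF indep]) measurable
    show "AE \<omega> in \<Omega>. (o1 i k \<omega>, o2 i k \<omega>) \<notin> N" if "N \<in> null_sets lborel" for k N
      by (rule AE_noise_pair_notin[OF indep o1 o2 that])
    show "f s = f s'" if "\<And>k. k < M \<Longrightarrow> s k = s' k" for s s'
      by (rule noise_poly_cong[OF f that])
    show "f (\<lambda>k. (n1 k, n2 k)) \<noteq> 0" by (rule nz)
  qed
  then show ?thesis
  proof eventually_elim
    case (elim \<omega>)
    then show ?case by (intro gram_span) (simp add: f_def)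
  qed
qed

theorem theorem5:
  fixes A :: "real^'n^'n" and B :: "real^'m^'n" and E :: "real^'d^'n"
    and Q sqrtQ P :: "real^'n^'n" and R :: "real^'m^'m"
    and \<alpha> lam :: real
    and N M :: nat and v :: "nat \<Rightarrow> real^'d" and wbar :: "real^'d"
    and g x0 :: "real^'n"
    and \<Omega> :: "'z measure"
    and o1 :: "nat \<Rightarrow> nat \<Rightarrow> 'z \<Rightarrow> real^'m" and o2 :: "nat \<Rightarrow> nat \<Rightarrow> 'z \<Rightarrow> real^'d"
  defines "q \<equiv> CARD('n) + CARD('m) + CARD('d)"
    and "H \<equiv> H_matrix \<alpha> lam A B E Q R P"
    and "G \<equiv> G_vector \<alpha> lam A B E wbar g"
  assumes "psd Q" and "pd R"
    and "0 < \<alpha>" and "\<alpha> < 1" and "0 < lam"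
    and "0 < N" and "wbar = (1 / real N) *\<^sub>R (\<Sum>j = 1..N. v j)"
    and "pd (B ** matrix_inv R ** transpose B - (1 / lam) *\<^sub>R (E ** transpose E))"
    and "psd sqrtQ" and "sqrtQ ** sqrtQ = Q" and "observable A sqrtQ"
    and "psd P" and "riccati_solution \<alpha> lam A B E Q R P"
    and "lam > Inf {\<mu>. pd (mat \<mu> - \<alpha> *\<^sub>R (transpose E ** P ** E))}"
    and "linear_term_equation \<alpha> lam A B E R wbar P g"
    and "prob_space \<Omega>"
    and "\<And>i k. distributed \<Omega> lborel (o1 i k) (\<lambda>y. ennreal (std_gaussian_density y))"
    and "\<And>i k. distributed \<Omega> lborel (o2 i k) (\<lambda>y. ennreal (std_gaussian_density y))"
    and "prob_space.indep_noises \<Omega> o1 o2"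
    and "real M > 1 / 2 * (real q + 1) * (real q + 2)"
  shows "\<exists>s::real.
    (\<forall>x u w. game_Q \<alpha> A B E Q R lam wbar x u w =
       ereal (evec x u w \<bullet> (H *v evec x u w) + G \<bullet> evec x u w + s)) \<and>
    (AE \<omega> in \<Omega>.
       (\<lambda>i. fst (q_learning \<alpha> A B E Q R lam wbar M x0 (\<lambda>i k. o1 i k \<omega>) (\<lambda>i k. o2 i k \<omega>) i))
         \<longlonglongrightarrow> param_of H G s)"
proof -
  interpret lq_game A B E Q R \<alpha> lam wbar
    using assms by unfold_locales auto
  let ?D = "\<lambda>\<mu>. mat \<mu> - \<alpha> *\<^sub>R (transpose E ** P ** E)"
  have P: "psd P" by fact
  have form: "w \<bullet> (?D \<mu> *v w) = \<mu> * (w \<bullet> w) - w \<bullet> ((\<alpha> *\<^sub>R (transpose E ** P ** E)) *v w)" for \<mu> w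
    by (simp add: matrix_vector_mult_diff_rdistrib mat_mult_vec inner_diff_right)
  have D_sym: "transpose (?D \<mu>) = ?D \<mu>" for \<mu>
    using P by (simp add: psd_def transpose_diff transpose_mat transpose_scaleR matrix_transpose_mul matrix_mul_assoc)
  \<comment> \<open>An element below \<open>lam\<close> can be extracted from the infimum only if
    the set is nonempty, as the infimum of the empty set carries no information; a bound
    \<open>K\<close> of the linear map gives the member \<open>K + 1\<close>.\<close>
  have "\<exists>\<mu>\<in>{\<mu>. pd (?D \<mu>)}. \<mu> < lam"
  proof -
    obtain \<mu>0 where "pd (?D \<mu>0)"
    proof -
      obtain K where K: "\<And>w. norm ((\<alpha> *\<^sub>R (transpose E ** P ** E)) *v w) \<le> norm w * K"
        using bounded_linear.bounded[OF matrix_vector_mul_bounded_linear] by blast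
      have "0 < w \<bullet> (?D (K + 1) *v w)" if "w \<noteq> 0" for w
      proof -
        have "w \<bullet> ((\<alpha> *\<^sub>R (transpose E ** P ** E)) *v w) \<le> norm w * (norm w * K)"
          using norm_cauchy_schwarz mult_left_mono[OF K norm_ge_zero] order_trans by blast
        also have "\<dots> = K * (w \<bullet> w)" by (simp add: dot_square_norm power2_eq_square)
        finally have "w \<bullet> ((\<alpha> *\<^sub>R (transpose E ** P ** E)) *v w) \<le> K * (w \<bullet> w)" .
        moreover have "0 < w \<bullet> w" using that by simp
        ultimately show ?thesis
          unfolding form distrib_right by linarith
      qed
      then show thesis using that D_sym unfolding pd_def by blast
    qed
    then show ?thesis
      using \<open>lam > Inf _\<close> cInf_lessD[of "{\<mu>. pd (?D \<mu>)}" lam] by blast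
  qed
  then obtain \<mu> where \<mu>: "pd (?D \<mu>)" "\<mu> < lam" by blast
  have "pd (?D lam)"
    unfolding pd_def
  proof (intro conjI allI impI)
    show "transpose (?D lam) = ?D lam" by (rule D_sym)
    fix w :: "real^'d" assume w: "w \<noteq> 0"
    have "0 < w \<bullet> (?D \<mu> *v w)" using \<mu>(1) w by (simp add: pd_def)
    also have "\<dots> \<le> w \<bullet> (?D lam *v w)"
      unfolding form using \<mu>(2) by (simp add: mult_right_mono)
    finally show "0 < w \<bullet> (?D lam *v w)" .
  qed
  then have adm: "admissible P" using P by (simp add: admissible_def)
  interpret lq_solution A B E Q R \<alpha> lam wbar P g
  proof unfold_locales
    fix x assume zero: "\<And>k. (((*v) A ^^ k) x) \<bullet> (Q *v (((*v) A ^^ k) x)) = 0"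
    have "sqrtQ *v y = 0" if "y \<bullet> (Q *v y) = 0" for y
    proof -
      have "y \<bullet> (Q *v y) = (sqrtQ *v y) \<bullet> (sqrtQ *v y)"
        using \<open>psd sqrtQ\<close> \<open>sqrtQ ** sqrtQ = Q\<close>
        by (metis inner_mult_right matrix_vector_mul_assoc psd_def)
      then show ?thesis using that by simp
    qed
    then have "sqrtQ *v (((*v) A ^^ k) x) = 0" for k
      using zero by blast
    moreover have "((*v) A ^^ k) 0 = 0" for k by (induction k) simp_all
    ultimately have "sqrtQ *v (((*v) A ^^ k) x) = sqrtQ *v (((*v) A ^^ k) 0)" for k by simp
    then show "x = 0" using \<open>observable A sqrtQ\<close> unfolding observable_def by blast
  next
    show "riccati P = P"
      using \<open>riccati_solution \<alpha> lam A B E Q R P\<close> by (simp add: riccati_solution_def riccati_def)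
    show "linear_step P g = g"
      using \<open>linear_term_equation \<alpha> lam A B E R wbar P g\<close> by (simp add: linear_term_equation_def linear_step_def)
  qed (rule adm)
  have o1: "\<And>i k. distributed \<Omega> lborel (o1 i k) (\<lambda>y. ennreal (std_gaussian_density y))"
    and o2: "\<And>i k. distributed \<Omega> lborel (o2 i k) (\<lambda>y. ennreal (std_gaussian_density y))" by fact+
  have M: "real M > 1 / 2 * (real (CARD('n) + CARD('m) + CARD('d)) + 1) * (real (CARD('n) + CARD('m) + CARD('d)) + 2)"
    using \<open>real M > _\<close> unfolding q_def .
  \<comment> \<open>The policies here are those of exact value iteration and do not depend on
    \<open>\<omega>\<close>; intersecting over the countably many rounds makes all fits exact at
    once.\<close>
  have "AE \<omega> in \<Omega>. span (sample_feature A B E (snd (exact_iterate i)) x0 (\<lambda>k. o1 i k \<omega>) (\<lambda>k. o2 i k \<omega>) ` {..<M}) = UNIV" for i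
    by (rule AE_exciting[OF \<open>prob_space \<Omega>\<close> o1 o2 \<open>prob_space.indep_noises \<Omega> o1 o2\<close> M])
  then have "AE \<omega> in \<Omega>. \<forall>i. span (sample_feature A B E (snd (exact_iterate i)) x0 (\<lambda>k. o1 i k \<omega>) (\<lambda>k. o2 i k \<omega>) ` {..<M}) = UNIV"
    by (simp add: AE_all_countable)
  then have "AE \<omega> in \<Omega>.
       (\<lambda>i. fst (q_learning \<alpha> A B E Q R lam wbar M x0 (\<lambda>i k. o1 i k \<omega>) (\<lambda>i k. o2 i k \<omega>) i))
         \<longlonglongrightarrow> param_of H G (\<alpha> * c_fix - lam * (wbar \<bullet> wbar))"
  proof eventually_elim
    case (elim \<omega>)
    then show ?case
      using q_learning_exact[of x0 "\<lambda>i k. o1 i k \<omega>" "\<lambda>i k. o2 i k \<omega>" M] exact_iterate_tendsto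
      unfolding H_def G_def by simp
  qed
  then show ?thesis
    using game_Q_eq unfolding H_def G_def by blast
qed

end
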